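(* For every $n\ge1$, let $\mu^n$ be a Borel measure on $[0,1]^n$ which is automorphism-invariant and detects pseudotruths. Then $\mu^n=\lambda^n$ for every $n\ge2$, where $\lambda^n$ is Lebesgue measure on $[0,1]^n$. If moreover the system $\{\mu^n\}_{n\ge1}$ is coherent, then also $\mu^1=\lambda^1$.
   Context: A rational polyhedral complex in $[0,1]^n$ is a finite set $W$ of compact convex polyhedra, each contained in $[0,1]^n$ with all vertices having rational coordinates, such that every face of a member of $W$ is in $W$ and any two members of $W$ intersect in a common face; $|W|$ denotes the union of its members. A McNaughton function on $[0,1]^n$ is a continuous $f:[0,1]^n\to[0,1]$ for which there exist a rational polyhedral complex $W$ with $|W|=[0,1]^n$ and, for each $n$-dimensional $C_j\in W$, an affine function $F_j(x)=a_{j1}x_1+\dots+a_{jn}x_n+a_{j(n+1)}$ with integer coefficients such that $f\restriction C_j=F_j$. $\mathrm{Free}_n$ denotes the set of McNaughton functions on $[0,1]^n$, with pointwise operations $f\oplus g=\min(1,f+g)$, $\neg f=1-f$, $f\wedge g=\min(f,g)$; for $k\ge1$, $kf=f\oplus\cdots\oplus f$ ($k$ times) $=\min(1,kf)$. A McNaughton homeomorphism of $[0,1]^n$ is a homeomorphism $S:[0,1]^n\to[0,1]^n$ for which there exist a rational polyhedral complex $W$ with $|W|=[0,1]^n$ and matrices $P_j\in\mathrm{Mat}_{n+1}(\mathbb Z)$, one for each $n$-dimensional $C_j\in W$, such that each $P_j$ has last row $(0,\dots,0,1)$, $P_j$ expresses $S\restriction C_j$ in homogeneous coordinates (if $p=(r_1,\dots,r_n)\in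 C_j$ and $S(p)=(s_1,\dots,s_n)$ then $(s_1,\dots,s_n,1)^{T}=P_j(r_1,\dots,r_n,1)^T$), and either all $P_j$ have determinant $+1$ or all have determinant $-1$. A Borel measure $\mu$ on $[0,1]^n$ is automorphism-invariant if $\mu(S^{-1}B)=\mu(B)$ for every Borel $B\subseteq[0,1]^n$ and every McNaughton homeomorphism $S$. An element $f\in\mathrm{Free}_n$ is pseudotrue if the only $g\in\mathrm{Free}_n$ with $f\wedge g=0$ is $g=0$. A Borel measure $\mu$ on $[0,1]^n$ detects pseudotruths if for every pseudotrue $f\in\mathrm{Free}_n$ one has $\sup_{k\ge1}\int kf\,d\mu=1$. The system $\{\mu^n\}$ is coherent if for every $n\ge1$, $\mu^n=\pi_*\mu^{n+1}$, where $\pi:[0,1]^{n+1}\to[0,1]^n$ is the projection onto the first $n$ coordinates and $\pi_*$ denotes push-forward. *)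

theory Defs
  imports
    "HOL-Analysis.Analysis"
    "HOL-Library.Function_Algebras"
    "Jordan_Normal_Form.Determinant"
begin

text \<open>
  The dimension \<open>n\<close> varies inside the statement, so points of n-space are functions on
  \<open>{..<n}\<close>, represented as extensional functions \<open>nat \<Rightarrow> real\<close> (value \<open>undefined\<close> outside
  \<open>{..<n}\<close>) in agreement with \<open>Pi\<^sub>E\<close> and \<open>Pi\<^sub>M\<close>.  These form an affine subspace of
  \<open>nat \<Rightarrow> real\<close> on which the product topology is the Euclidean one. With the pointwise
  vector space structure below, the library's notions \<open>convex hull\<close>, \<open>polytope\<close>,
  \<open>face_of\<close>, \<open>extreme_point_of\<close> and \<open>affine hull\<close> apply directly.
\<close>

instantiation "fun" :: (type, real_vector) real_vector
begin

definition scaleR_fun_def: "r *\<^sub>R f = (\<lambda>x. r *\<^sub>R f x)"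

instance
  by standard (simp_all add: scaleR_fun_def fun_eq_iff scaleR_add_left scaleR_add_right)

end

definition cube :: "nat \<Rightarrow> (nat \<Rightarrow> real) set" where
  "cube n = (\<Pi>\<^sub>E i\<in>{..<n}. {0..1})"

text \<open>
  The library's \<open>aff_dim\<close> requires a Euclidean space; for nonempty sets (and \<open>d\<close> a natural
  number) the following is its defining property.
\<close>

definition has_aff_dim :: "'a::real_vector set \<Rightarrow> nat \<Rightarrow> bool" where
  "has_aff_dim C d \<longleftrightarrow>
     (\<exists>B. affine hull B = affine hull C \<and> \<not> affine_dependent B \<and> card B = d + 1)"

text \<open>
  As usual for \<open>face_of\<close>, the empty set counts as a face, so disjoint members
  intersect in the common face \<open>{}\<close>.
\<close>

definition rational_polyhedral_complex :: "nat \<Rightarrow> (nat \<Rightarrow> real) set set \<Rightarrow> bool" where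
  "rational_polyhedral_complex n W \<longleftrightarrow>
     finite W \<and>
     (\<forall>C\<in>W. polytope C \<and> C \<subseteq> cube n \<and>
        (\<forall>v. v extreme_point_of C \<longrightarrow> (\<forall>i<n. v i \<in> \<rat>))) \<and>
     (\<forall>C F. C \<in> W \<and> F face_of C \<longrightarrow> F \<in> W) \<and>
     (\<forall>C D. C \<in> W \<and> D \<in> W \<longrightarrow> C \<inter> D face_of C \<and> C \<inter> D face_of D)"

text \<open>
  Functions on the cube are represented by functions on the whole type; only their
  values on the cube matter.
\<close>

definition mcnaughton_function :: "nat \<Rightarrow> ((nat \<Rightarrow> real) \<Rightarrow> real) \<Rightarrow> bool" where
  "mcnaughton_function n f \<longleftrightarrow>
     continuous_on (cube n) f \<and> f ` cube n \<subseteq> {0..1} \<and>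
     (\<exists>W. rational_polyhedral_complex n W \<and> \<Union>W = cube n \<and>
        (\<forall>C\<in>W. has_aff_dim C n \<longrightarrow>
           (\<exists>a :: nat \<Rightarrow> int. \<forall>x\<in>C.
              f x = (\<Sum>i<n. of_int (a i) * x i) + of_int (a n))))"

definition mv_oplus :: "('a \<Rightarrow> real) \<Rightarrow> ('a \<Rightarrow> real) \<Rightarrow> 'a \<Rightarrow> real" where
  "mv_oplus f g = (\<lambda>x. min 1 (f x + g x))"

definition mv_wedge :: "('a \<Rightarrow> real) \<Rightarrow> ('a \<Rightarrow> real) \<Rightarrow> 'a \<Rightarrow> real" where
  "mv_wedge f g = (\<lambda>x. min (f x) (g x))"

primrec mv_multiple :: "nat \<Rightarrow> ('a \<Rightarrow> real) \<Rightarrow> 'a \<Rightarrow> real" where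
  "mv_multiple 0 f = (\<lambda>x. 0)"
| "mv_multiple (Suc k) f = mv_oplus f (mv_multiple k f)"

lemma mv_multiple_eq:
  assumes "0 \<le> f x"
  shows "mv_multiple k f x = min 1 (real k * f x)"
  using assms by (induction k) (auto simp: mv_oplus_def algebra_simps min_def)

definition pseudotrue :: "nat \<Rightarrow> ((nat \<Rightarrow> real) \<Rightarrow> real) \<Rightarrow> bool" where
  "pseudotrue n f \<longleftrightarrow>
     mcnaughton_function n f \<and>
     (\<forall>g. mcnaughton_function n g \<and> (\<forall>x\<in>cube n. mv_wedge f g x = 0)
        \<longrightarrow> (\<forall>x\<in>cube n. g x = 0))"

definition homogeneous :: "nat \<Rightarrow> (nat \<Rightarrow> real) \<Rightarrow> real Matrix.vec" where
  "homogeneous n p = Matrix.vec (Suc n) (\<lambda>i. if i < n then p i else 1)"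

definition mcnaughton_homeomorphism ::
  "nat \<Rightarrow> ((nat \<Rightarrow> real) \<Rightarrow> (nat \<Rightarrow> real)) \<Rightarrow> bool" where
  "mcnaughton_homeomorphism n S \<longleftrightarrow>
     (\<exists>T. homeomorphism (cube n) (cube n) S T) \<and>
     (\<exists>W (P :: (nat \<Rightarrow> real) set \<Rightarrow> int Matrix.mat) d.
        rational_polyhedral_complex n W \<and> \<Union>W = cube n \<and>
        (d = 1 \<or> d = -1) \<and>
        (\<forall>C\<in>W. has_aff_dim C n \<longrightarrow>
           P C \<in> carrier_mat (Suc n) (Suc n) \<and>
           Matrix.row (P C) n = unit_vec (Suc n) n \<and>
           Determinant.det (P C) = d \<and>
           (\<forall>p\<in>C. homogeneous n (S p) =
              map_mat real_of_int (P C) *\<^sub>v homogeneous n p)))"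

definition borel_measure_on_cube :: "nat \<Rightarrow> (nat \<Rightarrow> real) measure \<Rightarrow> bool" where
  "borel_measure_on_cube n M \<longleftrightarrow> sets M = sets (restrict_space borel (cube n))"

definition lebesgue_cube :: "nat \<Rightarrow> (nat \<Rightarrow> real) measure" where
  "lebesgue_cube n = restrict_space (\<Pi>\<^sub>M i\<in>{..<n}. lborel) (cube n)"

lemma borel_measure_on_cube_lebesgue_cube: "borel_measure_on_cube n (lebesgue_cube n)"
proof -
  let ?P = "(\<Pi>\<^sub>M i\<in>{..<n}. lborel) :: (nat \<Rightarrow> real) measure"
  have sub: "cube n \<subseteq> space ?P"
    by (auto simp: cube_def space_PiM PiE_def Pi_def)
  have sp: "space (restrict_space ?P (cube n)) = cube n"
    using sub by (auto simp: space_restrict_space)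
  have sp': "space (restrict_space borel (cube n)) = cube n"
    by (simp add: space_restrict_space)
  have "(\<lambda>x. x) \<in> ?P \<rightarrow>\<^sub>M borel"
  proof (rule measurable_coordinatewise_then_product)
    fix i
    show "(\<lambda>x. x i) \<in> borel_measurable ?P"
    proof (cases "i < n")
      case True
      then have "(\<lambda>x. x i) \<in> ?P \<rightarrow>\<^sub>M lborel"
        by (intro measurable_component_singleton) auto
      then show ?thesis by simp
    next
      case False
      have "(\<lambda>x. x i) \<in> borel_measurable ?P \<longleftrightarrow> (\<lambda>x. undefined :: real) \<in> borel_measurable ?P"
        using False by (intro measurable_cong) (auto simp: space_PiM PiE_def extensional_def)
      then show ?thesis by simp
    qed
  qed
  then have "(\<lambda>x. x) \<in> restrict_space ?P (cube n) \<rightarrow>\<^sub>M restrict_space borel (cube n)"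
    by (intro measurable_restrict_space3) auto
  then have 1: "sets (restrict_space borel (cube n)) \<subseteq> sets (restrict_space ?P (cube n))"
  proof (intro subsetI)
    fix A assume id: "(\<lambda>x. x) \<in> restrict_space ?P (cube n) \<rightarrow>\<^sub>M restrict_space borel (cube n)"
      and A: "A \<in> sets (restrict_space borel (cube n))"
    have "A \<subseteq> cube n" using sets.sets_into_space[OF A] sp' by simp
    with measurable_sets[OF id A] sp show "A \<in> sets (restrict_space ?P (cube n))"
      by (simp add: Int_absorb2)
  qed
  have "(\<lambda>x. x) \<in> restrict_space borel (cube n) \<rightarrow>\<^sub>M ?P"
  proof (rule measurable_PiM_single')
    fix i
    have "(\<lambda>x::nat \<Rightarrow> real. x i) \<in> borel_measurable borel"
      by (rule borel_measurable_continuous_onI) (rule continuous_on_product_coordinates)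
    then show "(\<lambda>x. x i) \<in> restrict_space borel (cube n) \<rightarrow>\<^sub>M lborel"
      by (simp add: measurable_restrict_space1)
  next
    show "(\<lambda>x. x) \<in> space (restrict_space borel (cube n)) \<rightarrow> (\<Pi>\<^sub>E i\<in>{..<n}. space lborel)"
      using sub sp' by (auto simp: space_PiM)
  qed
  then have id: "(\<lambda>x. x) \<in> restrict_space borel (cube n) \<rightarrow>\<^sub>M restrict_space ?P (cube n)"
    by (intro measurable_restrict_space2) (auto simp: sp')
  have 2: "sets (restrict_space ?P (cube n)) \<subseteq> sets (restrict_space borel (cube n))"
  proof
    fix A assume A: "A \<in> sets (restrict_space ?P (cube n))"
    have "A \<subseteq> cube n" using sets.sets_into_space[OF A] sp by simp
    with measurable_sets[OF id A] sp' show "A \<in> sets (restrict_space borel (cube n))"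
      by (simp add: Int_absorb2)
  qed
  from 1 2 show ?thesis by (auto simp: borel_measure_on_cube_def lebesgue_cube_def)
qed

definition automorphism_invariant :: "nat \<Rightarrow> (nat \<Rightarrow> real) measure \<Rightarrow> bool" where
  "automorphism_invariant n M \<longleftrightarrow>
     (\<forall>S. mcnaughton_homeomorphism n S \<longrightarrow>
        (\<forall>B\<in>sets (restrict_space borel (cube n)).
           emeasure M (S -` B \<inter> cube n) = emeasure M B))"

definition detects_pseudotruths :: "nat \<Rightarrow> (nat \<Rightarrow> real) measure \<Rightarrow> bool" where
  "detects_pseudotruths n M \<longleftrightarrow>
     (\<forall>f. pseudotrue n f \<longrightarrow>
        (SUP k\<in>{1..}. \<integral>\<^sup>+x. ennreal (mv_multiple k f x) \<partial>M) = 1)"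

definition coherent :: "(nat \<Rightarrow> (nat \<Rightarrow> real) measure) \<Rightarrow> bool" where
  "coherent \<mu> \<longleftrightarrow>
     (\<forall>n\<ge>1. \<mu> n =
        distr (\<mu> (Suc n)) (restrict_space borel (cube n)) (\<lambda>x. restrict x {..<n}))"

end

theory Submission
  imports
    Defs
    "HOL-Analysis.Kronecker_Approximation_Theorem"
    "HOL-Real_Asymp.Real_Asymp"
begin

text \<open>
  The functions \<open>min 1 \<bar>L\<bar>\<close> with \<open>L\<close> affine and integral are pseudotrue, so the measure is a
  probability and every rational hyperplane is null.  Two coordinates at a time, invariance is only
  needed under the reflections \<open>x \<mapsto> 1 - x\<close>, \<open>y \<mapsto> 1 - y\<close> and a single twist of the triangle
  \<open>x, y, 1 - x - y \<ge> 0\<close>.  The twist moves each point along the boundary of the concentric triangle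
  \<open>min x (min y (1 - x - y)) = t\<close> through it, by lattice length \<open>t\<close> if \<open>t < 1/4\<close>.  This boundary has lattice
  length \<open>3 (1 - 3 t)\<close>, so the twist rotates it by an irrational angle as soon as \<open>t\<close> is irrational,
  and an invariant measure that ignores the rational lines must be uniform on almost every
  such boundary.

  The measure on the triangle is therefore determined by the distribution of \<open>t\<close>.  Near the origin
  the triangles concentric in the reflected copy of the big triangle cross the original ones
  transversally; comparing the two product decompositions of the measure of a small parallelogram
  forces the distribution of \<open>t\<close> to be the one of Lebesgue measure, up to a constant factor.
\<close>

text \<open>Detecting pseudotruths yields total mass one and null rational hyperplanes, but no
  absolute continuity; any density has to come out of the dynamics. In dimension one there are no
  dynamics: slopes all 1 or all -1 leave only the identity and the reflection, so there the first
  marginal of the planar measure has to serve.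

  The bound 1/4 solves t = 1 - 3 t. At that level the shift by t is a shift by one full side, so the
  map continues into the central triangle as an affine rotation of order three; at t = 0 it is the
  identity and extends to the rest of the square. In between, t is an integral affine form on each
  side, which keeps the pieces integral. The central triangle, on which the map has finite order, is
  recovered from the annuli of the reflected copies.

  Higher dimensions reduce to the plane because the maps move two coordinates and fix the others.
  Conditioning on an event in the other coordinates preserves every planar hypothesis, so each pair
  of coordinates is uniform and independent of the rest.\<close>

section \<open>Measures invariant under an irrational skew rotation\<close>

lemma irrational_multiple_near:
  fixes \<theta> x \<epsilon> :: real
  assumes "\<theta> \<notin> \<rat>" "\<epsilon> > 0"
  shows "\<exists>(a::nat) (b::int). \<bar>real a * \<theta> - b - x\<bar> < \<epsilon>"
proof -
  obtain k where "\<bar>frac (real k * \<theta>) - frac x\<bar> < \<epsilon>"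
    using Kronecker_approx_1_explicit[of \<theta> "frac x" \<epsilon>] assms frac_ge_0 frac_lt_1 less_imp_le
    by metis
  then have "\<bar>real k * \<theta> - of_int (\<lfloor>real k * \<theta>\<rfloor> - \<lfloor>x\<rfloor>) - x\<bar> < \<epsilon>"
    by (simp add: frac_def algebra_simps)
  then show ?thesis by blast
qed

section \<open>Lebesgue measure on the half-open unit interval\<close>

definition unit_uniform :: "real measure" where
  "unit_uniform = density lborel (indicator {0..<1})"

lemma sets_unit_uniform [measurable_cong, simp]: "sets unit_uniform = sets borel"
  by (simp add: unit_uniform_def)

lemma emeasure_unit_uniform: "A \<in> sets borel \<Longrightarrow> emeasure unit_uniform A = emeasure lborel (A \<inter> {0..<1})"
  unfolding unit_uniform_def
  by (subst emeasure_density) (auto intro!: nn_integral_cong simp: indicator_def simp flip: nn_integral_indicator)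

lemma emeasure_unit_uniform_greaterThan:
  "emeasure unit_uniform {x<..} = ennreal (if x < 0 then 1 else if x \<le> 1 then 1 - x else 0)"
proof -
  have "{x<..} \<inter> {0..<1} = (if x < 0 then {0..<1} else {x<..<1::real})"
    by auto
  then show ?thesis by (auto simp: emeasure_unit_uniform)
qed

lemma finite_measure_unit_uniform: "finite_measure unit_uniform"
  by (rule finite_measureI) (simp add: emeasure_unit_uniform sets_eq_imp_space_eq[OF sets_unit_uniform])

text \<open>The angle varies with the second coordinate, whose distribution is left arbitrary.
  Preimages are taken in the whole plane; points with first coordinate outside [0, 1) are
  null.\<close>

locale skew_rotation = finite_measure M
  for M :: "(real \<times> real) measure" +
  fixes \<alpha> :: "real \<Rightarrow> real"
  assumes sets_M [measurable_cong, simp]: "sets M = sets borel"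
    and \<alpha>_measurable [measurable]: "\<alpha> \<in> borel_measurable borel"
    and AE_unit: "AE p in M. fst p \<in> {0..<1}"
    and AE_irrational: "AE p in M. \<alpha> (snd p) \<notin> \<rat>"
    and invariant: "\<And>B. B \<in> sets borel \<Longrightarrow>
      emeasure M ((\<lambda>(s, y). (frac (s + \<alpha> y), y)) -` B) = emeasure M B"
begin

lemma space_M [simp]: "space M = UNIV"
  using sets_eq_imp_space_eq[OF sets_M] by simp

lemma Times_measurable [measurable (raw), intro]:
  "A \<in> sets borel \<Longrightarrow> B \<in> sets borel \<Longrightarrow> (A \<times> B :: (real \<times> real) set) \<in> sets borel"
  by (rule borel_Times)

lemma fst_measurable [measurable]: "fst \<in> borel_measurable M"
  and snd_measurable [measurable]: "snd \<in> borel_measurable M"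
  by (simp_all add: measurable_cong_sets[OF sets_M refl] flip: borel_prod)

lemma rotation_measurable [measurable]:
  "(\<lambda>(s, y). (frac (s + real a * \<alpha> y), y)) \<in> borel \<rightarrow>\<^sub>M borel"
  unfolding frac_def borel_prod[symmetric] by measurable

lemma invariant_iterate:
  assumes "B \<in> sets borel"
  shows "emeasure M ((\<lambda>(s, y). (frac (s + real a * \<alpha> y), y)) -` B) = emeasure M B"
proof (induction a)
  \<comment> \<open>The zeroth iterate still applies \<open>frac\<close>, so it is the identity only
    where the first coordinate lies in [0, 1), that is, almost everywhere.\<close>
  case 0
  show ?case
  proof (rule emeasure_eq_AE)
    show "AE x in M. x \<in> (\<lambda>(s, y). (frac (s + real 0 * \<alpha> y), y)) -` B \<longleftrightarrow> x \<in> B"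
      using AE_unit by eventually_elim (auto simp: frac_eq)
    show "(\<lambda>(s, y). (frac (s + real 0 * \<alpha> y), y)) -` B \<in> sets M"
      using measurable_sets[OF rotation_measurable[of 0] assms] by simp
  qed (use assms in simp)
next
  case (Suc a)
  have eq: "(\<lambda>(s, y). (frac (s + real (Suc a) * \<alpha> y), y)) -` B =
    (\<lambda>(s, y). (frac (s + \<alpha> y), y)) -` ((\<lambda>(s, y). (frac (s + real a * \<alpha> y), y)) -` B)"
    by (auto simp: algebra_simps frac_add_simps)
  show ?case
    unfolding eq using Suc measurable_sets[OF rotation_measurable[of a] assms]
    by (subst invariant) simp_all
qed

text \<open>
  \<open>Y\<close> is cut according to the first multiple of \<open>\<alpha> y\<close> which, modulo 1, moves \<open>{p..q}\<close> into
  \<open>{p'..<q'}\<close>; on each piece a single power of the rotation does the job.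
\<close>

lemma box_le:
  assumes Y [measurable]: "Y \<in> sets borel" and len: "q - p < q' - p'" and "0 \<le> p'" "q' \<le> 1"
  shows "measure M ({p..q} \<times> Y) \<le> measure M ({p'..<q'} \<times> Y)"
proof -
  \<comment> \<open>Half of the slack in length: modulo 1, a shift within \<epsilon> of p' - p +
    \<epsilon> carries {p..q} strictly between p' and q'.\<close>
  define \<epsilon> where "\<epsilon> = ((q' - p') - (q - p)) / 2"
  have \<epsilon>: "\<epsilon> > 0" using len by (simp add: \<epsilon>_def)
  define Z where "Z a = {y. \<exists>b::int. \<bar>real a * \<alpha> y - b - (p' - p + \<epsilon>)\<bar> < \<epsilon>}" for a :: nat
  have [measurable]: "Z a \<in> sets borel" for a
    unfolding Z_def by measurable
  define D where "D = disjointed (\<lambda>a. Y \<inter> Z a)"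
  have D [measurable]: "D a \<in> sets borel" for a
  proof -
    have "range D \<subseteq> sets borel" unfolding D_def by (rule sets.range_disjointed_sets) auto
    then show ?thesis by auto
  qed
  have disj: "disjoint_family D" unfolding D_def by (rule disjoint_family_disjointed)
  have sub: "D a \<subseteq> Y \<inter> Z a" for a unfolding D_def by (rule disjointed_subset)
  have un: "(\<Union>a. D a) = Y \<inter> (\<Union>a. Z a)" unfolding D_def UN_disjointed_eq by auto
  have step: "emeasure M ({p..q} \<times> D a) \<le> emeasure M ({p'..<q'} \<times> D a)" for a
  proof -
    let ?R = "\<lambda>(s, y). (frac (s + real a * \<alpha> y), y)"
    have "{p..q} \<times> D a \<subseteq> ?R -` ({p'..<q'} \<times> D a)"
    proof (clarsimp)
      fix s y assume s: "p \<le> s" "s \<le> q" and y: "y \<in> D a"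
      obtain b :: int where b: "\<bar>real a * \<alpha> y - b - (p' - p + \<epsilon>)\<bar> < \<epsilon>"
        using sub[of a] y by (auto simp: Z_def)
      let ?t = "s + real a * \<alpha> y - b"
      have t: "p' < ?t" "?t < q'" using s b by (auto simp: \<epsilon>_def abs_less_iff field_simps)
      have "frac (s + real a * \<alpha> y) = ?t"
        using t assms(3,4) by (subst frac_unique_iff) auto
      then show "p' \<le> frac (s + real a * \<alpha> y) \<and> frac (s + real a * \<alpha> y) < q'" using t by simp
    qed
    then have "emeasure M ({p..q} \<times> D a) \<le> emeasure M (?R -` ({p'..<q'} \<times> D a))"
      using measurable_sets[OF rotation_measurable[of a], of "{p'..<q'} \<times> D a"]
      by (intro emeasure_mono) (auto intro!: borel_Times)
    then show ?thesis by (subst (asm) invariant_iterate) auto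
  qed
  have dT: "disjoint_family (\<lambda>a. I \<times> D a)" for I :: "real set"
    using disj by (auto simp: disjoint_family_on_def)
  have "emeasure M ({p..q} \<times> Y) = emeasure M (\<Union>a. {p..q} \<times> D a)"
  proof (rule emeasure_eq_AE)
    show "AE x in M. x \<in> {p..q} \<times> Y \<longleftrightarrow> x \<in> (\<Union>a. {p..q} \<times> D a)"
      using AE_irrational
    proof eventually_elim
      case (elim x)
      have "\<exists>a. snd x \<in> Z a"
        using irrational_multiple_near[OF elim \<epsilon>, of "p' - p + \<epsilon>"] by (auto simp: Z_def)
      then have "snd x \<in> Y \<longleftrightarrow> snd x \<in> (\<Union>a. D a)" unfolding un by auto
      then show ?case by (cases x) auto
    qed
  qed (auto intro!: borel_Times)
  also have "\<dots> = (\<Sum>a. emeasure M ({p..q} \<times> D a))"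
    by (rule suminf_emeasure[symmetric]) (auto intro!: borel_Times simp: dT)
  also have "\<dots> \<le> (\<Sum>a. emeasure M ({p'..<q'} \<times> D a))"
    by (intro suminf_le step) auto
  also have "\<dots> = emeasure M (\<Union>a. {p'..<q'} \<times> D a)"
    by (rule suminf_emeasure) (auto intro!: borel_Times simp: dT)
  also have "\<dots> \<le> emeasure M ({p'..<q'} \<times> Y)"
    using sub by (intro emeasure_mono) (auto intro!: borel_Times)
  finally show ?thesis by (simp add: emeasure_eq_measure)
qed

text \<open>
  A box slightly narrower than \<open>1 / k\<close> is dominated by \<open>k\<close> disjoint boxes, hence carries at most
  a \<open>k\<close>-th of the mass.
\<close>

lemma box_upper:
  assumes Y [measurable]: "Y \<in> sets borel" and pq: "0 \<le> p" "p \<le> q" "q \<le> 1"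
  shows "measure M ({p..q} \<times> Y) \<le> (q - p) * measure M (UNIV \<times> Y)"
proof -
  define m where "m = measure M (UNIV \<times> Y)"
  have m0: "0 \<le> m" by (simp add: m_def)
  \<comment> \<open>The width 1 / (k + 1) is strictly below 1 / k, as \<open>box_le\<close> demands;
    the limit in k removes the loss.\<close>
  have short: "real k * measure M ({x..x + 1 / (real k + 1)} \<times> Y) \<le> m" if k: "k > 0" for k :: nat and x
  proof -
    let ?J = "\<lambda>j. {real j / k..<(real j + 1) / k}"
    have "real k * measure M ({x..x + 1 / (real k + 1)} \<times> Y) = 
      (\<Sum>j<k. measure M ({x..x + 1 / (real k + 1)} \<times> Y))" by simp
    also have "\<dots> \<le> (\<Sum>j<k. measure M (?J j \<times> Y))"
    proof (intro sum_mono box_le Y)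
      fix j assume "j \<in> {..<k}"
      then show "(real j + 1) / k \<le> 1" using k by (simp add: field_simps)
      show "x + 1 / (real k + 1) - x < (real j + 1) / k - real j / k"
        using k by (simp add: field_simps)
    qed simp
    also have "\<dots> = measure M (\<Union>j<k. ?J j \<times> Y)"
    proof (rule finite_measure_finite_Union[symmetric])
      show "disjoint_family_on (\<lambda>j. ?J j \<times> Y) {..<k}"
      proof (unfold disjoint_family_on_def, intro ballI impI)
        fix i j :: nat assume "i \<noteq> j"
        then have "real i + 1 \<le> real j \<or> real j + 1 \<le> real i" by linarith
        then have "(real i + 1) / k \<le> real j / k \<or> (real j + 1) / k \<le> real i / k"
          using k by (auto intro: divide_right_mono)
        then show "?J i \<times> Y \<inter> ?J j \<times> Y = {}" by auto
      qed
    qed (auto intro!: borel_Times)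
    also have "\<dots> \<le> m" unfolding m_def by (rule finite_measure_mono) (auto intro!: borel_Times)
    finally show ?thesis .
  qed
  \<comment> \<open>An interval of length q - p is covered by at most (q - p) (k + 1) + 1 of the
    short boxes.\<close>
  have bound: "measure M ({p..q} \<times> Y) \<le> ((q - p) * (real k + 1) + 1) * (m / k)" if k: "k > 0" for k :: nat
  proof -
    define r where "r = nat \<lfloor>(q - p) * (real k + 1)\<rfloor> + 1"
    let ?l = "1 / (real k + 1)"
    let ?I = "\<lambda>j. {p + real j * ?l .. p + real j * ?l + ?l}"
    have cov: "{p..q} \<subseteq> (\<Union>j<r. ?I j)"
    proof
      fix x assume x: "x \<in> {p..q}"
      define j where "j = nat \<lfloor>(x - p) * (real k + 1)\<rfloor>"
      have x0: "0 \<le> (x - p) * (real k + 1)" using x by simp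
      then have j: "real j \<le> (x - p) * (real k + 1)" "(x - p) * (real k + 1) < real j + 1"
        unfolding j_def by linarith+
      have "(x - p) * (real k + 1) \<le> (q - p) * (real k + 1)" using x by (intro mult_right_mono) auto
      then have "\<lfloor>(x - p) * (real k + 1)\<rfloor> \<le> \<lfloor>(q - p) * (real k + 1)\<rfloor>" by (rule floor_mono)
      then have "j < r" unfolding j_def r_def by linarith
      moreover have "x \<in> ?I j" using j by (auto simp: field_simps)
      ultimately show "x \<in> (\<Union>j<r. ?I j)" by blast
    qed
    have "measure M ({p..q} \<times> Y) \<le> measure M (\<Union>j<r. ?I j \<times> Y)"
      using cov by (intro finite_measure_mono) (auto intro!: borel_Times)
    also have "\<dots> \<le> (\<Sum>j<r. measure M (?I j \<times> Y))"
      by (intro finite_measure_subadditive_finite) (auto intro!: borel_Times)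
    also have "\<dots> \<le> (\<Sum>j<r. m / k)"
    proof (intro sum_mono)
      fix j
      show "measure M (?I j \<times> Y) \<le> m / k"
        using short[OF k, of "p + real j * ?l"] k by (simp only: pos_le_divide_eq of_nat_0_less_iff mult.commute)
    qed
    also have "\<dots> = real r * (m / k)" by simp
    also have "\<dots> \<le> ((q - p) * (real k + 1) + 1) * (m / k)"
    proof (rule mult_right_mono)
      have "0 \<le> (q - p) * (real k + 1)" using pq by simp
      then show "real r \<le> (q - p) * (real k + 1) + 1" unfolding r_def by linarith
    qed (use m0 in simp)
    finally show ?thesis .
  qed
  have "(\<lambda>k. ((q - p) * (real k + 1) + 1) * (m / k)) \<longlonglongrightarrow> (q - p) * m"
    by real_asymp
  then show ?thesis
    unfolding m_def[symmetric]
    by (rule LIMSEQ_le_const) (use bound in \<open>auto intro!: exI[of _ 1]\<close>)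
qed

text \<open>The upper bounds for {..s} and {s<..} add up to the whole mass, so neither can be
  strict.\<close>

lemma box_exact:
  assumes Y [measurable]: "Y \<in> sets borel" and s: "0 \<le> s" "s \<le> 1"
  shows "measure M ({s<..} \<times> Y) = (1 - s) * measure M (UNIV \<times> Y)"
proof -
  have 1: "measure M ({s<..} \<times> Y) \<le> (1 - s) * measure M (UNIV \<times> Y)"
  proof -
    have "measure M ({s<..} \<times> Y) \<le> measure M ({s..1} \<times> Y)"
      using AE_unit by (intro finite_measure_mono_AE) (auto intro!: borel_Times elim: eventually_mono)
    also have "\<dots> \<le> (1 - s) * measure M (UNIV \<times> Y)" using s by (intro box_upper) auto
    finally show ?thesis .
  qed
  have 2: "measure M ({..s} \<times> Y) \<le> s * measure M (UNIV \<times> Y)"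
  proof -
    have "measure M ({..s} \<times> Y) \<le> measure M ({0..s} \<times> Y)"
      using AE_unit by (intro finite_measure_mono_AE) (auto intro!: borel_Times elim: eventually_mono)
    also have "\<dots> \<le> (s - 0) * measure M (UNIV \<times> Y)" using s by (intro box_upper) auto
    finally show ?thesis by simp
  qed
  have "measure M (UNIV \<times> Y) = measure M ({..s} \<times> Y \<union> {s<..} \<times> Y)"
    by (rule arg_cong[where f = "measure M"]) auto
  also have "\<dots> = measure M ({..s} \<times> Y) + measure M ({s<..} \<times> Y)"
    by (rule finite_measure_Union) (auto intro!: borel_Times)
  finally show ?thesis using 1 2 by (simp add: algebra_simps)
qed

text \<open>For fixed Y, the measure A \<mapsto> M (A \<times> Y) and a multiple of the uniform
  measure agree on half-lines by \<open>box_exact\<close>, hence on all Borel sets; rectangles then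
  determine M.\<close>

lemma eq_product: "M = unit_uniform \<Otimes>\<^sub>M distr M borel snd"
proof (rule pair_measure_eqI[symmetric])
  show "sigma_finite_measure unit_uniform"
    using finite_measure_unit_uniform by (rule finite_measure.axioms)
  have fin: "finite_measure (distr M borel snd)"
    by (intro finite_measure_distr snd_measurable)
  then show "sigma_finite_measure (distr M borel snd)"
    by (rule finite_measure.axioms)
  have "sets (unit_uniform \<Otimes>\<^sub>M distr M borel snd) = sets (borel \<Otimes>\<^sub>M borel :: (real \<times> real) measure)"
    by (rule sets_pair_measure_cong) simp_all
  then show "sets (unit_uniform \<Otimes>\<^sub>M distr M borel snd) = sets M"
    unfolding borel_prod sets_M .
  fix A Y assume "A \<in> sets unit_uniform" and "Y \<in> sets (distr M borel snd)"
  then have A [measurable]: "A \<in> sets borel" and Y [measurable]: "Y \<in> sets borel" by auto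
  define N where "N = distr (density M (indicator (UNIV \<times> Y))) borel fst"
  have ind: "indicator (UNIV \<times> Y) \<in> borel_measurable M"
    by (rule borel_measurable_indicator) (auto intro!: borel_Times)
  have N: "emeasure N B = emeasure M (B \<times> Y)" if B [measurable]: "B \<in> sets borel" for B
  proof -
    have BU: "B \<times> UNIV \<in> sets M" "B \<times> Y \<in> sets M"
      by (auto intro!: borel_Times)
    have "emeasure N B = emeasure (density M (indicator (UNIV \<times> Y))) (B \<times> UNIV)"
      unfolding N_def by (subst emeasure_distr) (auto intro!: arg_cong2[where f = emeasure])
    also have "\<dots> = (\<integral>\<^sup>+p. indicator (B \<times> Y) p \<partial>M)"
      unfolding emeasure_density[OF ind BU(1)] by (rule nn_integral_cong) (auto simp: indicator_def)
    also have "\<dots> = emeasure M (B \<times> Y)" using BU by (rule_tac nn_integral_indicator)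
    finally show ?thesis .
  qed
  have k: "emeasure (distr M borel snd) Y = emeasure M (UNIV \<times> Y)"
    by (subst emeasure_distr) (auto intro!: arg_cong2[where f = emeasure])
  have "N = scale_measure (emeasure M (UNIV \<times> Y)) unit_uniform"
  proof (rule measure_eqI_lessThan)
    show "emeasure N {x<..} < \<infinity>" for x
      by (simp add: N emeasure_eq_measure)
    show "emeasure N {x<..} = emeasure (scale_measure (emeasure M (UNIV \<times> Y)) unit_uniform) {x<..}" for x
    proof -
      consider "x < 0" | "0 \<le> x" "x \<le> 1" | "x > 1" by linarith
      then have "measure M ({x<..} \<times> Y) = 
        measure M (UNIV \<times> Y) * (if x < 0 then 1 else if x \<le> 1 then 1 - x else 0)"
      proof cases
        case 1
        have "measure M ({x<..} \<times> Y) = measure M (UNIV \<times> Y)"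
          using AE_unit 1 by (intro finite_measure_eq_AE) (auto intro!: borel_Times elim: eventually_mono)
        with 1 show ?thesis by simp
      next
        case 2 then show ?thesis by (simp add: box_exact)
      next
        case 3
        have "measure M ({x<..} \<times> Y) = measure M {}"
          using AE_unit 3 by (intro finite_measure_eq_AE) (auto intro!: borel_Times elim: eventually_mono)
        with 3 show ?thesis by simp
      qed
      then show ?thesis
        by (simp add: N emeasure_unit_uniform_greaterThan emeasure_eq_measure flip: ennreal_mult')
    qed
  qed (simp_all add: N_def)
  then have "emeasure N A = emeasure M (UNIV \<times> Y) * emeasure unit_uniform A" by simp
  then show "emeasure unit_uniform A * emeasure (distr M borel snd) Y = emeasure M (A \<times> Y)"
    by (simp add: N k mult.commute)
qed

end

section \<open>The twist of a triangle\<close>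

text \<open>
  In barycentric coordinates \<open>(a, b, c) = (x, y, 1 - x - y)\<close>: a point whose minimal coordinate is
  \<open>b = t < 1/4\<close> moves to \<open>(a + t, t, c - t)\<close>, or, if it gets past the corner, to
  \<open>(a - 3 t + 2 c, 3 t - c, t)\<close>; the other two sides are obtained by rotating the coordinates.  In
  the central triangle \<open>t \<ge> 1/4\<close> the map is the rotation \<open>(a, b, c) \<mapsto> (c, a, b)\<close>, which moves
  points by \<open>1 - 3 t\<close>, one full side.
\<close>

definition twist :: "real \<times> real \<Rightarrow> real \<times> real" where
  "twist = (\<lambda>(x, y).
     if x < 0 \<or> y < 0 \<or> 1 < x + y then (x, y)
     else if 1/4 \<le> x \<and> 1/4 \<le> y \<and> 1/4 \<le> 1 - x - y then (1 - x - y, x)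
     else if y \<le> x \<and> y \<le> 1 - x - y then
       (if 2 * y \<le> 1 - x - y then (x + y, y) else (2 - x - 5 * y, x + 4 * y - 1))
     else if 1 - x - y \<le> x \<and> 1 - x - y \<le> y then
       (if 2 * (1 - x - y) \<le> x then (2 * x + y - 1, 1 - x)
        else (1 - x - y, 5 * x + 4 * y - 3))
     else (if 2 * x \<le> y then (x, y - x) else (3 * x - y, x)))"

section \<open>Coordinates along the boundaries of the concentric triangles\<close>

definition level :: "real \<times> real \<Rightarrow> real" where
  "level = (\<lambda>(x, y). min x (min y (1 - x - y)))"

text \<open>Ties are broken so that each side keeps its starting corner and gives up its end corner;
  the three half-open sides partition the boundary in the direction of the twist.\<close>

definition side :: "real \<times> real \<Rightarrow> nat" where
  "side = (\<lambda>(x, y).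
     if y \<le> x \<and> y < 1 - x - y then 0 else if 1 - x - y \<le> y \<and> 1 - x - y < x then 1 else 2)"

text \<open>The lattice distance from the starting corner of the side, written as a difference of
  two barycentric coordinates.\<close>

definition offset :: "real \<times> real \<Rightarrow> real" where
  "offset = (\<lambda>(x, y).
     if side (x, y) = 0 then x - y else if side (x, y) = 1 then x + 2 * y - 1 else 1 - 2 * x - y)"

text \<open>Each side has length 1 - 3 t at level t; rescaling each to a third makes the boundary a
  circle of length one.\<close>

definition arc_pos :: "real \<times> real \<Rightarrow> real" where
  "arc_pos p = (real (side p) + offset p / (1 - 3 * level p)) / 3"

definition point :: "nat \<Rightarrow> real \<Rightarrow> real \<Rightarrow> real \<times> real" where
  "point k w t =
     (if k = 0 then (t + w, t) else if k = 1 then (1 - 2 * t - w, t + w) else (t, 1 - 2 * t - w))"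

text \<open>The levels at which the twist can be an irrational rotation: at level 0 it is the
  identity, and from 1/4 on it has order three.\<close>

definition annulus :: "(real \<times> real) set" where
  "annulus = {p. 0 < level p \<and> level p < 1/4}"

lemma level_eqI:
  assumes "v \<le> x" "v \<le> y" "v \<le> 1 - x - y"
  shows "x \<le> v \<Longrightarrow> level (x, y) = v" "y \<le> v \<Longrightarrow> level (x, y) = v" "1 - x - y \<le> v \<Longrightarrow> level (x, y) = v"
  using assms unfolding level_def by auto

lemma twist_cases:
  obtains
    (outside) "x < 0 \<or> y < 0 \<or> 1 < x + y" "twist (x, y) = (x, y)"
  | (centre) "1/4 \<le> x" "1/4 \<le> y" "1/4 \<le> 1 - x - y" "twist (x, y) = (1 - x - y, x)"
  | (bottom) "0 \<le> y" "y < 1/4" "y \<le> x" "2 * y \<le> 1 - x - y" "twist (x, y) = (x + y, y)"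
  | (bottom_turn) "0 \<le> y" "y < 1/4" "y \<le> x" "y \<le> 1 - x - y" "1 - x - y < 2 * y"
      "twist (x, y) = (2 - x - 5 * y, x + 4 * y - 1)"
  | (slant) "0 \<le> 1 - x - y" "1 - x - y < 1/4" "1 - x - y \<le> y" "2 * (1 - x - y) \<le> x"
      "twist (x, y) = (2 * x + y - 1, 1 - x)"
  | (slant_turn) "0 \<le> 1 - x - y" "1 - x - y < 1/4" "1 - x - y \<le> y" "1 - x - y \<le> x"
      "x < 2 * (1 - x - y)" "twist (x, y) = (1 - x - y, 5 * x + 4 * y - 3)"
  | (left) "0 \<le> x" "x < 1/4" "x \<le> 1 - x - y" "2 * x \<le> y" "twist (x, y) = (x, y - x)"
  | (left_turn) "0 \<le> x" "x < 1/4" "x \<le> 1 - x - y" "x \<le> y" "y < 2 * x"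
      "twist (x, y) = (3 * x - y, x)"
proof -
  note tw = twist_def prod.case if_True if_False simp_thms
  consider (O) "x < 0 \<or> y < 0 \<or> 1 < x + y" | (C) "\<not> (x < 0 \<or> y < 0 \<or> 1 < x + y)" "1/4 \<le> x \<and> 1/4 \<le> y \<and> 1/4 \<le> 1 - x - y"
    | (B) "\<not> (x < 0 \<or> y < 0 \<or> 1 < x + y)" "\<not> (1/4 \<le> x \<and> 1/4 \<le> y \<and> 1/4 \<le> 1 - x - y)" "y \<le> x \<and> y \<le> 1 - x - y"
    | (S) "\<not> (x < 0 \<or> y < 0 \<or> 1 < x + y)" "\<not> (1/4 \<le> x \<and> 1/4 \<le> y \<and> 1/4 \<le> 1 - x - y)" "\<not> (y \<le> x \<and> y \<le> 1 - x - y)" "1 - x - y \<le> x \<and> 1 - x - y \<le> y"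
    | (L) "\<not> (x < 0 \<or> y < 0 \<or> 1 < x + y)" "\<not> (1/4 \<le> x \<and> 1/4 \<le> y \<and> 1/4 \<le> 1 - x - y)" "\<not> (y \<le> x \<and> y \<le> 1 - x - y)" "\<not> (1 - x - y \<le> x \<and> 1 - x - y \<le> y)"
    by argo
  then show thesis
  proof cases
    case O
    then show ?thesis by (intro outside) (simp_all only: tw)
  next
    case C
    then show ?thesis by (intro centre) (simp_all only: tw)
  next
    case B
    have *: "0 \<le> y" "y < 1/4" "y \<le> x" "y \<le> 1 - x - y" using B by argo+
    show ?thesis
    proof (cases "2 * y \<le> 1 - x - y")
      case True
      show ?thesis using * True B by (intro bottom) (simp_all only: tw)
    next
      case False
      then have "1 - x - y < 2 * y" by simp
      then show ?thesis using * False B by (intro bottom_turn) (simp_all only: tw)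
    qed
  next
    case S
    have *: "0 \<le> 1 - x - y" "1 - x - y < 1/4" "1 - x - y \<le> x" "1 - x - y \<le> y" using S by argo+
    show ?thesis
    proof (cases "2 * (1 - x - y) \<le> x")
      case True
      show ?thesis using * True S by (intro slant) (simp_all only: tw)
    next
      case False
      then have "x < 2 * (1 - x - y)" by simp
      then show ?thesis using * False S by (intro slant_turn) (simp_all only: tw)
    qed
  next
    case L
    have *: "0 \<le> x" "x < 1/4" "x \<le> 1 - x - y" "x \<le> y" using L by argo+
    show ?thesis
    proof (cases "2 * x \<le> y")
      case True
      show ?thesis using * True L by (intro left) (simp_all only: tw)
    next
      case False
      then have "y < 2 * x" by simp
      then show ?thesis using * False L by (intro left_turn) (simp_all only: tw)
    qed
  qed
qed

lemma level_twist: "level (twist p) = level p"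
proof (cases p)
  case (Pair x y)
  have "level (twist (x, y)) = level (x, y)"
  proof (cases rule: twist_cases[of x y])
    case outside then show ?thesis by simp
  next
    case centre
    then show ?thesis by (simp add: level_def min.commute min.left_commute)
  next
    case bottom
    have "level (x, y) = y" "level (x + y, y) = y"
      by (rule level_eqI(2); use bottom in linarith)+
    then show ?thesis using bottom by simp
  next
    case bottom_turn
    have "level (x, y) = y" by (rule level_eqI(2); use bottom_turn in linarith)
    moreover have "level (2 - x - 5 * y, x + 4 * y - 1) = y"
      by (rule level_eqI(3); use bottom_turn in linarith)
    ultimately show ?thesis using bottom_turn by simp
  next
    case slant
    have "level (x, y) = 1 - x - y" by (rule level_eqI(3); use slant in argo)
    moreover have "level (2 * x + y - 1, 1 - x) = 1 - x - y"
      by (rule level_eqI(3); use slant in argo)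
    ultimately show ?thesis using slant by simp
  next
    case slant_turn
    have "level (x, y) = 1 - x - y" by (rule level_eqI(3); use slant_turn in argo)
    moreover have "level (1 - x - y, 5 * x + 4 * y - 3) = 1 - x - y"
      by (rule level_eqI(1); use slant_turn in argo)
    ultimately show ?thesis using slant_turn by simp
  next
    case left
    have "level (x, y) = x" by (rule level_eqI(1); use left in linarith)
    moreover have "level (x, y - x) = x"
      by (rule level_eqI(1); use left in linarith)
    ultimately show ?thesis using left by simp
  next
    case left_turn
    have "level (x, y) = x" by (rule level_eqI(1); use left_turn in linarith)
    moreover have "level (3 * x - y, x) = x"
      by (rule level_eqI(2); use left_turn in linarith)
    ultimately show ?thesis using left_turn by simp
  qed
  then show ?thesis by (simp add: Pair)
qed

lemma annulus_iff:
  "(x, y) \<in> annulus \<longleftrightarrow> 0 < x \<and> 0 < y \<and> x + y < 1 \<and> (x < 1/4 \<or> y < 1/4 \<or> 3/4 < x + y)"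
  unfolding annulus_def level_def mem_Collect_eq case_prod_conv min_less_iff_disj min_less_iff_conj by argo

lemma side_cases:
  assumes "(x, y) \<in> annulus"
  obtains
    (bottom) "0 < y" "y < 1/4" "y \<le> x" "y < 1 - x - y" "side (x, y) = 0" "offset (x, y) = x - y" "level (x, y) = y"
  | (slant) "0 < 1 - x - y" "1 - x - y < 1/4" "1 - x - y \<le> y" "1 - x - y < x" "side (x, y) = 1"
      "offset (x, y) = x + 2 * y - 1" "level (x, y) = 1 - x - y"
  | (left) "0 < x" "x < 1/4" "x \<le> 1 - x - y" "x < y" "side (x, y) = 2"
      "offset (x, y) = 1 - 2 * x - y" "level (x, y) = x"
proof -
  have "0 < y \<and> y < 1/4 \<and> y \<le> x \<and> y < 1 - x - y \<or>
    0 < 1 - x - y \<and> 1 - x - y < 1/4 \<and> 1 - x - y \<le> y \<and> 1 - x - y < x \<and> \<not> (y \<le> x \<and> y < 1 - x - y) \<or>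
    0 < x \<and> x < 1/4 \<and> x \<le> 1 - x - y \<and> x < y \<and> \<not> (y \<le> x \<and> y < 1 - x - y) \<and>
      \<not> (1 - x - y \<le> y \<and> 1 - x - y < x)"
    using assms unfolding annulus_iff by argo
  then show thesis
  proof (elim disjE)
    assume *: "0 < y \<and> y < 1/4 \<and> y \<le> x \<and> y < 1 - x - y"
    have "level (x, y) = y" by (rule level_eqI(2)) (use * in linarith)+
    then show thesis using * by (intro bottom) (simp_all add: offset_def side_def)
  next
    assume *: "0 < 1 - x - y \<and> 1 - x - y < 1/4 \<and> 1 - x - y \<le> y \<and> 1 - x - y < x \<and> \<not> (y \<le> x \<and> y < 1 - x - y)"
    have "level (x, y) = 1 - x - y" by (rule level_eqI(3)) (use * in linarith)+
    then show thesis using * by (intro slant) (auto simp add: offset_def side_def)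
  next
    assume *: "0 < x \<and> x < 1/4 \<and> x \<le> 1 - x - y \<and> x < y \<and> \<not> (y \<le> x \<and> y < 1 - x - y) \<and>
      \<not> (1 - x - y \<le> y \<and> 1 - x - y < x)"
    have "level (x, y) = x" by (rule level_eqI(1)) (use * in linarith)+
    then show thesis using * by (intro left) (auto simp add: offset_def side_def)
  qed
qed

lemma offset_bounds:
  assumes "p \<in> annulus"
  shows "0 \<le> offset p" "offset p < 1 - 3 * level p"
proof -
  obtain x y where p: "p = (x, y)" by (cases p)
  show "0 \<le> offset p" "offset p < 1 - 3 * level p"
    using assms unfolding p by (cases rule: side_cases; simp)+
qed

lemma side_le: "side p \<le> 2"
  by (auto simp: side_def split: prod.splits)

lemma point_side_offset:
  assumes "p \<in> annulus"
  shows "point (side p) (offset p) (level p) = p"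
proof -
  obtain x y where p: "p = (x, y)" by (cases p)
  show ?thesis
    using assms unfolding p by (cases rule: side_cases) (simp_all add: point_def)
qed

lemma side_offset_pointI:
  assumes "0 \<le> w" "w < 1 - 3 * t" "0 < t" "k \<le> 2"
  shows "side (point k w t) = k \<and> offset (point k w t) = w"
proof -
  have "k = 0 \<or> k = 1 \<or> k = 2" using assms by auto
  then show ?thesis
    using assms by (elim disjE) (simp_all add: point_def side_def offset_def)
qed

text \<open>The step t is shorter than a side, of length 1 - 3 t, precisely because t < 1/4; hence
  at most one corner is passed, and the excess is carried over to the next side.\<close>

lemma twist_point:
  assumes "p \<in> annulus"
  shows "twist p = (if offset p + level p < 1 - 3 * level p then point (side p) (offset p + level p) (level p)
    else point ((side p + 1) mod 3) (offset p + level p - (1 - 3 * level p)) (level p))"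
proof -
  obtain x y where p: "p = (x, y)" by (cases p)
  show ?thesis
    using assms unfolding p by (cases rule: side_cases) (simp_all add: point_def twist_def)
qed

lemma twist_side_offset:
  assumes "p \<in> annulus"
  shows "offset p + level p < 1 - 3 * level p \<Longrightarrow>
      side (twist p) = side p \<and> offset (twist p) = offset p + level p"
    and "\<not> offset p + level p < 1 - 3 * level p \<Longrightarrow>
      side (twist p) = (side p + 1) mod 3 \<and> offset (twist p) = offset p + level p - (1 - 3 * level p)"
proof -
  have l: "0 < level p" "level p < 1/4" using assms by (simp_all add: annulus_def)
  show "offset p + level p < 1 - 3 * level p \<Longrightarrow>
      side (twist p) = side p \<and> offset (twist p) = offset p + level p"
    using side_offset_pointI[of "offset p + level p" "level p" "side p"] offset_bounds[OF assms] l
    by (simp add: twist_point[OF assms] side_le)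
  show "\<not> offset p + level p < 1 - 3 * level p \<Longrightarrow>
      side (twist p) = (side p + 1) mod 3 \<and> offset (twist p) = offset p + level p - (1 - 3 * level p)"
    using side_offset_pointI[of "offset p + level p - (1 - 3 * level p)" "level p" "(side p + 1) mod 3"]
      offset_bounds[OF assms] l
    by (simp add: twist_point[OF assms])
qed

lemma arc_pos_bounds:
  assumes "p \<in> annulus"
  shows "0 \<le> arc_pos p" "arc_pos p < 1"
proof -
  have "0 \<le> offset p / (1 - 3 * level p)" "offset p / (1 - 3 * level p) < 1"
    using offset_bounds[OF assms] by simp_all
  then show "0 \<le> arc_pos p" "arc_pos p < 1"
    using side_le[of p] unfolding arc_pos_def by (simp_all add: field_simps)
qed

text \<open>Dividing by the perimeter 3 (1 - 3 t) turns the shift by t, with its carries, into a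
  rotation of the unit circle. The two sides differ by an integer, and \<open>arc_pos\<close> has
  values in [0, 1).\<close>

lemma arc_pos_twist:
  assumes p: "p \<in> annulus"
  shows "arc_pos (twist p) = frac (arc_pos p + level p / (3 * (1 - 3 * level p)))"
proof -
  let ?l = "1 - 3 * level p"
  have l: "?l > 0" using p by (simp add: annulus_def)
  have tp: "twist p \<in> annulus" using p by (simp add: annulus_def level_twist)
  have aux: "(a + b - c) / c = a / c + b / c - 1" if "c > 0" for a b c :: real
    using that by (simp add: add_divide_distrib diff_divide_distrib)
  define r v where "r = offset p / ?l" and "v = level p / ?l"
  have a: "arc_pos p + level p / (3 * ?l) = (real (side p) + r + v) / 3"
    by (simp add: arc_pos_def r_def v_def add_divide_distrib)
  \<comment> \<open>The value -1 arises when the step leads from side 2 back to side 0.\<close>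
  have "arc_pos (twist p) - (arc_pos p + level p / (3 * ?l)) \<in> {0, -1}"
  proof (cases "offset p + level p < ?l")
    case True
    have "arc_pos (twist p) = (real (side p) + r + v) / 3"
      using twist_side_offset(1)[OF p True]
      by (simp add: arc_pos_def level_twist r_def v_def add_divide_distrib)
    then show ?thesis unfolding a by simp
  next
    case False
    have s: "side p = 0 \<or> side p = 1 \<or> side p = 2" using side_le[of p] by auto
    have "offset (twist p) / ?l = r + v - 1"
      using twist_side_offset(2)[OF p False] aux[OF l] unfolding r_def v_def by metis
    then have "arc_pos (twist p) = (real ((side p + 1) mod 3) + r + v - 1) / 3"
      using twist_side_offset(2)[OF p False] by (simp add: arc_pos_def level_twist)
    then show ?thesis using s unfolding a by (elim disjE) (simp_all add: field_simps)
  qed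
  then have "arc_pos p + level p / (3 * ?l) - arc_pos (twist p) = of_int 0 \<or>
      arc_pos p + level p / (3 * ?l) - arc_pos (twist p) = of_int 1" by auto
  then have "arc_pos p + level p / (3 * ?l) - arc_pos (twist p) \<in> \<int>" by (metis Ints_of_int)
  then show ?thesis
    using arc_pos_bounds[OF tp] by (subst eq_commute) (simp add: frac_unique_iff)
qed

text \<open>The inverse of \<open>(arc_pos, level)\<close> on \<open>annulus\<close>.\<close>

definition unarc :: "real \<times> real \<Rightarrow> real \<times> real" where
  "unarc = (\<lambda>(s, t).
     if s < 1/3 then point 0 (3 * s * (1 - 3 * t)) t
     else if s < 2/3 then point 1 ((3 * s - 1) * (1 - 3 * t)) t
     else point 2 ((3 * s - 2) * (1 - 3 * t)) t)"

lemma unarc_arc: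
  assumes p: "p \<in> annulus"
  shows "unarc (arc_pos p, level p) = p"
proof -
  have l: "1 - 3 * level p > 0" using p by (simp add: annulus_def)
  define r where "r = offset p / (1 - 3 * level p)"
  have r: "0 \<le> r" "r < 1" "r * (1 - 3 * level p) = offset p"
    using offset_bounds[OF p] l by (simp_all add: r_def)
  have a: "arc_pos p = (real (side p) + r) / 3" by (simp add: arc_pos_def r_def)
  have s: "side p = 0 \<or> side p = 1 \<or> side p = 2" using side_le[of p] by auto
  have pt: "point (side p) (r * (1 - 3 * level p)) (level p) = p"
    using point_side_offset[OF p] r(3) by simp
  show ?thesis
    using s
  proof (elim disjE)
    assume k: "side p = 0"
    then have "arc_pos p < 1/3" "3 * arc_pos p = r" using r unfolding a by (simp_all add: field_simps)
    then show ?thesis using pt by (simp add: unarc_def k)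
  next
    assume k: "side p = 1"
    then have "\<not> arc_pos p < 1/3" "arc_pos p < 2/3" "3 * arc_pos p - 1 = r" using r unfolding a by (simp_all add: field_simps)
    then show ?thesis using pt by (simp add: unarc_def k)
  next
    assume k: "side p = 2"
    then have "\<not> arc_pos p < 1/3" "\<not> arc_pos p < 2/3" "3 * arc_pos p - 2 = r" using r unfolding a by (simp_all add: field_simps)
    then show ?thesis using pt by (simp add: unarc_def k)
  qed
qed

lemma twist_measurable [measurable]: "twist \<in> borel \<rightarrow>\<^sub>M borel"
  unfolding twist_def borel_prod[symmetric] by measurable

lemma level_measurable [measurable]: "level \<in> borel_measurable borel"
  unfolding level_def borel_prod[symmetric] by measurable

lemma side_measurable [measurable]: "side \<in> borel \<rightarrow>\<^sub>M count_space UNIV"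
  unfolding side_def borel_prod[symmetric] by measurable

lemma offset_measurable [measurable]: "offset \<in> borel_measurable borel"
proof -
  have "offset = (\<lambda>p. if side p = 0 then fst p - snd p else if side p = 1 then fst p + 2 * snd p - 1
    else 1 - 2 * fst p - snd p)" by (auto simp: offset_def fun_eq_iff)
  moreover have "\<dots> \<in> borel_measurable borel"
    by (intro measurable_If borel_measurable_continuous_onI continuous_intros) measurable
  ultimately show ?thesis by simp
qed

lemma arc_pos_measurable [measurable]: "arc_pos \<in> borel_measurable borel"
  unfolding arc_pos_def by measurable

lemma unarc_measurable [measurable]: "unarc \<in> borel \<rightarrow>\<^sub>M borel"
  unfolding unarc_def point_def borel_prod[symmetric] by measurable

lemma annulus_measurable [measurable]: "annulus \<in> sets borel"
  unfolding annulus_def by measurable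

text \<open>The lattice length of the part of S on the boundary of the concentric triangle at level
  t.\<close>

definition slice :: "(real \<times> real) set \<Rightarrow> real \<Rightarrow> ennreal" where
  "slice S t = (\<Sum>k<3. \<integral>\<^sup>+w. (if 0 \<le> w \<and> w < 1 - 3 * t \<and> point k w t \<in> S then 1 else 0) \<partial>lborel)"

lemma point_measurable [measurable]:
  "(\<lambda>(t, w). point k w t) \<in> borel \<Otimes>\<^sub>M borel \<rightarrow>\<^sub>M borel"
  unfolding point_def borel_prod[symmetric] by measurable

lemma slice_measurable [measurable]:
  assumes [measurable]: "S \<in> sets borel"
  shows "slice S \<in> borel_measurable borel"
  unfolding slice_def by measurable

text \<open>On the third of the circle that belongs to side k, substitute s = k / 3 + c w with c the
  inverse perimeter; then w is the offset and c is the Jacobian.\<close>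

lemma emeasure_unit_uniform_unarc:
  assumes [measurable]: "S \<in> sets borel" and t: "t < 1/3"
  shows "emeasure unit_uniform {s. unarc (s, t) \<in> S} = ennreal (1 / (3 * (1 - 3 * t))) * slice S t"
proof -
  let ?l = "1 - 3 * t"
  have l: "?l > 0" using t by simp
  define c where "c = 1 / (3 * ?l)"
  have c: "c > 0" "3 * c * ?l = 1" using l by (simp_all add: c_def field_simps)
  have [measurable]: "(\<lambda>s. unarc (s, t)) \<in> borel \<rightarrow>\<^sub>M borel"
    by (rule measurable_compose[OF _ unarc_measurable]) (simp flip: borel_prod)
  let ?f = "\<lambda>k s. if real k / 3 \<le> s \<and> s < (real k + 1) / 3 \<and> point k ((3 * s - real k) * ?l) t \<in> S
    then 1 else 0 :: ennreal"
  have [measurable]: "(\<lambda>s. point k ((3 * s - real k) * ?l) t) \<in> borel \<rightarrow>\<^sub>M borel" for k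
    unfolding point_def borel_prod[symmetric] by measurable
  have "emeasure unit_uniform {s. unarc (s, t) \<in> S} = (\<integral>\<^sup>+s. indicator ({s. unarc (s, t) \<in> S} \<inter> {0..<1}) s \<partial>lborel)"
    by (subst emeasure_unit_uniform) (auto simp: nn_integral_indicator)
  also have "\<dots> = (\<integral>\<^sup>+s. (\<Sum>k<3. ?f k s) \<partial>lborel)"
  proof (rule nn_integral_cong)
    fix s :: real
    consider "s < 0" | "0 \<le> s" "s < 1/3" | "1/3 \<le> s" "s < 2/3" | "2/3 \<le> s" "s < 1" | "1 \<le> s"
      by linarith
    then show "indicator ({s. unarc (s, t) \<in> S} \<inter> {0..<1}) s = (\<Sum>k<3. ?f k s)"
      by cases (simp_all add: indicator_def unarc_def eval_nat_numeral)
  qed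
  also have "\<dots> = (\<Sum>k<3. \<integral>\<^sup>+s. ?f k s \<partial>lborel)"
    by (rule nn_integral_sum) measurable
  also have "\<dots> = (\<Sum>k<3. ennreal c * (\<integral>\<^sup>+w. (if 0 \<le> w \<and> w < ?l \<and> point k w t \<in> S then 1 else 0) \<partial>lborel))"
  proof (rule sum.cong[OF refl])
    fix k
    have "(\<integral>\<^sup>+s. ?f k s \<partial>lborel) = ennreal \<bar>c\<bar> * (\<integral>\<^sup>+w. ?f k (real k / 3 + c * w) \<partial>lborel)"
      by (rule nn_integral_real_affine) (use c in auto)
    also have "(\<lambda>w. ?f k (real k / 3 + c * w)) = (\<lambda>w. if 0 \<le> w \<and> w < ?l \<and> point k w t \<in> S then 1 else 0)"
    proof (rule ext)
      fix w
      have 1: "(3 * (real k / 3 + c * w) - real k) * ?l = w"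
      proof -
        have "(3 * (real k / 3 + c * w) - real k) * ?l = (3 * c * ?l) * w" by (simp add: field_simps)
        then show ?thesis using c(2) by simp
      qed
      have 2: "real k / 3 + c * w < (real k + 1) / 3 \<longleftrightarrow> w < ?l"
      proof -
        have "real k / 3 + c * w < (real k + 1) / 3 \<longleftrightarrow> 3 * c * w < 1"
          by (simp add: field_simps)
        also have "\<dots> \<longleftrightarrow> 3 * c * w < 3 * c * ?l" using c(2) by simp
        finally have "real k / 3 + c * w < (real k + 1) / 3 \<longleftrightarrow> 3 * c * w < 3 * c * ?l" .
        then show ?thesis using c(1) by simp
      qed
      show "?f k (real k / 3 + c * w) = (if 0 \<le> w \<and> w < ?l \<and> point k w t \<in> S then 1 else 0)"
        unfolding 1 2 using c(1) by (simp add: zero_le_mult_iff)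
    qed
    finally show "(\<integral>\<^sup>+s. ?f k s \<partial>lborel) =
      ennreal c * (\<integral>\<^sup>+w. (if 0 \<le> w \<and> w < ?l \<and> point k w t \<in> S then 1 else 0) \<partial>lborel)"
      using c by simp
  qed
  finally show ?thesis by (simp add: slice_def c_def sum_distrib_left)
qed

section \<open>Lebesgue measure of the annulus, level by level\<close>

lemma emeasure_lborel_pair:
  assumes [measurable]: "S \<in> sets (borel :: (real \<times> real) measure)"
  shows "emeasure lborel S = (\<integral>\<^sup>+y. (\<integral>\<^sup>+x. (if (x, y) \<in> S then 1 else 0) \<partial>lborel) \<partial>lborel)"
    and "emeasure lborel S = (\<integral>\<^sup>+x. (\<integral>\<^sup>+y. (if (x, y) \<in> S then 1 else 0) \<partial>lborel) \<partial>lborel)"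
proof -
  have S: "S \<in> sets (lborel \<Otimes>\<^sub>M lborel)" unfolding lborel_prod by simp
  have f: "(\<lambda>p. indicator S p) \<in> borel_measurable (lborel \<Otimes>\<^sub>M lborel)"
    using S by (rule borel_measurable_indicator)
  have "emeasure lborel S = (\<integral>\<^sup>+p. indicator S p \<partial>(lborel \<Otimes>\<^sub>M lborel))"
    using S unfolding lborel_prod by simp
  then show "emeasure lborel S = (\<integral>\<^sup>+y. (\<integral>\<^sup>+x. (if (x, y) \<in> S then 1 else 0) \<partial>lborel) \<partial>lborel)"
    and "emeasure lborel S = (\<integral>\<^sup>+x. (\<integral>\<^sup>+y. (if (x, y) \<in> S then 1 else 0) \<partial>lborel) \<partial>lborel)"
    using lborel_pair.nn_integral_snd[OF f] lborel.nn_integral_fst[OF f]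
    by (simp_all add: indicator_def of_bool_def)
qed

text \<open>On each side, the change from level and offset to (x, y) has determinant of absolute
  value one, so Lebesgue measure integrates lattice length against dt. This is the model with which
  an invariant measure is compared.\<close>

lemma emeasure_lborel_annulus:
  assumes S [measurable]: "S \<in> sets borel"
  shows "emeasure lborel (annulus \<inter> S) = (\<integral>\<^sup>+t. (if 0 < t \<and> t < 1/4 then slice S t else 0) \<partial>lborel)"
proof -
  let ?I = "\<lambda>k t. (\<integral>\<^sup>+w. (if 0 \<le> w \<and> w < 1 - 3 * t \<and> point k w t \<in> S then 1 else 0) \<partial>lborel)"
  have [measurable]: "(\<lambda>t. point k w t) \<in> borel \<rightarrow>\<^sub>M borel" "(\<lambda>w. point k w t) \<in> borel \<rightarrow>\<^sub>M borel" for k w t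
    unfolding point_def borel_prod[symmetric] by measurable
  have [measurable]: "{p \<in> annulus \<inter> S. side p = k} \<in> sets borel" for k
    by measurable
  have side0: "emeasure lborel {p \<in> annulus \<inter> S. side p = 0} = (\<integral>\<^sup>+t. (if 0 < t \<and> t < 1/4 then ?I 0 t else 0) \<partial>lborel)"
    unfolding emeasure_lborel_pair(1)[OF \<open>{p \<in> annulus \<inter> S. side p = 0} \<in> sets borel\<close>]
  proof (rule nn_integral_cong)
    fix t :: real
    have "(\<integral>\<^sup>+x. (if (x, t) \<in> {p \<in> annulus \<inter> S. side p = 0} then 1 else 0) \<partial>lborel) =
      ennreal \<bar>1\<bar> * (\<integral>\<^sup>+w. (if (t + 1 * w, t) \<in> {p \<in> annulus \<inter> S. side p = 0} then 1 else 0) \<partial>lborel)"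
      by (rule nn_integral_real_affine) (simp_all flip: borel_prod)
    also have "\<dots> = (\<integral>\<^sup>+w. (if 0 < t \<and> t < 1/4 then (if 0 \<le> w \<and> w < 1 - 3 * t \<and> point 0 w t \<in> S then 1 else 0) else 0) \<partial>lborel)"
    proof (simp, rule nn_integral_cong)
      fix w
      have "(t + w, t) \<in> annulus \<and> side (t + w, t) = 0 \<longleftrightarrow> 0 < t \<and> t < 1/4 \<and> 0 \<le> w \<and> w < 1 - 3 * t"
        by (auto simp: annulus_iff side_def)
      then show "(if (t + w, t) \<in> annulus \<and> (t + w, t) \<in> S \<and> side (t + w, t) = 0 then 1 else 0) =
        (if 0 < t \<and> t * 4 < 1 then if 0 \<le> w \<and> w < 1 - 3 * t \<and> point 0 w t \<in> S then 1 else 0 else (0 :: ennreal))"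
        by (auto simp: point_def)
    qed
    also have "\<dots> = (if 0 < t \<and> t < 1/4 then ?I 0 t else 0)"
      by (cases "0 < t"; cases "t < 1/4") simp_all
    finally show "(\<integral>\<^sup>+x. (if (x, t) \<in> {p \<in> annulus \<inter> S. side p = 0} then 1 else 0) \<partial>lborel) =
      (if 0 < t \<and> t < 1/4 then ?I 0 t else 0)" .
  qed
  have side2: "emeasure lborel {p \<in> annulus \<inter> S. side p = 2} = (\<integral>\<^sup>+t. (if 0 < t \<and> t < 1/4 then ?I 2 t else 0) \<partial>lborel)"
    unfolding emeasure_lborel_pair(2)[OF \<open>{p \<in> annulus \<inter> S. side p = 2} \<in> sets borel\<close>]
  proof (rule nn_integral_cong)
    fix t :: real
    have "(\<integral>\<^sup>+y. (if (t, y) \<in> {p \<in> annulus \<inter> S. side p = 2} then 1 else 0) \<partial>lborel) =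
      ennreal \<bar>-1\<bar> * (\<integral>\<^sup>+w. (if (t, (1 - 2 * t) + -1 * w) \<in> {p \<in> annulus \<inter> S. side p = 2} then 1 else 0) \<partial>lborel)"
      by (rule nn_integral_real_affine) (simp_all flip: borel_prod)
    also have "\<dots> = (\<integral>\<^sup>+w. (if 0 < t \<and> t < 1/4 then (if 0 \<le> w \<and> w < 1 - 3 * t \<and> point 2 w t \<in> S then 1 else 0) else 0) \<partial>lborel)"
    proof (simp, rule nn_integral_cong)
      fix w
      have "(t, 1 - 2 * t - w) \<in> annulus \<and> side (t, 1 - 2 * t - w) = 2 \<longleftrightarrow> 0 < t \<and> t < 1/4 \<and> 0 \<le> w \<and> w < 1 - 3 * t"
        unfolding annulus_iff side_def by auto
      then show "(if (t, 1 - 2 * t - w) \<in> annulus \<and> (t, 1 - 2 * t - w) \<in> S \<and> side (t, 1 - 2 * t - w) = 2 then 1 else 0) =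
        (if 0 < t \<and> t * 4 < 1 then if 0 \<le> w \<and> w < 1 - 3 * t \<and> point 2 w t \<in> S then 1 else 0 else (0 :: ennreal))"
        by (auto simp: point_def)
    qed
    also have "\<dots> = (if 0 < t \<and> t < 1/4 then ?I 2 t else 0)"
      by (cases "0 < t"; cases "t < 1/4") simp_all
    finally show "(\<integral>\<^sup>+y. (if (t, y) \<in> {p \<in> annulus \<inter> S. side p = 2} then 1 else 0) \<partial>lborel) =
      (if 0 < t \<and> t < 1/4 then ?I 2 t else 0)" .
  qed
  let ?g = "\<lambda>y t. (if (1 - y - t, y) \<in> {p \<in> annulus \<inter> S. side p = 1} then 1 else 0 :: ennreal)"
  have [measurable]: "(\<lambda>(y, t). (1 - y - t, y)) \<in> borel \<Otimes>\<^sub>M borel \<rightarrow>\<^sub>M (borel :: (real \<times> real) measure)"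
    unfolding borel_prod[symmetric] by measurable
  \<comment> \<open>Neither coordinate is constant along the slanted side: x is replaced by t = 1 -
    x - y for fixed y, and, after exchanging the integrals, y by t + w for fixed t.\<close>
  have side1: "emeasure lborel {p \<in> annulus \<inter> S. side p = 1} = (\<integral>\<^sup>+t. (if 0 < t \<and> t < 1/4 then ?I 1 t else 0) \<partial>lborel)"
  proof -
    have "emeasure lborel {p \<in> annulus \<inter> S. side p = 1} = (\<integral>\<^sup>+y. (\<integral>\<^sup>+t. ?g y t \<partial>lborel) \<partial>lborel)"
      unfolding emeasure_lborel_pair(1)[OF \<open>{p \<in> annulus \<inter> S. side p = 1} \<in> sets borel\<close>]
    proof (rule nn_integral_cong)
      fix y :: real
      have "(\<integral>\<^sup>+x. (if (x, y) \<in> {p \<in> annulus \<inter> S. side p = 1} then 1 else 0) \<partial>lborel) =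
        ennreal \<bar>-1\<bar> * (\<integral>\<^sup>+t. (if ((1 - y) + -1 * t, y) \<in> {p \<in> annulus \<inter> S. side p = 1} then 1 else 0) \<partial>lborel)"
        by (rule nn_integral_real_affine) (simp_all flip: borel_prod)
      then show "(\<integral>\<^sup>+x. (if (x, y) \<in> {p \<in> annulus \<inter> S. side p = 1} then 1 else 0) \<partial>lborel) = (\<integral>\<^sup>+t. ?g y t \<partial>lborel)"
        by simp
    qed
    also have "\<dots> = (\<integral>\<^sup>+t. (\<integral>\<^sup>+y. ?g y t \<partial>lborel) \<partial>lborel)"
      by (rule lborel_pair.Fubini') measurable
    also have "\<dots> = (\<integral>\<^sup>+t. (if 0 < t \<and> t < 1/4 then ?I 1 t else 0) \<partial>lborel)"
    proof (rule nn_integral_cong)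
      fix t :: real
      have "(\<integral>\<^sup>+y. ?g y t \<partial>lborel) = ennreal \<bar>1\<bar> * (\<integral>\<^sup>+w. ?g (t + 1 * w) t \<partial>lborel)"
        by (rule nn_integral_real_affine) (simp_all flip: borel_prod)
      also have "\<dots> = (\<integral>\<^sup>+w. (if 0 < t \<and> t < 1/4 then (if 0 \<le> w \<and> w < 1 - 3 * t \<and> point 1 w t \<in> S then 1 else 0) else 0) \<partial>lborel)"
      proof (simp only: abs_one ennreal_1 mult_1_left, rule nn_integral_cong)
        fix w
        have "(1 - (t + w) - t, t + w) = point 1 w t" by (simp add: point_def)
        moreover have "point 1 w t \<in> annulus \<and> side (point 1 w t) = 1 \<longleftrightarrow> 0 < t \<and> t < 1/4 \<and> 0 \<le> w \<and> w < 1 - 3 * t"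
          by (auto simp: point_def annulus_iff side_def)
        ultimately have "(1 - (t + w) - t, t + w) \<in> {p \<in> annulus \<inter> S. side p = 1} \<longleftrightarrow>
            (0 < t \<and> t < 1/4) \<and> 0 \<le> w \<and> w < 1 - 3 * t \<and> point 1 w t \<in> S"
          by (simp only:) blast
        then show "?g (t + w) t =
          (if 0 < t \<and> t < 1/4 then if 0 \<le> w \<and> w < 1 - 3 * t \<and> point 1 w t \<in> S then 1 else 0 else (0 :: ennreal))"
          by (cases "0 < t \<and> t < 1/4") (simp_all only: if_True if_False simp_thms)
      qed
      also have "\<dots> = (if 0 < t \<and> t < 1/4 then ?I 1 t else 0)"
      by (cases "0 < t"; cases "t < 1/4") simp_all
      finally show "(\<integral>\<^sup>+y. ?g y t \<partial>lborel) = (if 0 < t \<and> t < 1/4 then ?I 1 t else 0)" .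
    qed
    finally show ?thesis .
  qed
  have "annulus \<inter> S = (\<Union>k<3. {p \<in> annulus \<inter> S. side p = k})"
    using side_le by (auto simp: less_Suc_eq_le eval_nat_numeral)
  also have "emeasure lborel \<dots> = (\<Sum>k<3. emeasure lborel {p \<in> annulus \<inter> S. side p = k})"
    by (rule sum_emeasure[symmetric]) (auto simp: disjoint_family_on_def)
  also have "\<dots> = (\<Sum>k<3. \<integral>\<^sup>+t. (if 0 < t \<and> t < 1/4 then ?I k t else 0) \<partial>lborel)"
  proof (rule sum.cong[OF refl])
    fix k :: nat assume "k \<in> {..<3}"
    then have "k = 0 \<or> k = 1 \<or> k = 2" by auto
    then show "emeasure lborel {p \<in> annulus \<inter> S. side p = k} = (\<integral>\<^sup>+t. (if 0 < t \<and> t < 1/4 then ?I k t else 0) \<partial>lborel)"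
      using side0 side1 side2 by (elim disjE) (simp_all only:)
  qed
  also have "\<dots> = (\<integral>\<^sup>+t. (\<Sum>k<3. if 0 < t \<and> t < 1/4 then ?I k t else 0) \<partial>lborel)"
    by (rule nn_integral_sum[symmetric]) measurable
  also have "\<dots> = (\<integral>\<^sup>+t. (if 0 < t \<and> t < 1/4 then slice S t else 0) \<partial>lborel)"
  proof (rule nn_integral_cong)
    fix t :: real
    show "(\<Sum>k<3. if 0 < t \<and> t < 1/4 then ?I k t else 0) = (if 0 < t \<and> t < 1/4 then slice S t else 0)"
      by (cases "0 < t \<and> t < 1/4") (simp_all only: slice_def if_True if_False simp_thms sum.neutral_const)
  qed
  finally show ?thesis .
qed

section \<open>Planar measures invariant under the twist and the reflections\<close>

text \<open>The lines excluded here contain the boundaries at rational level of the concentric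
  triangles and of their reflected copies; x - y enters through the reflections.\<close>

definition generic :: "real \<times> real \<Rightarrow> bool" where
  "generic p \<longleftrightarrow> fst p \<notin> \<rat> \<and> snd p \<notin> \<rat> \<and> fst p + snd p \<notin> \<rat> \<and> fst p - snd p \<notin> \<rat>"

definition flip1 :: "real \<times> real \<Rightarrow> real \<times> real" where "flip1 p = (1 - fst p, snd p)"
definition flip2 :: "real \<times> real \<Rightarrow> real \<times> real" where "flip2 p = (fst p, 1 - snd p)"

lemma flip_measurable [measurable]: "flip1 \<in> borel \<rightarrow>\<^sub>M borel" "flip2 \<in> borel \<rightarrow>\<^sub>M borel"
  unfolding flip1_def flip2_def borel_prod[symmetric] by measurable

lemma flip_flip [simp]: "flip1 (flip1 p) = p" "flip2 (flip2 p) = p"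
  by (simp_all add: flip1_def flip2_def)

lemma Rats_of_rotation_number:
  fixes x :: real
  assumes "x / (3 * (1 - 3 * x)) \<in> \<rat>"
  shows "x \<in> \<rat>"
proof (cases "1 - 3 * x = 0")
  \<comment> \<open>At x = 1/3 the quotient is 0 by the convention on division and says nothing, but
    1/3 is itself rational.\<close>
  case True
  then have "x = 1 / 3" by simp
  then show ?thesis by (simp only:) (intro Rats_divide Rats_1 Rats_number_of)
next
  case False
  define r where "r = x / (3 * (1 - 3 * x))"
  have "r * (3 * (1 - 3 * x)) = x" using False by (simp add: r_def)
  then have "x * (1 + 9 * r) = 3 * r" by (simp add: algebra_simps)
  moreover from this have "1 + 9 * r \<noteq> 0" by auto
  ultimately have "x = 3 * r / (1 + 9 * r)" by (simp add: field_simps)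
  moreover have "r \<in> \<rat>" using assms by (simp add: r_def)
  ultimately show ?thesis by simp
qed

lemma emeasure_lborel_flip:
  assumes B [measurable]: "B \<in> sets borel"
  shows "emeasure lborel (flip1 -` B) = emeasure lborel B"
    and "emeasure lborel (flip2 -` B) = emeasure lborel B"
proof -
  have F: "flip1 -` B \<in> sets borel" "flip2 -` B \<in> sets borel"
    using measurable_sets[OF flip_measurable(1) B] measurable_sets[OF flip_measurable(2) B] by simp_all
  have "(\<integral>\<^sup>+x. (if (x, y) \<in> B then 1 else 0) \<partial>lborel) =
      ennreal \<bar>-1\<bar> * (\<integral>\<^sup>+x. (if (1 + -1 * x, y) \<in> B then 1 else 0) \<partial>lborel)" for y
    by (rule nn_integral_real_affine) (simp_all flip: borel_prod)
  then show "emeasure lborel (flip1 -` B) = emeasure lborel B"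
    unfolding emeasure_lborel_pair(1)[OF B] emeasure_lborel_pair(1)[OF F(1)] by (simp add: flip1_def)
  have "(\<integral>\<^sup>+y. (if (x, y) \<in> B then 1 else 0) \<partial>lborel) =
      ennreal \<bar>-1\<bar> * (\<integral>\<^sup>+y. (if (x, 1 + -1 * y) \<in> B then 1 else 0) \<partial>lborel)" for x
    by (rule nn_integral_real_affine) (simp_all flip: borel_prod)
  then show "emeasure lborel (flip2 -` B) = emeasure lborel B"
    unfolding emeasure_lborel_pair(2)[OF B] emeasure_lborel_pair(2)[OF F(2)] by (simp add: flip2_def)
qed

text \<open>Fubini along an axis whose coefficient is nonzero: each parallel to it meets the
  exceptional set in countably many points.\<close>

lemma AE_lborel_irrational:
  fixes a b :: real
  assumes "a \<noteq> 0 \<or> b \<noteq> 0"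
  shows "AE p in lborel. a * fst p + b * snd p \<notin> \<rat>"
proof (rule AE_I')
  let ?N = "{p :: real \<times> real. a * fst p + b * snd p \<in> \<rat>}"
  have "(\<lambda>p :: real \<times> real. a * fst p + b * snd p) \<in> borel_measurable borel"
    by (intro borel_measurable_continuous_onI continuous_intros)
  moreover have "(\<rat> :: real set) \<in> sets borel"
    by (rule sets.countable[OF _ countable_rat]) simp
  ultimately have "(\<lambda>p :: real \<times> real. a * fst p + b * snd p) -` \<rat> \<inter> space borel \<in> sets borel"
    by (rule measurable_sets)
  then have N: "?N \<in> sets borel" by (simp add: vimage_def)
  have line: "(\<integral>\<^sup>+x. (if c * x + d \<in> \<rat> then 1 else 0) \<partial>lborel) = 0" if "c \<noteq> 0" for c d :: real
  proof -
    have "{x. c * x + d \<in> \<rat>} = (\<lambda>r. (r - d) / c) ` \<rat>"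
      using that by (auto simp: image_iff intro!: bexI[of _ "c * _ + d"])
    then have c: "countable {x. c * x + d \<in> \<rat>}" by (metis countable_image countable_rat)
    then have "{x. c * x + d \<in> \<rat>} \<in> sets lborel" by (rule sets.countable[rotated]) simp
    then have "(\<integral>\<^sup>+x. indicator {x. c * x + d \<in> \<rat>} x \<partial>lborel) = emeasure lborel {x. c * x + d \<in> \<rat>}"
      by (rule nn_integral_indicator)
    also have "\<dots> = 0" using c by (rule emeasure_lborel_countable)
    finally show ?thesis by (simp add: indicator_def of_bool_def)
  qed
  have "emeasure lborel ?N = 0"
  proof (cases "a = 0")
    case False
    then show ?thesis
      unfolding emeasure_lborel_pair(1)[OF N] using line[of a] by simp
  next
    case True
    then show ?thesis
      unfolding emeasure_lborel_pair(2)[OF N] using line[of b 0] assms by simp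
  qed
  then show "?N \<in> null_sets lborel" using N by (simp add: null_sets_def)
qed auto

lemma AE_lborel_generic: "AE p in lborel. generic p"
proof -
  have "AE p in (lborel :: (real \<times> real) measure). fst p \<notin> \<rat>" "AE p in (lborel :: (real \<times> real) measure). snd p \<notin> \<rat>"
    "AE p in (lborel :: (real \<times> real) measure). fst p + snd p \<notin> \<rat>" "AE p in (lborel :: (real \<times> real) measure). fst p - snd p \<notin> \<rat>"
    using AE_lborel_irrational[of 1 0] AE_lborel_irrational[of 0 1]
      AE_lborel_irrational[of 1 1] AE_lborel_irrational[of 1 "-1"] by simp_all
  then show ?thesis by eventually_elim (simp add: generic_def)
qed

text \<open>Up to non-generic points, an annulus misses only the central triangle of its big
  triangle. The half of that central triangle on either side of the diagonal lies in the annulus of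
  the copy reflected in one coordinate.\<close>

lemma generic_cover:
  assumes "generic p" "p \<in> {0..1} \<times> {0..1}"
  shows "p \<in> annulus \<or> flip1 p \<in> annulus \<or> flip2 p \<in> annulus \<or> flip1 (flip2 p) \<in> annulus"
proof -
  obtain x y where p: "p = (x, y)" by (cases p)
  have R: "1 / 4 \<in> (\<rat> :: real set)" "3 / 4 \<in> (\<rat> :: real set)" "1 \<in> (\<rat> :: real set)" "0 \<in> (\<rat> :: real set)"
    by (intro Rats_divide Rats_number_of Rats_1 Rats_0)+
  have x: "x \<notin> \<rat>" "y \<notin> \<rat>" "x + y \<notin> \<rat>" "x - y \<notin> \<rat>" using assms by (simp_all add: generic_def p)
  have "x \<noteq> 0" "x \<noteq> 1" "x \<noteq> 1/4" "x \<noteq> 3/4" "y \<noteq> 0" "y \<noteq> 1" "y \<noteq> 1/4" "y \<noteq> 3/4" "x + y \<noteq> 1" "x - y \<noteq> 0"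
    using x R by metis+
  moreover have "0 \<le> x" "x \<le> 1" "0 \<le> y" "y \<le> 1" using assms p by auto
  ultimately show ?thesis
    unfolding p flip1_def flip2_def fst_conv snd_conv annulus_iff by argo
qed

text \<open>These are the properties shared by all marginals on two coordinates, including those
  conditioned on the other coordinates; the total mass is therefore left free.\<close>

locale planar_invariant = finite_measure \<nu> for \<nu> :: "(real \<times> real) measure" +
  assumes sets_\<nu> [measurable_cong, simp]: "sets \<nu> = sets borel"
    and AE_square: "AE p in \<nu>. p \<in> {0..1} \<times> {0..1}"
    and AE_generic: "AE p in \<nu>. generic p"
    and twist_invariant: "\<And>B. B \<in> sets borel \<Longrightarrow> emeasure \<nu> (twist -` B) = emeasure \<nu> B"
    and flip1_invariant: "\<And>B. B \<in> sets borel \<Longrightarrow> emeasure \<nu> (flip1 -` B) = emeasure \<nu> B"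
    and flip2_invariant: "\<And>B. B \<in> sets borel \<Longrightarrow> emeasure \<nu> (flip2 -` B) = emeasure \<nu> B"
begin

section \<open>Disintegration of the measure on the annulus\<close>

definition M :: "(real \<times> real) measure" where
  "M = distr (density \<nu> (indicator annulus)) borel (\<lambda>p. (arc_pos p, level p))"

lemma space_\<nu> [simp]: "space \<nu> = UNIV"
  using sets_eq_imp_space_eq[OF sets_\<nu>] by simp

lemma coords_measurable [measurable]: "(\<lambda>p. (arc_pos p, level p)) \<in> borel \<rightarrow>\<^sub>M borel"
  by (subst (2) borel_prod[symmetric]) measurable

lemma sets_M [simp]: "sets M = sets borel" by (simp add: M_def)

lemma emeasure_M:
  assumes B [measurable]: "B \<in> sets borel"
  shows "emeasure M B = emeasure \<nu> (annulus \<inter> (\<lambda>p. (arc_pos p, level p)) -` B)"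
proof -
  have B': "(\<lambda>p. (arc_pos p, level p)) -` B \<in> sets \<nu>"
    using measurable_sets[OF coords_measurable B] by simp
  have "emeasure M B = emeasure (density \<nu> (indicator annulus)) ((\<lambda>p. (arc_pos p, level p)) -` B)"
    unfolding M_def
    by (subst emeasure_distr)
       (simp_all add: measurable_cong_sets[OF sets_density refl] measurable_cong_sets[OF sets_\<nu> refl])
  also have "\<dots> = emeasure \<nu> (annulus \<inter> (\<lambda>p. (arc_pos p, level p)) -` B)"
    by (rule emeasure_restricted) (use B' in auto)
  finally show ?thesis .
qed

lemma finite_measure_M: "finite_measure M"
proof
  have "emeasure M UNIV \<noteq> \<infinity>" by (simp add: emeasure_M)
  then show "emeasure M (space M) \<noteq> \<infinity>"
    using sets_eq_imp_space_eq[OF sets_M] by simp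
qed

lemma AE_M:
  assumes [measurable]: "{q. P q} \<in> sets borel"
    and P: "AE p in \<nu>. p \<in> annulus \<longrightarrow> P (arc_pos p, level p)"
  shows "AE q in M. P q"
proof (rule AE_I')
  have *: "{q. \<not> P q} \<in> sets borel"
    using sets.compl_sets[OF assms(1)] by (simp add: Collect_neg_eq Compl_eq_Diff_UNIV)
  have "emeasure \<nu> (annulus \<inter> (\<lambda>p. (arc_pos p, level p)) -` {q. \<not> P q}) = emeasure \<nu> {}"
  proof (rule emeasure_eq_AE)
    show "AE p in \<nu>. p \<in> annulus \<inter> (\<lambda>p. (arc_pos p, level p)) -` {q. \<not> P q} \<longleftrightarrow> p \<in> {}"
      using P by eventually_elim auto
    show "annulus \<inter> (\<lambda>p. (arc_pos p, level p)) -` {q. \<not> P q} \<in> sets \<nu>"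
      using measurable_sets[OF coords_measurable *] by auto
  qed simp
  then show "{q. \<not> P q} \<in> null_sets M" using * by (auto simp: null_sets_def emeasure_M)
qed auto

text \<open>The twist preserves the annulus and rotates the circle at level t by t / (3 (1 - 3 t)),
  so its invariance passes to arc coordinates. At a generic point the level, being one of x, y, 1 -
  x - y, is irrational, and so is the angle.\<close>

sublocale skew: skew_rotation M "\<lambda>t. t / (3 * (1 - 3 * t))"
proof (intro skew_rotation.intro skew_rotation_axioms.intro)
  show "finite_measure M" by (rule finite_measure_M)
  show "AE q in M. fst q \<in> {0..<1}"
  proof (rule AE_M)
    have "{q. fst q \<in> {0..<1}} = ({0..<1} \<times> UNIV :: (real \<times> real) set)" by auto
    then show "{q. fst q \<in> {0..<1}} \<in> sets (borel :: (real \<times> real) measure)"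
      by (simp add: borel_Times)
    show "AE p in \<nu>. p \<in> annulus \<longrightarrow> fst (arc_pos p, level p) \<in> {0..<1}"
      by (rule AE_I2) (simp add: arc_pos_bounds)
  qed
  show "AE q in M. snd q / (3 * (1 - 3 * snd q)) \<notin> \<rat>"
  proof (rule AE_M)
    let ?Q = "{x :: real. x / (3 * (1 - 3 * x)) \<in> \<rat>}"
    have "countable ?Q"
      by (rule countable_subset[OF _ countable_rat]) (use Rats_of_rotation_number in blast)
    then have "?Q \<in> sets borel" by (rule sets.countable[rotated]) simp
    moreover have "{q. snd q / (3 * (1 - 3 * snd q)) \<notin> \<rat>} = (UNIV \<times> - ?Q :: (real \<times> real) set)"
      by auto
    ultimately show "{q. snd q / (3 * (1 - 3 * snd q)) \<notin> \<rat>} \<in> sets (borel :: (real \<times> real) measure)"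
      by (simp only:) (intro borel_Times borel_comp; simp)
    show "AE p in \<nu>. p \<in> annulus \<longrightarrow> snd (arc_pos p, level p) / (3 * (1 - 3 * snd (arc_pos p, level p))) \<notin> \<rat>"
      using AE_generic
    proof eventually_elim
      case (elim p)
      obtain x y where p: "p = (x, y)" by (cases p)
      have "1 - x - y \<notin> \<rat>"
      proof
        assume "1 - x - y \<in> \<rat>"
        then have "1 - (1 - x - y) \<in> \<rat>" by (rule Rats_diff[OF Rats_1])
        then show False using elim by (simp add: generic_def p)
      qed
      then have "level p \<notin> \<rat>"
        using elim by (auto simp: generic_def level_def p min_def)
      then show ?case using Rats_of_rotation_number[of "level p"] by (metis snd_conv)
    qed
  qed
  fix B :: "(real \<times> real) set" assume B [measurable]: "B \<in> sets borel"
  let ?R = "\<lambda>(s, t). (frac (s + t / (3 * (1 - 3 * t))), t)"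
  let ?\<Phi> = "\<lambda>p. (arc_pos p, level p)"
  have R: "?R \<in> borel \<rightarrow>\<^sub>M (borel :: (real \<times> real) measure)"
    unfolding frac_def borel_prod[symmetric] by measurable
  have RB: "?R -` B \<in> sets borel"
    using measurable_sets[OF R B] by simp
  have "annulus \<inter> ?\<Phi> -` (?R -` B) = twist -` (annulus \<inter> ?\<Phi> -` B)"
  proof (rule Set.set_eqI)
    fix p
    have "twist p \<in> annulus \<longleftrightarrow> p \<in> annulus" by (simp add: annulus_def level_twist)
    then show "p \<in> annulus \<inter> ?\<Phi> -` (?R -` B) \<longleftrightarrow> p \<in> twist -` (annulus \<inter> ?\<Phi> -` B)"
      by (simp add: arc_pos_twist level_twist cong: conj_cong)
  qed
  note eq = this
  have m: "annulus \<inter> ?\<Phi> -` B \<in> sets borel"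
    using measurable_sets[OF coords_measurable B] by auto
  show "emeasure M (?R -` B) = emeasure M B"
    unfolding emeasure_M[OF RB] emeasure_M[OF B] eq by (rule twist_invariant[OF m])
qed auto

text \<open>The distribution of the level divided by the perimeter, that is, mass per unit length of
  boundary. For Lebesgue measure on the annulus it is dt on (0, 1/4).\<close>

definition height :: "real measure" where
  "height = density (distr M borel snd) (\<lambda>t. if 0 < t \<and> t < 1/4 then ennreal (1 / (3 * (1 - 3 * t))) else 0)"

lemma sets_height [measurable_cong, simp]: "sets height = sets borel"
  by (simp add: height_def)

lemma finite_measure_base: "finite_measure (distr M borel snd)"
  by (intro finite_measure.finite_measure_distr finite_measure_M) (simp add: skew.snd_measurable)

text \<open>By \<open>eq_product\<close> the measure is uniform along each boundary; the uniform
  mass of a fibre is its lattice length over the perimeter, and that factor is absorbed into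
  \<open>height\<close>.\<close>

lemma emeasure_annulus:
  assumes S [measurable]: "S \<in> sets borel"
  shows "emeasure \<nu> (annulus \<inter> S) = (\<integral>\<^sup>+t. slice S t \<partial>height)"
proof -
  let ?\<kappa> = "distr M borel snd"
  interpret \<kappa>: finite_measure ?\<kappa> by (rule finite_measure_base)
  interpret U: finite_measure unit_uniform by (rule finite_measure_unit_uniform)
  interpret pair_sigma_finite unit_uniform ?\<kappa> ..
  have US: "unarc -` S \<in> sets borel"
    using measurable_sets[OF unarc_measurable S] by simp
  have "annulus \<inter> S = annulus \<inter> (\<lambda>p. (arc_pos p, level p)) -` (unarc -` S)"
    by (auto simp: unarc_arc)
  then have "emeasure \<nu> (annulus \<inter> S) = emeasure M (unarc -` S)"
    using US by (simp add: emeasure_M)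
  also have "\<dots> = emeasure (unit_uniform \<Otimes>\<^sub>M ?\<kappa>) (unarc -` S)"
    by (subst skew.eq_product) simp
  also have "\<dots> = (\<integral>\<^sup>+t. emeasure unit_uniform ((\<lambda>s. (s, t)) -` (unarc -` S)) \<partial>?\<kappa>)"
    by (rule emeasure_pair_measure_alt2) (use US in \<open>simp only: skew.eq_product[symmetric] sets_M\<close>)
  also have "\<dots> = (\<integral>\<^sup>+t. (if 0 < t \<and> t < 1/4 then ennreal (1 / (3 * (1 - 3 * t))) else 0) * slice S t \<partial>?\<kappa>)"
  proof (rule nn_integral_cong_AE)
    have "AE q in M. 0 < snd q \<and> snd q < 1/4"
    proof (rule AE_M)
      have "{q. 0 < snd q \<and> snd q < 1/4} = (UNIV \<times> {0<..<1/4} :: (real \<times> real) set)" by auto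
      then show "{q. 0 < snd q \<and> snd q < 1/4} \<in> sets (borel :: (real \<times> real) measure)"
        by (simp only:) (intro borel_Times; simp)
      show "AE p in \<nu>. p \<in> annulus \<longrightarrow> 0 < snd (arc_pos p, level p) \<and> snd (arc_pos p, level p) < 1/4"
        by (rule AE_I2) (simp add: annulus_def)
    qed
    then have "AE t in ?\<kappa>. 0 < t \<and> t < 1/4"
      by (subst AE_distr_iff) (simp_all add: skew.snd_measurable)
    then show "AE t in ?\<kappa>. emeasure unit_uniform ((\<lambda>s. (s, t)) -` (unarc -` S)) =
      (if 0 < t \<and> t < 1/4 then ennreal (1 / (3 * (1 - 3 * t))) else 0) * slice S t"
    proof eventually_elim
      case (elim t)
      then show ?case using emeasure_unit_uniform_unarc[OF S, of t] by (simp add: vimage_def)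
    qed
  qed
  also have "\<dots> = (\<integral>\<^sup>+t. slice S t \<partial>height)"
    unfolding height_def by (subst nn_integral_density) simp_all
  finally show ?thesis .
qed

lemma finite_measure_height: "finite_measure height"
proof
  interpret \<kappa>: finite_measure "distr M borel snd" by (rule finite_measure_base)
  \<comment> \<open>For t < 1/4 the weight stays below its value 4/3 at t = 1/4.\<close>
  have "emeasure height UNIV \<le> (\<integral>\<^sup>+t. ennreal (4/3) \<partial>distr M borel snd)"
    unfolding height_def
    by (subst emeasure_density)
       (auto intro!: nn_integral_mono ennreal_leI simp: field_simps simp del: nn_integral_const)
  also have "\<dots> < \<infinity>" using \<kappa>.emeasure_finite by (simp add: ennreal_mult_eq_top_iff less_top[symmetric])
  finally show "emeasure height (space height) \<noteq> \<infinity>"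
    using sets_eq_imp_space_eq[OF sets_height] by simp
qed

lemma AE_height: "AE t in height. 0 < t \<and> t < 1/4"
  unfolding height_def by (subst AE_density) auto

text \<open>
  The parallelogram \<open>a < x - y < b\<close>, \<open>c < y < d\<close> lies along the horizontal sides of the triangles,
  at heights between \<open>c\<close> and \<open>d\<close>; its mirror image lies along the slanted sides, at levels
  between \<open>a\<close> and \<open>b\<close>.
\<close>

lemma emeasure_rectangle:
  assumes "0 \<le> a" "a < b" "b \<le> c" "c < d" "d \<le> 1/4"
  shows "emeasure height {c<..<d} * ennreal (b - a) = emeasure height {a<..<b} * ennreal (d - c)"
proof -
  let ?S = "{p. a < fst p - snd p \<and> fst p - snd p < b \<and> c < snd p \<and> snd p < d}"
  let ?T = "flip1 -` ?S"
  have S [measurable]: "?S \<in> sets borel"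
    by (intro borel_open open_Collect_conj open_Collect_less continuous_intros)
  have T [measurable]: "?T \<in> sets borel"
    using measurable_sets[OF flip_measurable(1) S] by simp
  \<comment> \<open>On the parallelogram y is the smallest coordinate, so the level is y and the
    offset x - y; the two other sides miss it.\<close>
  have 1: "slice ?S t = ennreal (b - a) * indicator {c<..<d} t" if t: "0 < t" "t < 1/4" for t
  proof -
    have "(\<integral>\<^sup>+w. (if 0 \<le> w \<and> w < 1 - 3 * t \<and> point 0 w t \<in> ?S then 1 else 0) \<partial>lborel) =
      (\<integral>\<^sup>+w. indicator {a<..<b} w * indicator {c<..<d} t \<partial>lborel)"
    proof (rule nn_integral_cong)
      fix w
      have "0 \<le> w \<and> w < 1 - 3 * t \<and> point 0 w t \<in> ?S \<longleftrightarrow>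
          0 \<le> w \<and> w < 1 - 3 * t \<and> a < w \<and> w < b \<and> c < t \<and> t < d" by (simp add: point_def)
      also have "\<dots> \<longleftrightarrow> (a < w \<and> w < b) \<and> c < t \<and> t < d" using assms t by argo
      finally show "(if 0 \<le> w \<and> w < 1 - 3 * t \<and> point 0 w t \<in> ?S then 1 else 0) =
        indicator {a<..<b} w * (indicator {c<..<d} t :: ennreal)" by (simp only: indicator_def) auto
    qed
    also have "\<dots> = ennreal (b - a) * indicator {c<..<d} t"
      using assms by (subst nn_integral_multc) simp_all
    finally have 0: "(\<integral>\<^sup>+w. (if 0 \<le> w \<and> w < 1 - 3 * t \<and> point 0 w t \<in> ?S then 1 else 0) \<partial>lborel) =
      ennreal (b - a) * indicator {c<..<d} t" .
    have "(if 0 \<le> w \<and> w < 1 - 3 * t \<and> point k w t \<in> ?S then 1 else 0 :: ennreal) = 0" if "k = 1 \<or> k = 2" for w k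
    proof -
      have "0 \<le> w \<Longrightarrow> w < 1 - 3 * t \<Longrightarrow> point k w t \<notin> ?S"
        using that
      proof (elim disjE)
        assume w: "0 \<le> w" "w < 1 - 3 * t" and k: "k = 1"
        have "\<not> (a < 1 - 2 * t - w - (t + w) \<and> 1 - 2 * t - w - (t + w) < b \<and> c < t + w \<and> t + w < d)"
          using assms t w by argo
        then show ?thesis by (simp add: point_def k)
      next
        assume w: "0 \<le> w" "w < 1 - 3 * t" and k: "k = 2"
        have "\<not> a < t - (1 - 2 * t - w)" using assms t w by argo
        then show ?thesis by (simp add: point_def k)
      qed
      then show ?thesis by auto
    qed
    then show ?thesis using 0 by (simp add: slice_def eval_nat_numeral)
  qed
  \<comment> \<open>Here b \<le> c makes 1 - x - y the smallest coordinate. The roles are exchanged: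
    the level runs through {a<..<b}, while y = t + w cuts out a segment of length d - c.\<close>
  have 2: "slice ?T t = ennreal (d - c) * indicator {a<..<b} t" if t: "0 < t" "t < 1/4" for t
  proof -
    have "(\<integral>\<^sup>+w. (if 0 \<le> w \<and> w < 1 - 3 * t \<and> point 1 w t \<in> ?T then 1 else 0) \<partial>lborel) =
      (\<integral>\<^sup>+w. indicator {c - t<..<d - t} w * indicator {a<..<b} t \<partial>lborel)"
    proof (rule nn_integral_cong)
      fix w
      have "0 \<le> w \<and> w < 1 - 3 * t \<and> point 1 w t \<in> ?T \<longleftrightarrow>
          0 \<le> w \<and> w < 1 - 3 * t \<and> a < t \<and> t < b \<and> c < t + w \<and> t + w < d"
        by (simp add: point_def flip1_def)
      also have "\<dots> \<longleftrightarrow> (c - t < w \<and> w < d - t) \<and> a < t \<and> t < b" using assms t by argo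
      finally show "(if 0 \<le> w \<and> w < 1 - 3 * t \<and> point 1 w t \<in> ?T then 1 else 0) =
        indicator {c - t<..<d - t} w * (indicator {a<..<b} t :: ennreal)" by (simp only: indicator_def) auto
    qed
    also have "\<dots> = ennreal (d - c) * indicator {a<..<b} t"
      using assms by (subst nn_integral_multc) simp_all
    finally have 0: "(\<integral>\<^sup>+w. (if 0 \<le> w \<and> w < 1 - 3 * t \<and> point 1 w t \<in> ?T then 1 else 0) \<partial>lborel) =
      ennreal (d - c) * indicator {a<..<b} t" .
    have "(if 0 \<le> w \<and> w < 1 - 3 * t \<and> point k w t \<in> ?T then 1 else 0 :: ennreal) = 0" if "k = 0 \<or> k = 2" for w k
    proof -
      have "0 \<le> w \<Longrightarrow> w < 1 - 3 * t \<Longrightarrow> point k w t \<notin> ?T"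
        using that
      proof (elim disjE)
        assume w: "0 \<le> w" "w < 1 - 3 * t" and k: "k = 0"
        have "\<not> (1 - (t + w) - t < b \<and> c < t)" using assms t w by argo
        then show ?thesis by (auto simp: point_def flip1_def k)
      next
        assume w: "0 \<le> w" "w < 1 - 3 * t" and k: "k = 2"
        have "\<not> (1 - t - (1 - 2 * t - w) < b \<and> 1 - 2 * t - w < d)" using assms t w by argo
        then show ?thesis by (auto simp: point_def flip1_def k)
      qed
      then show ?thesis by auto
    qed
    then show ?thesis using 0 by (simp add: slice_def eval_nat_numeral)
  qed
  have "?S \<subseteq> annulus"
  proof
    fix p assume p: "p \<in> ?S"
    obtain x y where xy: "p = (x, y)" by (cases p)
    have "a < x - y" "x - y < b" "c < y" "y < d" using p by (simp_all add: xy)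
    then show "p \<in> annulus" unfolding xy annulus_iff using assms by argo
  qed
  moreover have "?T \<subseteq> annulus"
  proof
    fix p assume p: "p \<in> ?T"
    obtain x y where xy: "p = (x, y)" by (cases p)
    have "a < 1 - x - y" "1 - x - y < b" "c < y" "y < d" using p by (simp_all add: xy flip1_def)
    then show "p \<in> annulus" unfolding xy annulus_iff using assms by argo
  qed
  ultimately have sub: "annulus \<inter> ?S = ?S" "annulus \<inter> ?T = ?T" by blast+
  have "emeasure \<nu> ?S = (\<integral>\<^sup>+t. ennreal (b - a) * indicator {c<..<d} t \<partial>height)"
  proof -
    have "emeasure \<nu> ?S = (\<integral>\<^sup>+t. slice ?S t \<partial>height)"
      using emeasure_annulus[OF S] by (simp only: sub)
    also have "\<dots> = (\<integral>\<^sup>+t. ennreal (b - a) * indicator {c<..<d} t \<partial>height)"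
    proof (rule nn_integral_cong_AE)
      show "AE t in height. slice ?S t = ennreal (b - a) * indicator {c<..<d} t"
        using AE_height by eventually_elim (use 1 in blast)
    qed
    finally show ?thesis .
  qed
  moreover have "emeasure \<nu> ?T = (\<integral>\<^sup>+t. ennreal (d - c) * indicator {a<..<b} t \<partial>height)"
  proof -
    have "emeasure \<nu> ?T = (\<integral>\<^sup>+t. slice ?T t \<partial>height)"
      using emeasure_annulus[OF T] by (simp only: sub)
    also have "\<dots> = (\<integral>\<^sup>+t. ennreal (d - c) * indicator {a<..<b} t \<partial>height)"
    proof (rule nn_integral_cong_AE)
      show "AE t in height. slice ?T t = ennreal (d - c) * indicator {a<..<b} t"
        using AE_height by eventually_elim (use 2 in blast)
    qed
    finally show ?thesis .
  qed
  moreover have "emeasure \<nu> ?T = emeasure \<nu> ?S" by (rule flip1_invariant[OF S])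
  ultimately show ?thesis
    by (simp add: nn_integral_cmult_indicator mult.commute)
qed

text \<open>By \<open>emeasure_rectangle\<close>, two intervals one after the other have masses
  proportional to their lengths. Intervals from 1/8 or later up to 1/4 are measured against (0,
  1/8), those up to 3/16 against (3/16, 1/4), and the two ranges overlap.\<close>

lemma height_eq_lborel:
  obtains C where "0 \<le> C" "height = density lborel (\<lambda>t. ennreal C * indicator {0<..<1/4} t)"
proof -
  interpret H: finite_measure height by (rule finite_measure_height)
  define h where "h a b = measure height {a<..<b}" for a b
  \<comment> \<open>The only possible density: the mass of (0, 1/8) divided by its length.\<close>
  define C where "C = 8 * h 0 (1/8)"
  have C0: "0 \<le> C" by (simp add: C_def h_def)
  have rect: "h c d * (b - a) = h a b * (d - c)"
    if "0 \<le> a" "a < b" "b \<le> c" "c < d" "d \<le> 1/4" for a b c d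
  proof -
    have "ennreal (h c d * (b - a)) = ennreal (h a b * (d - c))"
      using emeasure_rectangle[OF that] that by (simp add: H.emeasure_eq_measure h_def ennreal_mult)
    then show ?thesis using that by (subst (asm) ennreal_inj) (simp_all add: h_def)
  qed
  have upper: "h m (1/4) = C * (1/4 - m)" if "1/8 \<le> m" "m < 1/4" for m
    using rect[of 0 "1/8" m "1/4"] that by (simp add: C_def)
  have lower: "h a b = C * (b - a)" if "0 \<le> a" "a < b" "b \<le> 3/16" for a b
    using rect[of a b "3/16" "1/4"] upper[of "3/16"] that by simp
  \<comment> \<open>The upper part is closed at 3/16 because an atom there has not yet been
    excluded; comparing both formulas from 1/8 on shows that there is none.\<close>
  have split: "h a (1/4) = h a (3/16) + measure height {3/16..<1/4}" if "a < 3/16" for a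
  proof -
    have "{a<..<1/4} = {a<..<3/16} \<union> {3/16..<1/4}" using that by auto
    then show ?thesis unfolding h_def by (simp only:) (rule H.finite_measure_Union; auto)
  qed
  have tail: "h a (1/4) = C * (1/4 - a)" if "0 \<le> a" "a < 1/4" for a
  proof (cases "a < 1/8")
    case True
    have "measure height {3/16..<1/4} = C / 16"
      using split[of "1/8"] upper[of "1/8"] lower[of "1/8" "3/16"] by simp
    then show ?thesis using split[of a] lower[of a "3/16"] True that by (simp add: algebra_simps)
  next
    case False
    then show ?thesis using upper[of a] that by simp
  qed
  have "height = density lborel (\<lambda>t. ennreal C * indicator {0<..<1/4} t)" (is "_ = ?N")
  proof (rule measure_eqI_lessThan)
    show "emeasure height {x<..} < \<infinity>" for x
      using H.emeasure_finite by (simp add: less_top[symmetric])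
    show "emeasure height {x<..} = emeasure ?N {x<..}" for x
    proof -
      have "emeasure height {x<..} = emeasure height {max 0 x<..<1/4}"
      proof (rule emeasure_eq_AE)
        show "AE t in height. t \<in> {x<..} \<longleftrightarrow> t \<in> {max 0 x<..<1/4}"
          using AE_height by eventually_elim auto
      qed simp_all
      also have "\<dots> = ennreal C * emeasure lborel {max 0 x<..<1/4}"
      proof (cases "max 0 x < 1/4")
        case True
        then have "measure height {max 0 x<..<1/4} = C * (1/4 - max 0 x)"
          using tail[of "max 0 x"] by (simp only: h_def max.cobounded1)
        then show ?thesis
          using True C0 by (simp only: H.emeasure_eq_measure emeasure_lborel_Ioo less_imp_le ennreal_mult diff_ge_0_iff_ge)
      next
        case False
        then have "{max 0 x<..<1/4} = {}" by auto
        then show ?thesis by (simp only: emeasure_empty mult_zero_right)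
      qed
      also have "\<dots> = (\<integral>\<^sup>+t. ennreal C * indicator {max 0 x<..<1/4} t \<partial>lborel)"
        by (simp add: nn_integral_cmult_indicator)
      also have "\<dots> = emeasure ?N {x<..}"
        by (subst emeasure_density) (auto intro!: nn_integral_cong simp: indicator_def)
      finally show ?thesis .
    qed
  qed simp_all
  with C0 show thesis by (rule that)
qed

lemma annulus_eq_lborel:
  "\<exists>C. \<forall>S\<in>sets borel. emeasure \<nu> (annulus \<inter> S) = ennreal C * emeasure lborel (annulus \<inter> S)"
proof -
  obtain C where C: "0 \<le> C" "height = density lborel (\<lambda>t. ennreal C * indicator {0<..<1/4} t)"
    by (rule height_eq_lborel)
  show ?thesis
  proof (intro exI ballI)
    fix S :: "(real \<times> real) set" assume S [measurable]: "S \<in> sets borel"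
    have "emeasure \<nu> (annulus \<inter> S) = (\<integral>\<^sup>+t. ennreal C * (indicator {0<..<1/4} t * slice S t) \<partial>lborel)"
      unfolding emeasure_annulus[OF S] C(2) by (subst nn_integral_density) (simp_all add: mult.assoc)
    also have "\<dots> = ennreal C * (\<integral>\<^sup>+t. indicator {0<..<1/4} t * slice S t \<partial>lborel)"
      by (rule nn_integral_cmult) simp
    also have "(\<integral>\<^sup>+t. indicator {0<..<1/4} t * slice S t \<partial>lborel) = emeasure lborel (annulus \<inter> S)"
      unfolding emeasure_lborel_annulus[OF S] by (rule nn_integral_cong) (simp add: indicator_def)
    finally show "emeasure \<nu> (annulus \<inter> S) = ennreal C * emeasure lborel (annulus \<inter> S)" .
  qed
qed

text \<open>Agreement with C times Lebesgue measure passes from the annulus to its reflections and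
  to their union, with the same C throughout; the union contains all generic points of the
  square.\<close>

theorem eq_lborel:
  assumes S [measurable]: "S \<in> sets borel"
  shows "emeasure \<nu> S = emeasure \<nu> UNIV * emeasure lborel (S \<inter> {0..1} \<times> {0..1})"
proof -
  obtain C where C: "\<And>S. S \<in> sets borel \<Longrightarrow> emeasure \<nu> (annulus \<inter> S) = ennreal C * emeasure lborel (annulus \<inter> S)"
    using annulus_eq_lborel by blast
  define good where "good D \<longleftrightarrow> D \<in> sets borel \<and>
    (\<forall>S\<in>sets borel. emeasure \<nu> (D \<inter> S) = ennreal C * emeasure lborel (D \<inter> S))" for D
  have good_annulus: "good annulus" by (simp add: good_def C)
  have good_Un: "good (D \<union> E)" if "good D" "good E" for D E
  proof -
    have [measurable]: "D \<in> sets borel" "E \<in> sets borel" using that by (auto simp: good_def)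
    have "emeasure \<nu> ((D \<union> E) \<inter> S) = ennreal C * emeasure lborel ((D \<union> E) \<inter> S)" if [measurable]: "S \<in> sets borel" for S
    proof -
      \<comment> \<open>E is tested on S - D only, so that the overlap counts once.\<close>
      have eq: "(D \<union> E) \<inter> S = D \<inter> S \<union> E \<inter> (S - D)" by auto
      have "emeasure \<nu> ((D \<union> E) \<inter> S) = emeasure \<nu> (D \<inter> S) + emeasure \<nu> (E \<inter> (S - D))"
        unfolding eq by (rule plus_emeasure[symmetric]) auto
      also have "\<dots> = ennreal C * emeasure lborel (D \<inter> S) + ennreal C * emeasure lborel (E \<inter> (S - D))"
        using \<open>good D\<close> \<open>good E\<close> by (simp add: good_def)
      also have "\<dots> = ennreal C * (emeasure lborel (D \<inter> S) + emeasure lborel (E \<inter> (S - D)))"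
        by (rule distrib_left[symmetric])
      also have "emeasure lborel (D \<inter> S) + emeasure lborel (E \<inter> (S - D)) = emeasure lborel ((D \<union> E) \<inter> S)"
        unfolding eq by (rule plus_emeasure) auto
      finally show ?thesis .
    qed
    then show ?thesis by (simp add: good_def)
  qed
  have good_flip: "good (f -` D)"
    if D: "good D" and f [measurable]: "f \<in> borel \<rightarrow>\<^sub>M borel" and ff: "\<And>p. f (f p) = p"
      and inv: "\<And>B. B \<in> sets borel \<Longrightarrow> emeasure \<nu> (f -` B) = emeasure \<nu> B"
        "\<And>B. B \<in> sets borel \<Longrightarrow> emeasure lborel (f -` B) = emeasure lborel B"
    for D and f :: "real \<times> real \<Rightarrow> real \<times> real"
  proof -
    have fm: "f -` B \<in> sets borel" if "B \<in> sets borel" for B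
      using measurable_sets[OF f that] by simp
    have Dm: "D \<in> sets borel" using D by (simp add: good_def)
    have "emeasure \<nu> (f -` D \<inter> S) = ennreal C * emeasure lborel (f -` D \<inter> S)" if S: "S \<in> sets borel" for S
    proof -
      have eq: "f -` D \<inter> S = f -` (D \<inter> f -` S)" by (rule Set.set_eqI) (simp add: ff)
      have m: "D \<inter> f -` S \<in> sets borel" using Dm fm[OF S] by auto
      show ?thesis unfolding eq inv[OF m] using D fm[OF S] by (simp add: good_def)
    qed
    then show ?thesis using fm[OF Dm] by (simp add: good_def)
  qed
  have g1: "good (flip1 -` D)" if "good D" for D
    by (rule good_flip[OF that]) (simp_all add: flip1_invariant emeasure_lborel_flip)
  have g2: "good (flip2 -` D)" if "good D" for D
    by (rule good_flip[OF that]) (simp_all add: flip2_invariant emeasure_lborel_flip)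
  define G where "G = annulus \<union> flip1 -` annulus \<union> flip2 -` annulus \<union> flip2 -` (flip1 -` annulus)"
  have G: "good G" unfolding G_def by (intro good_Un g1 g2 good_annulus)
  then have Gm: "G \<in> sets borel" by (simp add: good_def)
  have cover: "p \<in> G" if "generic p" "p \<in> {0..1} \<times> {0..1}" for p
    using generic_cover[OF that] by (auto simp: G_def)
  have sq: "({0..1} \<times> {0..1} :: (real \<times> real) set) \<in> sets borel" by (intro borel_Times) auto
  have main: "emeasure \<nu> T = ennreal C * emeasure lborel (T \<inter> {0..1} \<times> {0..1})" if T: "T \<in> sets borel" for T
  proof -
    let ?Q = "{0..1} \<times> {0..1} :: (real \<times> real) set"
    have "emeasure \<nu> T = emeasure \<nu> (G \<inter> (T \<inter> ?Q))"
    proof (rule emeasure_eq_AE)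
      show "AE p in \<nu>. p \<in> T \<longleftrightarrow> p \<in> G \<inter> (T \<inter> ?Q)"
        using AE_square AE_generic by eventually_elim (use cover in blast)
    qed (use T Gm sq in auto)
    also have "\<dots> = ennreal C * emeasure lborel (G \<inter> (T \<inter> ?Q))"
      using G T sq by (simp add: good_def)
    also have "emeasure lborel (G \<inter> (T \<inter> ?Q)) = emeasure lborel (T \<inter> ?Q)"
    proof (rule emeasure_eq_AE)
      show "AE p in lborel. p \<in> G \<inter> (T \<inter> ?Q) \<longleftrightarrow> p \<in> T \<inter> ?Q"
        using AE_lborel_generic by eventually_elim (use cover in blast)
    qed (use T Gm sq in auto)
    finally show ?thesis .
  qed
  have "emeasure lborel ({0..1} \<times> {0..1} :: (real \<times> real) set) = 1"
    unfolding lborel_prod[symmetric] by (subst lborel.emeasure_pair_measure_Times) auto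
  \<comment> \<open>The square has Lebesgue measure one, which identifies the constant as the total
    mass.\<close>
  then have "emeasure \<nu> UNIV = ennreal C" using main[of UNIV] by simp
  then show ?thesis using main[OF S] by simp
qed

end

section \<open>Hyperplane arrangements as polyhedral complexes\<close>

lemma scaleR_fun_apply [simp]: "(r *\<^sub>R f) x = r *\<^sub>R f x"
  by (simp add: scaleR_fun_def)

definition aff :: "nat \<Rightarrow> (nat \<Rightarrow> int) \<Rightarrow> (nat \<Rightarrow> real) \<Rightarrow> real" where
  "aff n a x = (\<Sum>i<n. of_int (a i) * x i) + of_int (a n)"

lemma aff_combination:
  assumes "u + v = 1"
  shows "aff n a (u *\<^sub>R x + v *\<^sub>R y) = u * aff n a x + v * aff n a y"
proof -
  have "u * of_int (a n) + v * of_int (a n) = of_int (a n)"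
    using assms by (metis distrib_right mult_1)
  then show ?thesis
    by (simp add: aff_def algebra_simps sum.distrib sum_distrib_left)
qed

lemma aff_sum:
  assumes "finite V" "sum c V = 1"
  shows "aff n a (\<Sum>v\<in>V. c v *\<^sub>R v) = (\<Sum>v\<in>V. c v * aff n a v)"
proof -
  have app: "(\<Sum>v\<in>V. c v *\<^sub>R v) i = (\<Sum>v\<in>V. c v * v i)" for i :: nat
    using assms(1) by (induction rule: finite_induct) auto
  have "(\<Sum>v\<in>V. c v * aff n a v) = (\<Sum>v\<in>V. \<Sum>i<n. c v * (of_int (a i) * v i)) + sum c V * of_int (a n)"
    by (simp add: aff_def distrib_left sum.distrib sum_distrib_left sum_distrib_right)
  also have "(\<Sum>v\<in>V. \<Sum>i<n. c v * (of_int (a i) * v i)) = (\<Sum>i<n. \<Sum>v\<in>V. c v * (of_int (a i) * v i))"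
    by (rule sum.swap)
  finally show ?thesis
    by (simp add: aff_def app assms(2) sum_distrib_left mult_ac)
qed

lemma aff_Rats:
  assumes "\<And>i. i < n \<Longrightarrow> v i \<in> \<rat>"
  shows "aff n a v \<in> \<rat>"
proof -
  have "(\<Sum>i<n. of_int (a i) * v i) \<in> (\<rat> :: real set)"
    using assms by (intro Rats_sum Rats_mult) auto
  then show ?thesis by (simp add: aff_def)
qed

text \<open>Rationality is asked of some finite generating set, which is easier to maintain under
  cuts than the exact vertex set; extreme points are always among the generators.\<close>

definition rat_polytope :: "nat \<Rightarrow> (nat \<Rightarrow> real) set \<Rightarrow> bool" where
  "rat_polytope n S \<longleftrightarrow> (\<exists>V. finite V \<and> S = convex hull V \<and> (\<forall>v\<in>V. \<forall>i<n. v i \<in> \<rat>))"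

lemma convex_aff_ge: "convex {x. 0 \<le> aff n a x}"
  by (auto simp: convex_def aff_combination)

lemma aff_uminus: "aff n (\<lambda>i. - a i) x = - aff n a x"
  by (simp add: aff_def sum_negf)

text \<open>
  The new vertices are the points where segments between vertices on opposite sides cross the
  hyperplane.
\<close>

lemma rat_polytope_halfspace:
  assumes "rat_polytope n S"
  shows "rat_polytope n {x \<in> S. 0 \<le> aff n a x}"
proof -
  obtain V where V: "finite V" "S = convex hull V" "\<And>v i. v \<in> V \<Longrightarrow> i < n \<Longrightarrow> v i \<in> \<rat>"
    using assms by (auto simp: rat_polytope_def)
  define L where "L = aff n a"
  define P where "P = {v \<in> V. 0 < L v}"
  define Z where "Z = {v \<in> V. L v = 0}"
  define Q where "Q = {v \<in> V. L v < 0}"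
  \<comment> \<open>The weights make the form vanish, so z is the crossing point of the segment from
    v to w.\<close>
  define z where "z v w = (L v / (L v - L w)) *\<^sub>R w + (- L w / (L v - L w)) *\<^sub>R v" for v w
  define V' where "V' = P \<union> Z \<union> (\<lambda>(v, w). z v w) ` (P \<times> Q)"
  have fin: "finite P" "finite Z" "finite Q" using V(1) by (auto simp: P_def Z_def Q_def)
  have PZQ: "V = P \<union> Z \<union> Q" by (auto simp: P_def Z_def Q_def)
  have disj: "P \<inter> Z = {}" "(P \<union> Z) \<inter> Q = {}" by (auto simp: P_def Z_def Q_def)
  have z: "L (z v w) = 0" "z v w \<in> convex hull V" "\<And>i. i < n \<Longrightarrow> z v w i \<in> \<rat>"
    if vw: "v \<in> P" "w \<in> Q" for v w
  proof -
    have pos: "L v > 0" "L w < 0" "L v - L w > 0" and V2: "v \<in> V" "w \<in> V"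
      using vw by (auto simp: P_def Q_def)
    have one: "L v / (L v - L w) + - L w / (L v - L w) = 1"
      using pos by (simp add: diff_divide_distrib[symmetric])
    show "L (z v w) = 0"
      unfolding z_def using aff_combination[OF one, of n a w v] by (simp add: L_def)
    show "z v w \<in> convex hull V"
      unfolding z_def
      by (rule convexD[OF convex_convex_hull]) (use V2 pos one hull_inc in \<open>auto intro: divide_nonneg_pos divide_nonpos_pos\<close>)
    have "L v \<in> \<rat>" "L w \<in> \<rat>" unfolding L_def using aff_Rats V(3) V2 by blast+
    then show "z v w i \<in> \<rat>" if "i < n" for i
      using V(3)[OF V2(1) that] V(3)[OF V2(2) that] by (simp add: z_def)
  qed
  have "convex hull V' \<subseteq> {x \<in> S. 0 \<le> aff n a x}"
  proof (rule hull_minimal)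
    show "V' \<subseteq> {x \<in> S. 0 \<le> aff n a x}"
      using z V(2) hull_inc[of _ V convex] by (force simp: V'_def P_def Z_def L_def)
    have "{x \<in> S. 0 \<le> aff n a x} = S \<inter> {x. 0 \<le> aff n a x}" by auto
    then show "convex {x \<in> S. 0 \<le> aff n a x}"
      using V(2) by (simp add: convex_Int convex_aff_ge)
  qed
  moreover have "x \<in> convex hull V'" if x: "x \<in> S" "0 \<le> aff n a x" for x
  proof -
    obtain c where c: "\<And>v. v \<in> V \<Longrightarrow> 0 \<le> c v" "sum c V = 1" "x = (\<Sum>v\<in>V. c v *\<^sub>R v)"
      using x(1) unfolding V(2) convex_hull_finite[OF V(1)] by auto
    \<comment> \<open>The total positive value p and the total negative value q of the form over the
      weighted generators; at x the form equals p - q, hence q \<le> p.\<close>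
    define p where "p = (\<Sum>v\<in>P. c v * L v)"
    define q where "q = (\<Sum>w\<in>Q. c w * - L w)"
    have split: "sum f V = sum f P + sum f Z + sum f Q" for f :: "(nat \<Rightarrow> real) \<Rightarrow> 'b::comm_monoid_add"
      unfolding PZQ using fin disj by (simp add: sum.union_disjoint)
    have "L x = (\<Sum>v\<in>V. c v * L v)"
      unfolding c(3) L_def by (rule aff_sum[OF V(1) c(2)])
    also have "\<dots> = p - q"
      unfolding split p_def q_def by (simp add: Z_def sum_negf)
    finally have pq: "q \<le> p" using x(2) by (simp add: L_def)
    have q0: "0 \<le> q" unfolding q_def
      by (rule sum_nonneg) (use c(1) in \<open>auto simp: Q_def mult_nonneg_nonpos\<close>)
    show ?thesis
    proof (cases "q = 0")
      case True
      have "\<forall>w\<in>Q. c w * - L w = 0"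
        using True unfolding q_def
        by (subst (asm) sum_nonneg_eq_0_iff) (use c(1) fin in \<open>auto simp: Q_def mult_nonneg_nonpos\<close>)
      then have cQ: "\<And>w. w \<in> Q \<Longrightarrow> c w = 0" by (auto simp: Q_def)
      have "sum c (P \<union> Z) = 1" "x = (\<Sum>v\<in>P \<union> Z. c v *\<^sub>R v)"
        using c(2,3) fin disj by (simp_all add: split cQ sum.union_disjoint)
      moreover have "(\<Sum>v\<in>P \<union> Z. c v *\<^sub>R v) \<in> convex hull V'"
        by (rule convex_sum) (use fin c(1) \<open>sum c (P \<union> Z) = 1\<close> in
            \<open>auto simp: PZQ V'_def convex_convex_hull intro: hull_inc\<close>)
      ultimately show ?thesis by simp
    next
      case False
      then have p0: "p > 0" using pq q0 by simp
      \<comment> \<open>A transport plan: every negative w is spread over the positive v in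
        proportion to c v * L v. Summed over v, the crossing points use exactly c w of w; summed
        over w, they use c v * q / p of v, and the remaining weight c v * (1 - q / p) is nonnegative
        because q \<le> p.\<close>
      define d where "d = (\<lambda>s. case s of Inl v \<Rightarrow> (if v \<in> P then c v * (1 - q / p) else c v)
        | Inr (v, w) \<Rightarrow> c v * c w * (L v - L w) / p)"
      define y where "y = (\<lambda>s. case s of Inl v \<Rightarrow> v | Inr (v, w) \<Rightarrow> z v w)"
      let ?I = "(P \<union> Z) <+> (P \<times> Q)"
      have dZ: "v \<notin> P" if "v \<in> Z" for v using that disj by auto
      have inner: "(\<Sum>w\<in>Q. (c v * c w * (L v - L w) / p) *\<^sub>R z v w) =
          (c v * L v / p) *\<^sub>R (\<Sum>w\<in>Q. c w *\<^sub>R w) + (q / p) *\<^sub>R (c v *\<^sub>R v)" if v: "v \<in> P" for v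
      proof -
        have "(c v * c w * (L v - L w) / p) *\<^sub>R z v w =
            (c v * L v / p) *\<^sub>R (c w *\<^sub>R w) + ((c w * - L w) / p) *\<^sub>R (c v *\<^sub>R v)" if w: "w \<in> Q" for w
        proof -
          have "L v - L w \<noteq> 0" using v w by (auto simp: P_def Q_def)
          then have "(c v * c w * (L v - L w) / p) * (L v / (L v - L w)) = c v * L v / p * c w"
            "(c v * c w * (L v - L w) / p) * (- L w / (L v - L w)) = (c w * - L w) / p * c v" by simp_all
          then show ?thesis by (simp only: z_def scaleR_add_right scaleR_scaleR)
        qed
        then have "(\<Sum>w\<in>Q. (c v * c w * (L v - L w) / p) *\<^sub>R z v w) =
            (\<Sum>w\<in>Q. (c v * L v / p) *\<^sub>R (c w *\<^sub>R w) + ((c w * - L w) / p) *\<^sub>R (c v *\<^sub>R v))"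
          by (rule sum.cong[OF refl])
        also have "\<dots> = (\<Sum>w\<in>Q. (c v * L v / p) *\<^sub>R (c w *\<^sub>R w)) + (\<Sum>w\<in>Q. ((c w * - L w) / p) *\<^sub>R (c v *\<^sub>R v))"
          by (rule sum.distrib)
        also have "(\<Sum>w\<in>Q. (c v * L v / p) *\<^sub>R (c w *\<^sub>R w)) = (c v * L v / p) *\<^sub>R (\<Sum>w\<in>Q. c w *\<^sub>R w)"
          by (rule scaleR_sum_right[symmetric])
        also have "(\<Sum>w\<in>Q. ((c w * - L w) / p) *\<^sub>R (c v *\<^sub>R v)) = (q / p) *\<^sub>R (c v *\<^sub>R v)"
          unfolding q_def sum_divide_distrib scaleR_left.sum ..
        finally show ?thesis .
      qed
      have innerc: "(\<Sum>w\<in>Q. c v * c w * (L v - L w) / p) = (c v * L v / p) * sum c Q + (q / p) * c v" for v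
      proof -
        have "(\<Sum>w\<in>Q. c v * c w * (L v - L w) / p) =
            (\<Sum>w\<in>Q. (c v * L v / p) * c w + ((c w * - L w) / p) * c v)"
          by (rule sum.cong) (simp_all add: right_diff_distrib diff_divide_distrib mult_ac)
        also have "\<dots> = (c v * L v / p) * sum c Q + (q / p) * c v"
          unfolding sum.distrib q_def sum_divide_distrib sum_distrib_left sum_distrib_right ..
        finally show ?thesis .
      qed
      have "sum d ?I = sum (d \<circ> Inl) (P \<union> Z) + sum (d \<circ> Inr) (P \<times> Q)"
        using fin by (subst sum.Plus) auto
      also have "sum (d \<circ> Inl) (P \<union> Z) = (1 - q / p) * sum c P + sum c Z"
        using fin disj by (simp add: sum.union_disjoint d_def dZ flip: sum_distrib_right)
      also have "sum (d \<circ> Inr) (P \<times> Q) = (\<Sum>v\<in>P. \<Sum>w\<in>Q. c v * c w * (L v - L w) / p)"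
        by (simp add: sum.cartesian_product d_def split_def)
      also have "\<dots> = (p / p) * sum c Q + (q / p) * sum c P"
      proof -
        have "(\<Sum>v\<in>P. \<Sum>w\<in>Q. c v * c w * (L v - L w) / p) =
            (\<Sum>v\<in>P. c v * L v / p * sum c Q) + (\<Sum>v\<in>P. q / p * c v)"
          unfolding innerc sum.distrib ..
        also have "(\<Sum>v\<in>P. c v * L v / p * sum c Q) = (p / p) * sum c Q"
          unfolding sum_distrib_right[symmetric] sum_divide_distrib[symmetric] p_def[symmetric] ..
        also have "(\<Sum>v\<in>P. q / p * c v) = (q / p) * sum c P"
          unfolding sum_distrib_left[symmetric] ..
        finally show ?thesis .
      qed
      finally have sd: "sum d ?I = 1"
        using p0 c(2) unfolding split by (simp add: algebra_simps)
      have "(\<Sum>s\<in>?I. d s *\<^sub>R y s) = (\<Sum>v\<in>P \<union> Z. d (Inl v) *\<^sub>R v) + (\<Sum>s\<in>P \<times> Q. d (Inr s) *\<^sub>R y (Inr s))"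
        using fin by (subst sum.Plus) (auto simp: y_def)
      also have "(\<Sum>v\<in>P \<union> Z. d (Inl v) *\<^sub>R v) = (1 - q / p) *\<^sub>R (\<Sum>v\<in>P. c v *\<^sub>R v) + (\<Sum>v\<in>Z. c v *\<^sub>R v)"
        using fin disj by (simp add: sum.union_disjoint d_def dZ scaleR_sum_right mult.commute)
      also have "(\<Sum>s\<in>P \<times> Q. d (Inr s) *\<^sub>R y (Inr s)) =
          (\<Sum>v\<in>P. \<Sum>w\<in>Q. (c v * c w * (L v - L w) / p) *\<^sub>R z v w)"
        by (simp add: sum.cartesian_product d_def y_def split_def)
      also have "\<dots> = (\<Sum>v\<in>P. (c v * L v / p) *\<^sub>R (\<Sum>w\<in>Q. c w *\<^sub>R w) + (q / p) *\<^sub>R (c v *\<^sub>R v))"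
        by (rule sum.cong[OF refl]) (rule inner)
      also have "\<dots> = (p / p) *\<^sub>R (\<Sum>w\<in>Q. c w *\<^sub>R w) + (q / p) *\<^sub>R (\<Sum>v\<in>P. c v *\<^sub>R v)"
      proof -
        have "(\<Sum>v\<in>P. (c v * L v / p) *\<^sub>R (\<Sum>w\<in>Q. c w *\<^sub>R w)) = (p / p) *\<^sub>R (\<Sum>w\<in>Q. c w *\<^sub>R w)"
          unfolding scaleR_left.sum[symmetric] sum_divide_distrib[symmetric] p_def[symmetric] ..
        moreover have "(\<Sum>v\<in>P. (q / p) *\<^sub>R (c v *\<^sub>R v)) = (q / p) *\<^sub>R (\<Sum>v\<in>P. c v *\<^sub>R v)"
          by (rule scaleR_sum_right[symmetric])
        ultimately show ?thesis unfolding sum.distrib by (simp only:)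
      qed
      finally have sy0: "(\<Sum>s\<in>?I. d s *\<^sub>R y s) = (1 - q / p) *\<^sub>R (\<Sum>v\<in>P. c v *\<^sub>R v) + (\<Sum>v\<in>Z. c v *\<^sub>R v) +
          ((p / p) *\<^sub>R (\<Sum>w\<in>Q. c w *\<^sub>R w) + (q / p) *\<^sub>R (\<Sum>v\<in>P. c v *\<^sub>R v))" .
      have sy: "(\<Sum>s\<in>?I. d s *\<^sub>R y s) = x"
      proof -
        have gen: "(1 - r) *\<^sub>R f + g + (1 *\<^sub>R h + r *\<^sub>R f) = f + g + h" for r and f g h :: "nat \<Rightarrow> real"
          by (simp add: fun_eq_iff algebra_simps)
        have one: "p / p = 1" using p0 by simp
        show ?thesis unfolding sy0 one gen c(3) split ..
      qed
      have "(\<Sum>s\<in>?I. d s *\<^sub>R y s) \<in> convex hull V'"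
      proof (rule convex_sum)
        show "finite ?I" using fin by auto
        show "convex (convex hull V')" by (rule convex_convex_hull)
        show "sum d ?I = 1" by (rule sd)
        fix s assume s: "s \<in> ?I"
        have cV: "0 \<le> c v" if "v \<in> P \<union> Z \<union> Q" for v using c(1) that PZQ by blast
        show "0 \<le> d s"
          using s p0 pq cV
          by (auto simp: d_def P_def Q_def Z_def intro!: mult_nonneg_nonneg divide_nonneg_pos)
        show "y s \<in> convex hull V'"
          using s by (intro hull_inc) (auto simp: y_def V'_def)
      qed
      then show ?thesis by (simp add: sy)
    qed
  qed
  ultimately have "{x \<in> S. 0 \<le> aff n a x} = convex hull V'" by auto
  moreover have "finite V'" using fin by (simp add: V'_def)
  moreover have "\<forall>v\<in>V'. \<forall>i<n. v i \<in> \<rat>"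
    using V(3) z(3) by (auto simp: V'_def P_def Z_def)
  ultimately show ?thesis unfolding rat_polytope_def by blast
qed

section \<open>The cube as a rational polytope\<close>

lemma cube_iff: "x \<in> cube n \<longleftrightarrow> (\<forall>i<n. 0 \<le> x i \<and> x i \<le> 1) \<and> (\<forall>i\<ge>n. x i = undefined)"
  by (auto simp: cube_def PiE_def Pi_def extensional_def)

lemma cube_combination:
  fixes u v :: real
  assumes "x \<in> cube n" "y \<in> cube n" "0 \<le> u" "0 \<le> v" "u + v = 1"
  shows "u *\<^sub>R x + v *\<^sub>R y \<in> cube n"
proof -
  have "u * x i + v * y i \<le> u * 1 + v * 1" if "i < n" for i
    using assms that by (intro add_mono mult_left_mono) (auto simp: cube_iff)
  \<comment> \<open>Outside {..<n} both points have the same fixed value, which a combination with u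
    + v = 1 reproduces.\<close>
  moreover have "u * undefined + v * undefined = (undefined :: real)"
    using assms(5) by (metis distrib_right mult_1)
  ultimately show ?thesis using assms by (auto simp: cube_iff)
qed

lemma convex_cube: "convex (cube n)"
  by (auto simp: convex_def cube_combination)

text \<open>Induction on the number of coordinates other than 0 and 1: moving one of them to 0 and
  to 1 gives two points having x on the segment between them.\<close>

lemma rat_polytope_cube: "rat_polytope n (cube n)"
proof -
  define V where "V = PiE {..<n} (\<lambda>_. {0, 1 :: real})"
  have fin: "finite V" unfolding V_def by (intro finite_PiE) auto
  have V: "x \<in> V \<longleftrightarrow> (\<forall>i<n. x i = 0 \<or> x i = 1) \<and> (\<forall>i\<ge>n. x i = undefined)" for x
    by (auto simp: V_def PiE_def Pi_def extensional_def)
  have "x \<in> convex hull V" if "x \<in> cube n" for x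
    using that
  proof (induction "card {i\<in>{..<n}. x i \<noteq> 0 \<and> x i \<noteq> 1}" arbitrary: x rule: less_induct)
    case less
    show ?case
    proof (cases "\<exists>i<n. x i \<noteq> 0 \<and> x i \<noteq> 1")
      case False
      then have "x \<in> V" using less.prems by (auto simp: V cube_iff)
      then show ?thesis by (rule hull_inc)
    next
      case True
      then obtain i where i: "i < n" "x i \<noteq> 0" "x i \<noteq> 1" by blast
      have step: "x(i := b) \<in> convex hull V" if b: "b = 0 \<or> b = 1" for b
      proof (rule less.hyps)
        show "card {j\<in>{..<n}. (x(i := b)) j \<noteq> 0 \<and> (x(i := b)) j \<noteq> 1} < card {j\<in>{..<n}. x j \<noteq> 0 \<and> x j \<noteq> 1}"
          by (rule psubset_card_mono) (use i b in auto)
        show "x(i := b) \<in> cube n" using less.prems i b by (auto simp: cube_iff)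
      qed
      have "(1 - x i) *\<^sub>R x(i := 0) + x i *\<^sub>R x(i := 1) \<in> convex hull V"
        by (rule convexD[OF convex_convex_hull])
           (use step less.prems i in \<open>auto simp: cube_iff\<close>)
      also have "(1 - x i) *\<^sub>R x(i := 0) + x i *\<^sub>R x(i := 1) = x"
        by (auto simp: fun_eq_iff algebra_simps)
      finally show ?thesis .
    qed
  qed
  moreover have "convex hull V \<subseteq> cube n"
    by (rule hull_minimal) (auto simp: V cube_iff convex_cube, (metis zero_le_one order_refl)+)
  ultimately have "cube n = convex hull V" by auto
  then show ?thesis using fin unfolding rat_polytope_def 
    by (intro exI[of _ V]) (auto simp: V, metis Rats_0 Rats_1)
qed

section \<open>Cells of an arrangement and their faces\<close>

definition cell :: "nat \<Rightarrow> (nat \<Rightarrow> int) set \<Rightarrow> (nat \<Rightarrow> int) set \<Rightarrow> (nat \<Rightarrow> real) set" where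
  "cell n P N = {x \<in> cube n. (\<forall>a\<in>P. 0 \<le> aff n a x) \<and> (\<forall>a\<in>N. aff n a x \<le> 0)}"

lemma rat_polytope_cell:
  assumes "finite P" "finite N"
  shows "rat_polytope n (cell n P N)"
proof -
  have pos: "rat_polytope n {x \<in> cube n. \<forall>a\<in>P. 0 \<le> aff n a x}"
    using assms(1)
  proof (induction rule: finite_induct)
    case empty
    then show ?case using rat_polytope_cube by simp
  next
    case (insert a P)
    have "{x \<in> cube n. \<forall>a\<in>insert a P. 0 \<le> aff n a x} =
        {x \<in> {x \<in> cube n. \<forall>a\<in>P. 0 \<le> aff n a x}. 0 \<le> aff n a x}" by auto
    then show ?case using rat_polytope_halfspace[OF insert.IH, of a] by (simp only:)
  qed
  show ?thesis
    using assms(2)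
  proof (induction rule: finite_induct)
    case empty
    then show ?case using pos by (simp add: cell_def)
  next
    case (insert a N)
    have "cell n P (insert a N) = {x \<in> cell n P N. 0 \<le> aff n (\<lambda>i. - a i) x}"
      by (auto simp: cell_def aff_uminus)
    then show ?case using rat_polytope_halfspace[OF insert.IH, of "\<lambda>i. - a i"] by (simp only:)
  qed
qed

lemma convex_cell: "convex (cell n P N)"
proof (rule convexI)
  fix x y and u v :: real
  assume x: "x \<in> cell n P N" and y: "y \<in> cell n P N" and uv: "0 \<le> u" "0 \<le> v" "u + v = 1"
  have "u * aff n a x + v * aff n a y \<le> 0" if "a \<in> N" for a
    using x y uv that by (intro add_nonpos_nonpos mult_nonneg_nonpos) (auto simp: cell_def)
  moreover have "0 \<le> u * aff n a x + v * aff n a y" if "a \<in> P" for a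
    using x y uv that by (intro add_nonneg_nonneg mult_nonneg_nonneg) (auto simp: cell_def)
  ultimately show "u *\<^sub>R x + v *\<^sub>R y \<in> cell n P N"
    using x y uv by (auto simp: cell_def aff_combination cube_combination)
qed

text \<open>By \<open>full\<close>, every added constraint reverses one already present, so it
  forces a form of constant sign to vanish. If a form of constant sign vanishes inside a segment, it
  vanishes at both ends.\<close>

lemma cell_face_of_cell:
  assumes sub: "P \<subseteq> P'" "N \<subseteq> N'" and full: "P' \<union> N' \<subseteq> P \<union> N"
  shows "cell n P' N' face_of cell n P N"
  unfolding face_of_def
proof (intro conjI ballI impI)
  show "cell n P' N' \<subseteq> cell n P N" using sub by (auto simp: cell_def)
  show "convex (cell n P' N')" by (rule convex_cell)
  fix y z x
  assume y: "y \<in> cell n P N" and z: "z \<in> cell n P N" and x: "x \<in> cell n P' N'" and "x \<in> open_segment y z"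
  then obtain u where u: "0 < u" "u < 1" "x = (1 - u) *\<^sub>R y + u *\<^sub>R z" by (auto simp: in_segment)
  have ax: "aff n a x = (1 - u) * aff n a y + u * aff n a z" for a
    unfolding u(3) by (rule aff_combination) simp
  have zero: "p = 0 \<and> q = 0"
    if "0 \<le> (1 - u) * p + u * q" "p \<le> 0" "q \<le> 0" for p q :: real
  proof -
    have "(1 - u) * p \<le> 0" "u * q \<le> 0" using u that by (auto intro: mult_nonneg_nonpos)
    then have "(1 - u) * p = 0" "u * q = 0" using that(1) by linarith+
    then show ?thesis using u by simp
  qed
  have P': "0 \<le> aff n a y \<and> 0 \<le> aff n a z" if a: "a \<in> P'" for a
  proof (cases "a \<in> P")
    case True then show ?thesis using y z by (simp add: cell_def)
  next
    case False
    then have "a \<in> N" using a full by auto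
    then have "aff n a y \<le> 0" "aff n a z \<le> 0" using y z by (auto simp: cell_def)
    moreover have "0 \<le> aff n a x" using x a by (simp add: cell_def)
    ultimately show ?thesis using zero[of "aff n a y" "aff n a z"] ax[of a] by simp
  qed
  have N': "aff n a y \<le> 0 \<and> aff n a z \<le> 0" if a: "a \<in> N'" for a
  proof (cases "a \<in> N")
    case True then show ?thesis using y z by (simp add: cell_def)
  next
    case False
    then have "a \<in> P" using a full by auto
    then have "0 \<le> aff n a y" "0 \<le> aff n a z" using y z by (auto simp: cell_def)
    moreover have "aff n a x \<le> 0" using x a by (simp add: cell_def)
    ultimately show ?thesis using zero[of "- aff n a y" "- aff n a z"] ax[of a] by simp
  qed
  show "y \<in> cell n P' N'" "z \<in> cell n P' N'"
    using y z P' N' by (auto simp: cell_def)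
qed

text \<open>The forms x_i and x_i - 1: with them in the arrangement, the faces of the cube itself
  are cut out by sign conditions.\<close>

definition box_forms :: "nat \<Rightarrow> (nat \<Rightarrow> int) set" where
  "box_forms n = (\<lambda>i j. if j = i then 1 else 0) ` {..<n} \<union> (\<lambda>i j. if j = i then 1 else if j = n then -1 else 0) ` {..<n}"

text \<open>
  A point of the face at which as few forms as possible vanish plays the role of a relative
  interior point.
\<close>

lemma face_of_cellD:
  assumes fin: "finite P" "finite N" and box: "box_forms n \<subseteq> P \<union> N"
    and F: "F face_of cell n P N" "F \<noteq> {}"
  shows "\<exists>P' N'. P' \<union> N' = P \<union> N \<and> F = cell n P' N'"
proof -
  let ?A = "P \<union> N"
  have FC: "F \<subseteq> cell n P N" and cF: "convex F"
    and seg: "\<And>a b x. \<lbrakk>a \<in> cell n P N; b \<in> cell n P N; x \<in> F; x \<in> open_segment a b\<rbrakk> \<Longrightarrow> a \<in> F \<and> b \<in> F"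
    using F(1) unfolding face_of_def by blast+
  define nz where "nz x = {a \<in> ?A. aff n a x \<noteq> 0}" for x
  have fnz: "finite (nz x)" for x using fin by (simp add: nz_def)
  have "\<forall>x. x \<in> F \<longrightarrow> card (nz x) < Suc (card ?A)"
    using fin by (auto simp: nz_def less_Suc_eq_le intro!: card_mono)
  then obtain x where x: "x \<in> F" and max: "\<And>y. y \<in> F \<Longrightarrow> card (nz y) \<le> card (nz x)"
    using F(2) ex_has_greatest_nat[of "\<lambda>x. x \<in> F" _ "\<lambda>x. card (nz x)" "Suc (card ?A)"]
    by (metis all_not_in_conv less_imp_le)
  \<comment> \<open>Otherwise the midpoint of x and y would have strictly more nonvanishing forms
    than x: values of equal sign cannot cancel.\<close>
  have zero: "aff n a y = 0" if y: "y \<in> F" and a: "a \<in> ?A" "aff n a x = 0" for y a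
  proof (rule ccontr)
    assume nz0: "aff n a y \<noteq> 0"
    define m where "m = (1/2) *\<^sub>R x + (1/2 :: real) *\<^sub>R y"
    have m: "m \<in> F" unfolding m_def by (rule convexD[OF cF x y]) auto
    have am: "aff n b m = (aff n b x + aff n b y) / 2" for b
      unfolding m_def by (subst aff_combination) simp_all
    have "nz x \<subseteq> nz m"
    proof
      fix b assume b: "b \<in> nz x"
      then have "(0 \<le> aff n b x \<and> 0 \<le> aff n b y) \<or> (aff n b x \<le> 0 \<and> aff n b y \<le> 0)"
        using x y FC by (auto simp: nz_def cell_def)
      then show "b \<in> nz m" using b by (auto simp: nz_def am)
    qed
    moreover have "a \<in> nz m" "a \<notin> nz x" using a nz0 by (auto simp: nz_def am)
    ultimately have "card (nz x) < card (nz m)" by (intro psubset_card_mono fnz) auto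
    then show False using max[OF m] by simp
  qed
  define P' where "P' = P \<union> {a \<in> ?A. aff n a x = 0}"
  define N' where "N' = N \<union> {a \<in> ?A. aff n a x = 0}"
  have "F \<subseteq> cell n P' N'"
  proof
    fix y assume y: "y \<in> F"
    then have yC: "y \<in> cell n P N" using FC by auto
    have z: "aff n a y = 0" if "a \<in> P' - P \<or> a \<in> N' - N" for a
      using zero[OF y, of a] that by (auto simp: P'_def N'_def)
    have "0 \<le> aff n a y" if "a \<in> P'" for a
      using yC z[of a] that by (cases "a \<in> P") (auto simp: cell_def)
    moreover have "aff n a y \<le> 0" if "a \<in> N'" for a
      using yC z[of a] that by (cases "a \<in> N") (auto simp: cell_def)
    ultimately show "y \<in> cell n P' N'" using yC by (simp add: cell_def)
  qed
  moreover have "y \<in> F" if y: "y \<in> cell n P' N'" for y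
  proof (cases "y = x")
    case True then show ?thesis using x by simp
  next
    case False
    have yC: "y \<in> cell n P N" and xC: "x \<in> cell n P N"
      using y x FC by (auto simp: cell_def P'_def N'_def)
    have y0: "aff n a y = 0" if "a \<in> ?A" "aff n a x = 0" for a
      using y that by (intro antisym) (auto simp: cell_def P'_def N'_def)
    \<comment> \<open>Strict signs at x survive a small step beyond x, away from y; forms vanishing
      at x vanish at y too and cause no trouble.\<close>
    have ev: "\<forall>\<^sub>F e in at_right 0. 0 < (1 + e) * p - e * q" if "0 < p" for p q :: real
    proof (rule order_tendstoD)
      show "((\<lambda>e. (1 + e) * p - e * q) \<longlongrightarrow> p) (at_right 0)"
        by (auto intro!: tendsto_eq_intros)
    qed fact
    have "\<forall>\<^sub>F e in at_right 0. \<forall>a\<in>?A. (0 < aff n a x \<longrightarrow> 0 < (1 + e) * aff n a x - e * aff n a y) \<and>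
        (aff n a x < 0 \<longrightarrow> 0 < (1 + e) * (- aff n a x) - e * (- aff n a y))"
    proof (rule eventually_ball_finite)
      show "finite ?A" using fin by simp
      show "\<forall>a\<in>?A. \<forall>\<^sub>F e in at_right 0. (0 < aff n a x \<longrightarrow> 0 < (1 + e) * aff n a x - e * aff n a y) \<and>
        (aff n a x < 0 \<longrightarrow> 0 < (1 + e) * (- aff n a x) - e * (- aff n a y))"
      proof
        fix a
        consider "0 < aff n a x" | "aff n a x < 0" | "aff n a x = 0" by linarith
        then show "\<forall>\<^sub>F e in at_right 0. (0 < aff n a x \<longrightarrow> 0 < (1 + e) * aff n a x - e * aff n a y) \<and>
            (aff n a x < 0 \<longrightarrow> 0 < (1 + e) * (- aff n a x) - e * (- aff n a y))"
        proof cases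
          case 1
          from ev[OF 1, of "aff n a y"] show ?thesis by eventually_elim (use 1 in simp)
        next
          case 2
          then have "0 < - aff n a x" by simp
          from ev[OF this, of "- aff n a y"] show ?thesis by eventually_elim (use 2 in simp)
        qed simp
      qed
    qed
    moreover have "\<forall>\<^sub>F e in at_right 0. (0 :: real) < e" by (simp add: eventually_at_right_less)
    ultimately have "\<forall>\<^sub>F e in at_right 0. 0 < e \<and> (\<forall>a\<in>?A. (0 < aff n a x \<longrightarrow> 0 < (1 + e) * aff n a x - e * aff n a y) \<and>
        (aff n a x < 0 \<longrightarrow> 0 < (1 + e) * (- aff n a x) - e * (- aff n a y)))"
      by eventually_elim auto
    from eventually_happens'[OF trivial_limit_at_right_real this]
    obtain e :: real where e': "0 < e \<and> (\<forall>a\<in>?A. (0 < aff n a x \<longrightarrow> 0 < (1 + e) * aff n a x - e * aff n a y) \<and>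
        (aff n a x < 0 \<longrightarrow> 0 < (1 + e) * (- aff n a x) - e * (- aff n a y)))"
      by (rule exE)
    have e: "0 < e" "\<And>a. a \<in> ?A \<Longrightarrow> 0 < aff n a x \<Longrightarrow> 0 < (1 + e) * aff n a x - e * aff n a y"
      "\<And>a. a \<in> ?A \<Longrightarrow> aff n a x < 0 \<Longrightarrow> 0 < (1 + e) * (- aff n a x) - e * (- aff n a y)"
      using e' by blast+
    \<comment> \<open>The segment from y to x is prolonged past x by the factor e. Then x lies
      strictly between y and z, and the face property returns y to F.\<close>
    define z where "z = (1 + e) *\<^sub>R x + (- e) *\<^sub>R y"
    have az: "aff n a z = (1 + e) * aff n a x - e * aff n a y" for a
      unfolding z_def by (subst aff_combination) simp_all
    have sgn: "0 \<le> aff n a x \<Longrightarrow> 0 \<le> aff n a z" "aff n a x \<le> 0 \<Longrightarrow> aff n a z \<le> 0" if a: "a \<in> ?A" for a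
    proof -
      consider "0 < aff n a x" | "aff n a x < 0" | "aff n a x = 0" by linarith
      then have "(0 \<le> aff n a x \<longrightarrow> 0 \<le> aff n a z) \<and> (aff n a x \<le> 0 \<longrightarrow> aff n a z \<le> 0)"
      proof cases
        case 1 then show ?thesis using e(2)[OF a] az[of a] by simp
      next
        case 2 then show ?thesis using e(3)[OF a] az[of a] by simp
      next
        case 3 then show ?thesis using y0[OF a] az[of a] by simp
      qed
      then show "0 \<le> aff n a x \<Longrightarrow> 0 \<le> aff n a z" "aff n a x \<le> 0 \<Longrightarrow> aff n a z \<le> 0" by simp_all
    qed
    have "z i = undefined" if "i \<ge> n" for i
    proof -
      have "x i = undefined" "y i = undefined" using xC yC that by (auto simp: cell_def cube_iff)
      then show ?thesis by (simp add: z_def algebra_simps)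
    qed
    \<comment> \<open>The box forms keep their signs at z, which holds z inside the cube.\<close>
    moreover have "0 \<le> z i \<and> z i \<le> 1" if i: "i < n" for i
    proof -
      let ?a = "\<lambda>j. if j = i then 1 else 0 :: int"
      let ?b = "\<lambda>j. if j = i then 1 else if j = n then -1 else 0 :: int"
      have mem: "?a \<in> ?A" "?b \<in> ?A" using box i by (auto simp: box_forms_def)
      have a: "aff n ?a w = w i" for w
        using i by (simp add: aff_def if_distrib[of "\<lambda>c. c * _"] if_distrib[of of_int] cong: if_cong)
      have b: "aff n ?b w = w i - 1" for w
      proof -
        have "(\<Sum>j<n. of_int (?b j) * w j) = (\<Sum>j<n. if j = i then w j else 0)"
          by (rule sum.cong) auto
        then show ?thesis using i by (simp add: aff_def)
      qed
      have "0 \<le> x i" "x i \<le> 1" using xC i by (auto simp: cell_def cube_iff)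
      then show ?thesis using sgn(1)[OF mem(1)] sgn(2)[OF mem(2)] unfolding a b by simp
    qed
    ultimately have "z \<in> cell n P N"
      using sgn xC by (auto simp: cell_def cube_iff)
    moreover have "x \<in> open_segment y z"
    proof -
      have "x = (1 - 1 / (1 + e)) *\<^sub>R y + (1 / (1 + e)) *\<^sub>R z"
      proof (rule ext)
        fix k
        define c where "c = 1 / (1 + e)"
        have ce: "c * (1 + e) = 1" using e(1) by (simp add: c_def)
        have "((1 - c) *\<^sub>R y + c *\<^sub>R z) k = (c * (1 + e)) * x k + (1 - c * (1 + e)) * y k"
          by (simp add: z_def algebra_simps)
        then show "x k = ((1 - 1 / (1 + e)) *\<^sub>R y + (1 / (1 + e)) *\<^sub>R z) k"
          unfolding ce by (simp add: c_def)
      qed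
      moreover have "y \<noteq> z"
      proof
        assume "y = z"
        then have "x = y" using calculation by (simp flip: scaleR_add_left)
        then show False using False by simp
      qed
      moreover have "0 < 1 / (1 + e)" "1 / (1 + e) < 1" using e(1) by simp_all
      ultimately show ?thesis unfolding in_segment by blast
    qed
    ultimately show ?thesis using seg[OF yC _ x] by blast
  qed
  ultimately have "F = cell n P' N'" by auto
  moreover have "P' \<union> N' = P \<union> N" by (auto simp: P'_def N'_def)
  ultimately show ?thesis by blast
qed

text \<open>Over a fixed set B of forms, the cells of all dimensions are closed under faces and
  intersections, a form in both P and N marking an equality. The empty set is added because it
  counts as a face.\<close>

theorem arrangement_complex:
  assumes "finite A"
  obtains W where "rational_polyhedral_complex n W" "\<Union>W = cube n"
    "\<And>C a. C \<in> W \<Longrightarrow> a \<in> A \<Longrightarrow> (\<forall>x\<in>C. 0 \<le> aff n a x) \<or> (\<forall>x\<in>C. aff n a x \<le> 0)"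
proof -
  define B where "B = A \<union> box_forms n"
  define W where "W = insert {} {cell n P N | P N. P \<union> N = B}"
  have finB: "finite B" using assms by (simp add: B_def box_forms_def)
  have finPN: "finite P \<and> finite N" if "P \<union> N = B" for P N
    using that finB by (metis finite_Un)
  have cube: "C \<subseteq> cube n" if "C \<in> W" for C using that by (auto simp: W_def cell_def)
  have "rational_polyhedral_complex n W"
    unfolding rational_polyhedral_complex_def
  proof (intro conjI allI ballI impI)
    have "W \<subseteq> insert {} ((\<lambda>(P, N). cell n P N) ` (Pow B \<times> Pow B))" by (auto simp: W_def)
    then show "finite W" by (rule finite_subset) (use finB in auto)
  next
    fix C assume C: "C \<in> W"
    have rp: "rat_polytope n C"
    proof (cases "C = {}")
      case True then show ?thesis by (auto simp: rat_polytope_def intro!: exI[of _ "{}"])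
    next
      case False
      then show ?thesis using C finPN rat_polytope_cell by (auto simp: W_def)
    qed
    then show "polytope C" by (auto simp: rat_polytope_def polytope_def)
    show "C \<subseteq> cube n" using C by (rule cube)
    fix v i assume v: "v extreme_point_of C" and i: "i < n"
    obtain V where V: "C = convex hull V" "\<forall>v\<in>V. \<forall>i<n. v i \<in> \<rat>" using rp by (auto simp: rat_polytope_def)
    have "v \<in> V" using v unfolding V(1) by (rule extreme_point_of_convex_hull)
    then show "v i \<in> \<rat>" using V(2) i by blast
  next
    fix C F assume CF: "C \<in> W \<and> F face_of C"
    show "F \<in> W"
    proof (cases "F = {}")
      case False
      then have "C \<noteq> {}" using CF face_of_imp_subset by blast
      then obtain P N where PN: "P \<union> N = B" "C = cell n P N"
        using CF by (auto simp: W_def)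
      have "box_forms n \<subseteq> P \<union> N" "F face_of cell n P N" "finite P" "finite N"
        using PN CF finPN[OF PN(1)] by (auto simp: B_def)
      then obtain P' N' where "P' \<union> N' = P \<union> N" "F = cell n P' N'"
        using face_of_cellD False by metis
      then show ?thesis using PN(1) unfolding W_def by blast
    qed (simp add: W_def)
  next
    fix C D assume CD: "C \<in> W \<and> D \<in> W"
    have "C \<inter> D face_of C \<and> C \<inter> D face_of D"
    proof (cases "C = {} \<or> D = {}")
      case True then show ?thesis by auto
    next
      case False
      then obtain P N Q R where PN: "P \<union> N = B" "C = cell n P N" "Q \<union> R = B" "D = cell n Q R"
        using CD by (auto simp: W_def)
      have "C \<inter> D = cell n (P \<union> Q) (N \<union> R)" by (auto simp: PN cell_def)
      then show ?thesis
        using cell_face_of_cell[of P "P \<union> Q" N "N \<union> R" n] cell_face_of_cell[of Q "P \<union> Q" R "N \<union> R" n] PN by auto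
    qed
    then show "C \<inter> D face_of C" "C \<inter> D face_of D" by auto
  qed
  moreover have "\<Union>W = cube n"
  proof
    show "\<Union>W \<subseteq> cube n" using cube by blast
    show "cube n \<subseteq> \<Union>W"
    proof
      fix x assume "x \<in> cube n"
      then have "x \<in> cell n {a \<in> B. 0 \<le> aff n a x} {a \<in> B. aff n a x \<le> 0}" by (simp add: cell_def)
      moreover have "{a \<in> B. 0 \<le> aff n a x} \<union> {a \<in> B. aff n a x \<le> 0} = B" by auto
      ultimately show "x \<in> \<Union>W" unfolding W_def by blast
    qed
  qed
  moreover have "(\<forall>x\<in>C. 0 \<le> aff n a x) \<or> (\<forall>x\<in>C. aff n a x \<le> 0)" if CW: "C \<in> W" and aA: "a \<in> A" for C a
  proof (cases "C = {}")
    case False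
    then obtain P N where PN: "P \<union> N = B" "C = cell n P N" using CW by (auto simp: W_def)
    then have "a \<in> P \<or> a \<in> N" using aA by (auto simp: B_def)
    then show ?thesis unfolding PN(2) by (auto simp: cell_def)
  qed simp
  ultimately show thesis by (rule that)
qed

section \<open>Planar piecewise affine maps as McNaughton homeomorphisms\<close>

definition lift2 :: "nat \<Rightarrow> nat \<Rightarrow> (real \<times> real \<Rightarrow> real \<times> real) \<Rightarrow> (nat \<Rightarrow> real) \<Rightarrow> nat \<Rightarrow> real" where
  "lift2 i j f x = x(i := fst (f (x i, x j)), j := snd (f (x i, x j)))"

definition affine_map :: "int \<Rightarrow> int \<Rightarrow> int \<Rightarrow> int \<Rightarrow> int \<Rightarrow> int \<Rightarrow> real \<times> real \<Rightarrow> real \<times> real" where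
  "affine_map p q r s c e = (\<lambda>(x, y). (p * x + q * y + c, r * x + s * y + e))"

section \<open>Integer matrices acting on two coordinates\<close>

definition lift_mat :: "nat \<Rightarrow> nat \<Rightarrow> nat \<Rightarrow> int \<Rightarrow> int \<Rightarrow> int \<Rightarrow> int \<Rightarrow> int \<Rightarrow> int \<Rightarrow> int Matrix.mat" where
  "lift_mat n i j p q r s c e = Matrix.mat (Suc n) (Suc n) (\<lambda>(k, l).
     if k = i then (if l = i then p else if l = j then q else if l = n then c else 0)
     else if k = j then (if l = i then r else if l = j then s else if l = n then e else 0)
     else if k = l then 1 else 0)"

lemma lift_mat_carrier: "lift_mat n i j p q r s c e \<in> carrier_mat (Suc n) (Suc n)"
  by (simp add: lift_mat_def)

text \<open>In the Leibniz formula the rows other than i and j are unit rows, so a contributing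
  permutation fixes all other indices: only the identity and the transposition of i and j
  remain.\<close>

lemma det_lift_mat:
  assumes ij: "i < n" "j < n" "i \<noteq> j"
  shows "Determinant.det (lift_mat n i j p q r s c e) = p * s - q * r"
proof -
  let ?A = "lift_mat n i j p q r s c e"
  let ?S = "{\<pi>. \<pi> permutes {0..<Suc n}}"
  let ?t = "Transposition.transpose i j"
  let ?g = "\<lambda>\<pi>. signof \<pi> * (\<Prod>k = 0..<Suc n. ?A $$ (k, \<pi> k))"
  have A: "?A $$ (k, l) = (if k = i then (if l = i then p else if l = j then q else if l = n then c else 0)
     else if k = j then (if l = i then r else if l = j then s else if l = n then e else 0)
     else if k = l then 1 else 0)" if "k < Suc n" "l < Suc n" for k l
    using that by (simp add: lift_mat_def)
  have t: "?t permutes {0..<Suc n}" using ij by (intro permutes_swap_id) auto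
  have zero: "?g \<pi> = 0" if \<pi>: "\<pi> permutes {0..<Suc n}" "\<pi> \<noteq> id" "\<pi> \<noteq> ?t" for \<pi>
  proof (rule ccontr)
    assume "?g \<pi> \<noteq> 0"
    then have nz: "?A $$ (k, \<pi> k) \<noteq> 0" if "k < Suc n" for k
      using that by (auto simp del: prod.op_ivl_Suc)
    have lt: "\<pi> k < Suc n" if "k < Suc n" for k
      using permutes_in_image[OF \<pi>(1), of k] that by auto
    have fixed: "\<pi> k = k" if "k \<noteq> i" "k \<noteq> j" for k
    proof (cases "k < Suc n")
      case True
      then show ?thesis using nz[OF True] A[OF True lt[OF True]] that by (auto split: if_splits)
    next
      case False
      then show ?thesis using permutes_not_in[OF \<pi>(1)] by simp
    qed
    have inj: "inj \<pi>" by (rule permutes_inj[OF \<pi>(1)])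
    have mem: "\<pi> k = i \<or> \<pi> k = j" if "k = i \<or> k = j" for k
    proof (rule ccontr)
      assume "\<not> (\<pi> k = i \<or> \<pi> k = j)"
      then have "\<pi> (\<pi> k) = \<pi> k" using fixed by blast
      then have "\<pi> k = k" using inj by (simp add: inj_eq)
      then show False using that \<open>\<not> (\<pi> k = i \<or> \<pi> k = j)\<close> by auto
    qed
    have "\<pi> i \<noteq> \<pi> j" using inj ij(3) by (simp add: inj_eq)
    then consider "\<pi> i = i" "\<pi> j = j" | "\<pi> i = j" "\<pi> j = i" using mem[of i] mem[of j] by auto
    then show False
    proof cases
      case 1
      then have "\<pi> = id" using fixed by (intro ext) (metis id_apply)
      then show False using \<pi>(2) by simp
    next
      case 2
      have "\<pi> k = ?t k" for k
        using 2 fixed[of k] by (cases "k = i"; cases "k = j") (simp_all add: transpose_def)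
      then have "\<pi> = ?t" by (rule ext)
      then show False using \<pi>(3) by simp
    qed
  qed
  have rest: "(\<Prod>k = 0..<Suc n. f k) = f i * f j" if "\<And>k. k < Suc n \<Longrightarrow> k \<noteq> i \<Longrightarrow> k \<noteq> j \<Longrightarrow> f k = 1" for f :: "nat \<Rightarrow> int"
  proof -
    have "(\<Prod>k = 0..<Suc n. f k) = (\<Prod>k \<in> {i, j}. f k)"
      by (rule prod.mono_neutral_right) (use ij that in auto)
    then show ?thesis using ij(3) by simp
  qed
  have "Determinant.det ?A = (\<Sum>\<pi>\<in>?S. ?g \<pi>)"
    by (rule det_def'[OF lift_mat_carrier])
  also have "\<dots> = (\<Sum>\<pi>\<in>{id, ?t}. ?g \<pi>)"
  proof (rule sum.mono_neutral_right)
    show "finite ?S" by (rule finite_permutations) simp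
    show "{id, ?t} \<subseteq> ?S" using t permutes_id by auto
    show "\<forall>\<pi>\<in>?S - {id, ?t}. ?g \<pi> = 0" using zero by auto
  qed
  also have "\<dots> = ?g id + ?g ?t"
  proof -
    have "?t i = j" by simp
    then have "id \<noteq> ?t" using ij(3) by (metis id_apply)
    then show ?thesis by simp
  qed
  also have "?g id = p * s"
    by (subst rest) (use ij in \<open>auto simp: A\<close>)
  also have "(\<Prod>k = 0..<Suc n. ?A $$ (k, ?t k)) = q * r"
    by (subst rest) (use ij in \<open>auto simp: A transpose_def\<close>)
  also have "signof ?t = (-1 :: int)" using ij(3) by (simp add: sign_swap_id)
  finally show ?thesis by simp
qed

lemma row_lift_mat:
  assumes "i < n" "j < n"
  shows "Matrix.row (lift_mat n i j p q r s c e) n = unit_vec (Suc n) n"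
  by (rule eq_vecI) (use assms in \<open>auto simp: lift_mat_def unit_vec_def\<close>)

lemma homogeneous_lift2:
  assumes ij: "i < n" "j < n" "i \<noteq> j" and f: "f (x i, x j) = affine_map p q r s c e (x i, x j)"
  shows "homogeneous n (lift2 i j f x) =
    map_mat real_of_int (lift_mat n i j p q r s c e) *\<^sub>v homogeneous n x"
proof (rule eq_vecI)
  let ?P = "lift_mat n i j p q r s c e"
  show "dim_vec (homogeneous n (lift2 i j f x)) = dim_vec (map_mat real_of_int ?P *\<^sub>v homogeneous n x)"
    by (simp add: homogeneous_def lift_mat_def)
  fix k assume "k < dim_vec (map_mat real_of_int ?P *\<^sub>v homogeneous n x)"
  then have k: "k < Suc n" by (simp add: lift_mat_def)
  define h where "h l = (if l < n then x l else 1)" for l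
  have "(map_mat real_of_int ?P *\<^sub>v homogeneous n x) $ k = (\<Sum>l = 0..<Suc n. real_of_int (?P $$ (k, l)) * h l)"
  proof -
    have "(map_mat real_of_int ?P *\<^sub>v homogeneous n x) $ k =
        scalar_prod (Matrix.row (map_mat real_of_int ?P) k) (homogeneous n x)"
      by (rule index_mult_mat_vec) (use k in \<open>simp add: lift_mat_def\<close>)
    also have "\<dots> = (\<Sum>l = 0..<Suc n. Matrix.row (map_mat real_of_int ?P) k $ l * homogeneous n x $ l)"
      unfolding scalar_prod_def by (simp add: homogeneous_def)
    also have "\<dots> = (\<Sum>l = 0..<Suc n. real_of_int (?P $$ (k, l)) * h l)"
    proof (rule sum.cong[OF refl])
      fix l assume l: "l \<in> {0..<Suc n}"
      have "Matrix.row (map_mat real_of_int ?P) k $ l = real_of_int (?P $$ (k, l))"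
        using k l lift_mat_carrier[of n i j p q r s c e] by simp
      moreover have "homogeneous n x $ l = h l"
        using l by (simp add: homogeneous_def h_def)
      ultimately show "Matrix.row (map_mat real_of_int ?P) k $ l * homogeneous n x $ l = real_of_int (?P $$ (k, l)) * h l"
        by (simp only:)
    qed
    finally show ?thesis .
  qed
  also have "\<dots> = (if k = i then p * x i + q * x j + c else if k = j then r * x i + s * x j + e else h k)"
  proof -
    have "(\<Sum>l = 0..<Suc n. real_of_int (?P $$ (k, l)) * h l) =
      (\<Sum>l\<in>(if k = i \<or> k = j then {i, j, n} else {k}). real_of_int (?P $$ (k, l)) * h l)"
      by (rule sum.mono_neutral_right) (use k ij in \<open>auto simp: lift_mat_def\<close>)
    then show ?thesis using k ij by (auto simp: lift_mat_def h_def)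
  qed
  also have "\<dots> = homogeneous n (lift2 i j f x) $ k"
    using k ij f by (auto simp: homogeneous_def lift2_def h_def affine_map_def)
  finally show "homogeneous n (lift2 i j f x) $ k = (map_mat real_of_int ?P *\<^sub>v homogeneous n x) $ k" ..
qed

section \<open>Piecewise affine maps of the square\<close>

abbreviation square :: "(real \<times> real) set" where "square \<equiv> {0..1} \<times> {0..1}"

definition form :: "int \<times> int \<times> int \<Rightarrow> real \<times> real \<Rightarrow> real" where
  "form = (\<lambda>(a, b, c) (x, y). a * x + b * y + c)"

definition signed :: "(int \<times> int \<times> int) set \<Rightarrow> (real \<times> real) set \<Rightarrow> bool" where
  "signed F C \<longleftrightarrow> C \<subseteq> square \<and> (\<forall>a\<in>F. (\<forall>p\<in>C. 0 \<le> form a p) \<or> (\<forall>p\<in>C. form a p \<le> 0))"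

text \<open>Quantifying over every set on which the forms keep their signs avoids a list of regions,
  and applies directly to the projection of any cell of a higher-dimensional arrangement.\<close>

definition piecewise :: "int \<Rightarrow> (real \<times> real \<Rightarrow> real \<times> real) \<Rightarrow> (int \<times> int \<times> int) set \<Rightarrow> bool" where
  "piecewise d f F \<longleftrightarrow> finite F \<and> (\<forall>C. signed F C \<longrightarrow>
     (\<exists>p q r s c e. p * s - q * r = d \<and> (\<forall>z\<in>C. f z = affine_map p q r s c e z)))"

lemma continuous_on_form: "continuous_on S (form a)"
  unfolding form_def split_def by (intro continuous_intros)

lemma continuous_on_affine_map: "continuous_on S (affine_map p q r s c e)"
  unfolding affine_map_def split_def by (intro continuous_intros)

text \<open>The choices of sign for the forms yield finitely many closed sets that cover the square,
  and f is affine on each.\<close>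

lemma piecewise_continuous_on:
  assumes "piecewise d f F"
  shows "continuous_on square f"
proof -
  define K where "K P = {z \<in> square. (\<forall>a\<in>P. 0 \<le> form a z) \<and> (\<forall>a\<in>F - P. form a z \<le> 0)}" for P
  have fin: "finite F" using assms by (simp add: piecewise_def)
  have closed: "closed (K P)" for P
  proof -
    have "K P = square \<inter> ((\<Inter>a\<in>P. {z. 0 \<le> form a z}) \<inter> (\<Inter>a\<in>F - P. {z. form a z \<le> 0}))"
      by (auto simp: K_def)
    moreover have "closed {z. 0 \<le> form a z}" "closed {z. form a z \<le> 0}" for a
      by (rule closed_Collect_le[OF continuous_on_const continuous_on_form]
          closed_Collect_le[OF continuous_on_form continuous_on_const])+
    moreover have "closed square" by (intro closed_Times closed_atLeastAtMost)
    ultimately show ?thesis by (simp only:) (intro closed_Int closed_INT ballI)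
  qed
  have cont: "continuous_on (K P) f" if "P \<subseteq> F" for P
  proof -
    have "signed F (K P)" using that by (auto simp: signed_def K_def)
    then obtain p q r s c e where "\<forall>z\<in>K P. f z = affine_map p q r s c e z"
      using assms unfolding piecewise_def by blast
    then show ?thesis
      using continuous_on_affine_map by (metis continuous_on_cong)
  qed
  have "square = (\<Union>P\<in>Pow F. K P)"
  proof
    show "square \<subseteq> (\<Union>P\<in>Pow F. K P)"
    proof
      fix z assume "z \<in> square"
      then have "z \<in> K {a \<in> F. 0 \<le> form a z}" by (auto simp: K_def)
      then show "z \<in> (\<Union>P\<in>Pow F. K P)" by (rule UN_I[rotated]) simp
    qed
    have "K P \<subseteq> square" for P unfolding K_def by (rule Collect_restrict)
    then show "(\<Union>P\<in>Pow F. K P) \<subseteq> square" by (rule UN_least)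
  qed
  moreover have "continuous_on (\<Union>P\<in>Pow F. K P) f"
    by (rule continuous_on_closed_Union) (use fin closed cont in auto)
  ultimately show ?thesis by (simp only:)
qed

lemma continuous_on_lift2:
  assumes "i < n" "j < n" "continuous_on square f"
  shows "continuous_on (cube n) (lift2 i j f)"
proof (rule continuous_on_coordinatewise_then_product)
  fix k
  have coord: "continuous_on (cube n) (\<lambda>x. x l)" for l
    by (rule continuous_on_subset[OF continuous_on_product_coordinates]) simp
  have "continuous_on (cube n) (\<lambda>x. f (x i, x j))"
    by (rule continuous_on_compose2[OF assms(3)])
       (use assms(1,2) in \<open>auto intro!: continuous_on_Pair coord simp: cube_iff\<close>)
  then show "continuous_on (cube n) (\<lambda>x. lift2 i j f x k)"
    unfolding lift2_def fun_upd_def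
    by (cases "k = j"; cases "k = i") (auto intro: continuous_intros coord)
qed

lemma lift2_cube:
  assumes "i < n" "j < n" "f ` square \<subseteq> square" "x \<in> cube n"
  shows "lift2 i j f x \<in> cube n"
proof -
  have "(x i, x j) \<in> square" using assms by (auto simp: cube_iff)
  then have "f (x i, x j) \<in> square" using assms(3) by blast
  then show ?thesis using assms by (auto simp: cube_iff lift2_def mem_Times_iff)
qed

text \<open>
  A matrix is found for every cell, of whatever dimension, so that \<open>has_aff_dim\<close> never has to be
  evaluated.
\<close>

theorem mcnaughton_homeomorphism_lift2:
  assumes ij: "i < n" "j < n" "i \<noteq> j" and pw: "piecewise d f F" and d: "d = 1 \<or> d = -1"
    and maps: "f ` square \<subseteq> square" "g ` square \<subseteq> square" and g: "continuous_on square g"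
    and inv: "\<And>z. z \<in> square \<Longrightarrow> f (g z) = z" "\<And>z. z \<in> square \<Longrightarrow> g (f z) = z"
  shows "mcnaughton_homeomorphism n (lift2 i j f)"
  unfolding mcnaughton_homeomorphism_def
proof
  have sq: "(x i, x j) \<in> square" if "x \<in> cube n" for x using that ij by (auto simp: cube_iff)
  have comp: "lift2 i j h (lift2 i j k x) = x" if "h (k (x i, x j)) = (x i, x j)" for h k x
    using that ij(3) by (auto simp: lift2_def fun_eq_iff)
  have "homeomorphism (cube n) (cube n) (lift2 i j f) (lift2 i j g)"
  proof (rule homeomorphismI)
    show "continuous_on (cube n) (lift2 i j f)" "continuous_on (cube n) (lift2 i j g)"
      using continuous_on_lift2 ij piecewise_continuous_on[OF pw] g by blast+
    show "lift2 i j f ` cube n \<subseteq> cube n" "lift2 i j g ` cube n \<subseteq> cube n"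
      using lift2_cube[OF ij(1,2)] maps by blast+
  qed (use comp inv sq in blast)+
  then show "\<exists>T. homeomorphism (cube n) (cube n) (lift2 i j f) T" by blast
  \<comment> \<open>A planar form read as a form in n variables depending on coordinates i and j
    only, so that cells of the arrangement project to sets with constant signs.\<close>
  define widen where "widen = (\<lambda>(a, b, c) k. if k = i then a else if k = j then b else if k = n then c else 0 :: int)"
  have widen: "aff n (widen a) x = form a (x i, x j)" for a x
  proof -
    obtain b1 b2 b3 where a: "a = (b1, b2, b3)" by (cases a)
    have "(\<Sum>k<n. of_int (widen a k) * x k) = (\<Sum>k\<in>{i, j}. of_int (widen a k) * x k)"
      by (rule sum.mono_neutral_right) (use ij in \<open>auto simp: widen_def a\<close>)
    then show ?thesis using ij by (simp add: aff_def form_def a widen_def)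
  qed
  have "finite (widen ` F)" using pw by (simp add: piecewise_def)
  then obtain W where W: "rational_polyhedral_complex n W" "\<Union>W = cube n"
    and sgn: "\<And>C a. C \<in> W \<Longrightarrow> a \<in> widen ` F \<Longrightarrow> (\<forall>x\<in>C. 0 \<le> aff n a x) \<or> (\<forall>x\<in>C. aff n a x \<le> 0)"
    using arrangement_complex[of "widen ` F" n] by blast
  have "\<exists>P. P \<in> carrier_mat (Suc n) (Suc n) \<and> Matrix.row P n = unit_vec (Suc n) n \<and>
      Determinant.det P = d \<and> (\<forall>x\<in>C. homogeneous n (lift2 i j f x) = map_mat real_of_int P *\<^sub>v homogeneous n x)"
    if C: "C \<in> W" for C
  proof -
    have "C \<subseteq> cube n" using C W(2) by blast
    have "signed F ((\<lambda>x. (x i, x j)) ` C)"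
      unfolding signed_def
    proof (intro conjI ballI)
      show "(\<lambda>x. (x i, x j)) ` C \<subseteq> square" using \<open>C \<subseteq> cube n\<close> sq by blast
      fix a assume "a \<in> F"
      then show "(\<forall>z\<in>(\<lambda>x. (x i, x j)) ` C. 0 \<le> form a z) \<or> (\<forall>z\<in>(\<lambda>x. (x i, x j)) ` C. form a z \<le> 0)"
        using sgn[OF C, of "widen a"] by (simp add: widen)
    qed
    then obtain p q r s c e where P: "p * s - q * r = d"
      "\<forall>z\<in>(\<lambda>x. (x i, x j)) ` C. f z = affine_map p q r s c e z"
      using pw unfolding piecewise_def by blast
    show ?thesis
    proof (intro exI[of _ "lift_mat n i j p q r s c e"] conjI ballI)
      show "Determinant.det (lift_mat n i j p q r s c e) = d"
        using det_lift_mat[OF ij] P(1) by simp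
      fix x assume "x \<in> C"
      then have "f (x i, x j) = affine_map p q r s c e (x i, x j)" using P(2) by blast
      then show "homogeneous n (lift2 i j f x) = map_mat real_of_int (lift_mat n i j p q r s c e) *\<^sub>v homogeneous n x"
        by (rule homogeneous_lift2[OF ij])
    qed (rule lift_mat_carrier row_lift_mat[OF ij(1,2)])+
  qed
  then obtain P where "\<forall>C\<in>W. P C \<in> carrier_mat (Suc n) (Suc n) \<and> Matrix.row (P C) n = unit_vec (Suc n) n \<and>
      Determinant.det (P C) = d \<and> (\<forall>x\<in>C. homogeneous n (lift2 i j f x) = map_mat real_of_int (P C) *\<^sub>v homogeneous n x)"
    by metis
  with W d show "\<exists>W (P :: (nat \<Rightarrow> real) set \<Rightarrow> int Matrix.mat) d.
        rational_polyhedral_complex n W \<and> \<Union>W = cube n \<and> (d = 1 \<or> d = -1) \<and>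
        (\<forall>C\<in>W. has_aff_dim C n \<longrightarrow> P C \<in> carrier_mat (Suc n) (Suc n) \<and>
           Matrix.row (P C) n = unit_vec (Suc n) n \<and> Determinant.det (P C) = d \<and>
           (\<forall>p\<in>C. homogeneous n (lift2 i j f p) = map_mat real_of_int (P C) *\<^sub>v homogeneous n p))"
    by blast
qed

section \<open>The twist as a piecewise affine homeomorphism\<close>

lemma twist_eqI: "twist z = (a, b) \<Longrightarrow> a = c \<and> b = d \<Longrightarrow> twist z = (c, d)"
  by simp

text \<open>The formulas agree where neighbouring regions meet, so each holds on the closed region,
  whatever the order of the tests in \<open>twist\<close>. Closed conditions are what constant signs
  provide.\<close>

lemma twist_regions:
  assumes "0 \<le> x" "0 \<le> y"
  shows "1 - x - y \<le> 0 \<Longrightarrow> twist (x, y) = (x, y)"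
    and "1 \<le> 4 * x \<Longrightarrow> 1 \<le> 4 * y \<Longrightarrow> 1 \<le> 4 * (1 - x - y) \<Longrightarrow> twist (x, y) = (1 - x - y, x)"
    and "4 * y \<le> 1 \<Longrightarrow> y \<le> x \<Longrightarrow> 2 * y \<le> 1 - x - y \<Longrightarrow> twist (x, y) = (x + y, y)"
    and "4 * y \<le> 1 \<Longrightarrow> y \<le> x \<Longrightarrow> y \<le> 1 - x - y \<Longrightarrow> 1 - x - y \<le> 2 * y \<Longrightarrow>
      twist (x, y) = (2 - x - 5 * y, x + 4 * y - 1)"
    and "0 \<le> 1 - x - y \<Longrightarrow> 4 * (1 - x - y) \<le> 1 \<Longrightarrow> 1 - x - y \<le> y \<Longrightarrow> 2 * (1 - x - y) \<le> x \<Longrightarrow>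
      twist (x, y) = (2 * x + y - 1, 1 - x)"
    and "0 \<le> 1 - x - y \<Longrightarrow> 4 * (1 - x - y) \<le> 1 \<Longrightarrow> 1 - x - y \<le> y \<Longrightarrow> 1 - x - y \<le> x \<Longrightarrow> x \<le> 2 * (1 - x - y) \<Longrightarrow>
      twist (x, y) = (1 - x - y, 5 * x + 4 * y - 3)"
    and "4 * x \<le> 1 \<Longrightarrow> x \<le> 1 - x - y \<Longrightarrow> 2 * x \<le> y \<Longrightarrow> twist (x, y) = (x, y - x)"
    and "4 * x \<le> 1 \<Longrightarrow> x \<le> 1 - x - y \<Longrightarrow> x \<le> y \<Longrightarrow> y \<le> 2 * x \<Longrightarrow> twist (x, y) = (3 * x - y, x)"
  by (cases rule: twist_cases[of x y]; erule twist_eqI; insert assms; argo)+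

text \<open>In the barycentric coordinates a, b, c: the sign of c; the comparison of each coordinate
  with 1/4; the three pairwise comparisons; and c - 2 b, a - 2 c, b - 2 a, whose zeros mark where a
  step passes a corner.\<close>

definition twist_forms :: "(int \<times> int \<times> int) set" where
  "twist_forms = {(-1,-1,1), (4,0,-1), (0,4,-1), (-4,-4,3), (1,-1,0), (1,2,-1), (2,1,-1),
     (-1,-3,1), (3,2,-2), (-2,1,0)}"

lemma piecewise_twist: "piecewise 1 twist twist_forms"
  unfolding piecewise_def
proof (intro conjI allI impI)
  show "finite twist_forms" by (simp add: twist_forms_def)
  fix C assume C: "signed twist_forms C"
  have sg: "(\<forall>x y. (x, y) \<in> C \<longrightarrow> 0 \<le> real_of_int a * x + real_of_int b * y + real_of_int c) \<or>
      (\<forall>x y. (x, y) \<in> C \<longrightarrow> real_of_int a * x + real_of_int b * y + real_of_int c \<le> 0)"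
    if "(a, b, c) \<in> twist_forms" for a b c
  proof -
    have form: "form (a, b, c) (x, y) = real_of_int a * x + real_of_int b * y + real_of_int c" for x y
      by (simp add: form_def)
    have "(\<forall>p\<in>C. 0 \<le> form (a, b, c) p) \<or> (\<forall>p\<in>C. form (a, b, c) p \<le> 0)"
      using C that unfolding signed_def by blast
    then show ?thesis unfolding form[symmetric] by blast
  qed
  have nonneg: "0 \<le> x" "0 \<le> y" if "(x, y) \<in> C" for x y
    using C that by (auto simp: signed_def)
  have pieceI: "\<exists>p q r s c e. p * s - q * r = 1 \<and> (\<forall>z\<in>C. twist z = affine_map p q r s c e z)"
    if "p * s - q * r = 1" "\<And>x y. (x, y) \<in> C \<Longrightarrow>
      twist (x, y) = (of_int p * x + of_int q * y + of_int c, of_int r * x + of_int s * y + of_int e)" for p q r s c e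
  proof (intro exI conjI ballI)
    show "p * s - q * r = 1" by (rule that(1))
    fix z assume "z \<in> C"
    then show "twist z = affine_map p q r s c e z"
      using that(2)[of "fst z" "snd z"] by (simp add: affine_map_def split_def)
  qed
  have d1: "(\<forall>x y. (x, y) \<in> C \<longrightarrow> 0 \<le> 1 - x - y) \<or> (\<forall>x y. (x, y) \<in> C \<longrightarrow> 1 - x - y \<le> 0)"
    using sg[of "-1" "-1" 1] by (simp add: twist_forms_def algebra_simps)
  have d2: "(\<forall>x y. (x, y) \<in> C \<longrightarrow> 1 \<le> 4 * x) \<or> (\<forall>x y. (x, y) \<in> C \<longrightarrow> 4 * x \<le> 1)"
    using sg[of 4 0 "-1"] by (simp add: twist_forms_def algebra_simps)
  have d3: "(\<forall>x y. (x, y) \<in> C \<longrightarrow> 1 \<le> 4 * y) \<or> (\<forall>x y. (x, y) \<in> C \<longrightarrow> 4 * y \<le> 1)"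
    using sg[of 0 4 "-1"] by (simp add: twist_forms_def algebra_simps)
  have d4: "(\<forall>x y. (x, y) \<in> C \<longrightarrow> 1 \<le> 4 * (1 - x - y)) \<or> (\<forall>x y. (x, y) \<in> C \<longrightarrow> 4 * (1 - x - y) \<le> 1)"
    using sg[of "-4" "-4" 3] by (simp add: twist_forms_def algebra_simps)
  have d5: "(\<forall>x y. (x, y) \<in> C \<longrightarrow> y \<le> x) \<or> (\<forall>x y. (x, y) \<in> C \<longrightarrow> x \<le> y)"
    using sg[of 1 "-1" 0] by (simp add: twist_forms_def algebra_simps)
  have d6: "(\<forall>x y. (x, y) \<in> C \<longrightarrow> 1 - x - y \<le> y) \<or> (\<forall>x y. (x, y) \<in> C \<longrightarrow> y \<le> 1 - x - y)"
    using sg[of 1 2 "-1"] by (simp add: twist_forms_def algebra_simps)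
  have d7: "(\<forall>x y. (x, y) \<in> C \<longrightarrow> 1 - x - y \<le> x) \<or> (\<forall>x y. (x, y) \<in> C \<longrightarrow> x \<le> 1 - x - y)"
    using sg[of 2 1 "-1"] by (simp add: twist_forms_def algebra_simps)
  have d8: "(\<forall>x y. (x, y) \<in> C \<longrightarrow> 2 * y \<le> 1 - x - y) \<or> (\<forall>x y. (x, y) \<in> C \<longrightarrow> 1 - x - y \<le> 2 * y)"
    using sg[of "-1" "-3" 1] by (simp add: twist_forms_def algebra_simps)
  have d9: "(\<forall>x y. (x, y) \<in> C \<longrightarrow> 2 * (1 - x - y) \<le> x) \<or> (\<forall>x y. (x, y) \<in> C \<longrightarrow> x \<le> 2 * (1 - x - y))"
    using sg[of 3 2 "-2"] by (simp add: twist_forms_def algebra_simps)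
  have d10: "(\<forall>x y. (x, y) \<in> C \<longrightarrow> 2 * x \<le> y) \<or> (\<forall>x y. (x, y) \<in> C \<longrightarrow> y \<le> 2 * x)"
    using sg[of "-2" 1 0] by (simp add: twist_forms_def algebra_simps)
  show "\<exists>p q r s c e. p * s - q * r = 1 \<and> (\<forall>z\<in>C. twist z = affine_map p q r s c e z)"
    using d1
  proof
    assume "\<forall>x y. (x, y) \<in> C \<longrightarrow> 1 - x - y \<le> 0"
    then show ?thesis
      using nonneg twist_regions(1) by (intro pieceI[of 1 1 0 0 0 0]) auto
  next
    assume c0: "\<forall>x y. (x, y) \<in> C \<longrightarrow> 0 \<le> 1 - x - y"
    consider (centre) "\<forall>x y. (x, y) \<in> C \<longrightarrow> 1 \<le> 4 * x \<and> 1 \<le> 4 * y \<and> 1 \<le> 4 * (1 - x - y)"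
      | (low) "\<forall>x y. (x, y) \<in> C \<longrightarrow> 4 * x \<le> 1 \<or> 4 * y \<le> 1 \<or> 4 * (1 - x - y) \<le> 1"
      using d2 d3 d4 by blast
    then show ?thesis
    proof cases
      case centre
      then show ?thesis
        using nonneg twist_regions(2) by (intro pieceI[of "-1" 0 "-1" 1 1 0]) auto
    next
      case low
      \<comment> \<open>The three pairwise comparisons have constant sign on C, so some coordinate
        is smallest throughout C; a cyclic pattern forces all three to be equal, and then any choice
        will do.\<close>
      consider (bottom) "\<forall>x y. (x, y) \<in> C \<longrightarrow> y \<le> x \<and> y \<le> 1 - x - y"
        | (slant) "\<forall>x y. (x, y) \<in> C \<longrightarrow> 1 - x - y \<le> x \<and> 1 - x - y \<le> y"
        | (left) "\<forall>x y. (x, y) \<in> C \<longrightarrow> x \<le> y \<and> x \<le> 1 - x - y"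
        using d5 d6 d7 by (smt (verit, ccfv_threshold))
      then show ?thesis
      proof cases
        case bottom
        have y: "4 * y \<le> 1" if "(x, y) \<in> C" for x y
        proof -
          have "4 * x \<le> 1 \<or> 4 * y \<le> 1 \<or> 4 * (1 - x - y) \<le> 1" "y \<le> x \<and> y \<le> 1 - x - y"
            using low bottom that by blast+
          then show ?thesis by argo
        qed
        from d8 show ?thesis
        proof
          assume "\<forall>x y. (x, y) \<in> C \<longrightarrow> 2 * y \<le> 1 - x - y"
          then show ?thesis
            using nonneg y bottom twist_regions(3) by (intro pieceI[of 1 1 1 0 0 0]) simp_all
        next
          assume "\<forall>x y. (x, y) \<in> C \<longrightarrow> 1 - x - y \<le> 2 * y"
          then show ?thesis
            using nonneg y bottom twist_regions(4) by (intro pieceI[of "-1" 4 "-5" 1 2 "-1"]) simp_all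
        qed
      next
        case slant
        have y: "4 * (1 - x - y) \<le> 1" if "(x, y) \<in> C" for x y
        proof -
          have "4 * x \<le> 1 \<or> 4 * y \<le> 1 \<or> 4 * (1 - x - y) \<le> 1" "1 - x - y \<le> x \<and> 1 - x - y \<le> y"
            using low slant that by blast+
          then show ?thesis by argo
        qed
        from d9 show ?thesis
        proof
          assume *: "\<forall>x y. (x, y) \<in> C \<longrightarrow> 2 * (1 - x - y) \<le> x"
          show ?thesis
          proof (rule pieceI[of 2 0 1 "-1" "-1" 1])
            fix x y assume "(x, y) \<in> C"
            then have "twist (x, y) = (2 * x + y - 1, 1 - x)"
              using nonneg y slant c0 * by (intro twist_regions(5)) blast+
            then show "twist (x, y) = (of_int 2 * x + of_int 1 * y + of_int (-1), of_int (-1) * x + of_int 0 * y + of_int 1)"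
              by simp
          qed simp
        next
          assume *: "\<forall>x y. (x, y) \<in> C \<longrightarrow> x \<le> 2 * (1 - x - y)"
          show ?thesis
          proof (rule pieceI[of "-1" 4 "-1" 5 1 "-3"])
            fix x y assume "(x, y) \<in> C"
            then have "twist (x, y) = (1 - x - y, 5 * x + 4 * y - 3)"
              using nonneg y slant c0 * by (intro twist_regions(6)) blast+
            then show "twist (x, y) = (of_int (-1) * x + of_int (-1) * y + of_int 1, of_int 5 * x + of_int 4 * y + of_int (-3))"
              by simp
          qed simp
        qed
      next
        case left
        have y: "4 * x \<le> 1" if "(x, y) \<in> C" for x y
        proof -
          have "4 * x \<le> 1 \<or> 4 * y \<le> 1 \<or> 4 * (1 - x - y) \<le> 1" "x \<le> y \<and> x \<le> 1 - x - y"
            using low left that by blast+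
          then show ?thesis by argo
        qed
        from d10 show ?thesis
        proof
          assume *: "\<forall>x y. (x, y) \<in> C \<longrightarrow> 2 * x \<le> y"
          show ?thesis
          proof (rule pieceI[of 1 1 0 "-1" 0 0])
            fix x y assume "(x, y) \<in> C"
            then have "twist (x, y) = (x, y - x)"
              using nonneg y left * by (intro twist_regions(7)) blast+
            then show "twist (x, y) = (of_int 1 * x + of_int 0 * y + of_int 0, of_int (-1) * x + of_int 1 * y + of_int 0)"
              by simp
          qed simp
        next
          assume *: "\<forall>x y. (x, y) \<in> C \<longrightarrow> y \<le> 2 * x"
          show ?thesis
          proof (rule pieceI[of 3 0 "-1" 1 0 0])
            fix x y assume "(x, y) \<in> C"
            then have "twist (x, y) = (3 * x - y, x)"
              using nonneg y left * by (intro twist_regions(8)) blast+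
            then show "twist (x, y) = (of_int 3 * x + of_int (-1) * y + of_int 0, of_int 1 * x + of_int 0 * y + of_int 0)"
              by simp
          qed simp
        qed
      qed
    qed
  qed
qed

text \<open>Exchanging x and y reverses the direction in which the boundaries are traversed, so it
  conjugates the twist into its inverse.\<close>

definition untwist :: "real \<times> real \<Rightarrow> real \<times> real" where
  "untwist z = prod.swap (twist (prod.swap z))"

lemma twist_swap_twist: "twist (prod.swap (twist z)) = prod.swap z"
  if "z \<in> square"
proof -
  obtain x y where z: "z = (x, y)" by (cases z)
  have xy: "0 \<le> x" "0 \<le> y" "x \<le> 1" "y \<le> 1" using that z by auto
  show ?thesis
  proof (cases rule: twist_cases[of x y])
    case outside
    have "twist (y, x) = (y, x)" by (rule twist_regions(1)) (use xy outside in argo)+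
    then show ?thesis using outside by (simp add: z)
  next
    case centre
    have "twist (x, 1 - x - y) = (1 - x - (1 - x - y), x)" by (rule twist_regions(2)) (use xy centre in argo)+
    then show ?thesis using centre by (simp add: z)
  next
    case bottom
    have "twist (y, x + y) = (y, (x + y) - y)" by (rule twist_regions(7)) (use xy bottom in argo)+
    then show ?thesis using bottom by (simp add: z)
  next
    case bottom_turn
    have "twist (x + 4 * y - 1, 2 - x - 5 * y) = (1 - (x + 4 * y - 1) - (2 - x - 5 * y), 5 * (x + 4 * y - 1) + 4 * (2 - x - 5 * y) - 3)"
      by (rule twist_regions(6)) (use xy bottom_turn in argo)+
    then show ?thesis using bottom_turn by (simp add: z)
  next
    case slant
    have "twist (1 - x, 2 * x + y - 1) = (2 * (1 - x) + (2 * x + y - 1) - 1, 1 - (1 - x))"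
      by (rule twist_regions(5)) (use xy slant in argo)+
    then show ?thesis using slant by (simp add: z)
  next
    case slant_turn
    have "twist (5 * x + 4 * y - 3, 1 - x - y) = (2 - (5 * x + 4 * y - 3) - 5 * (1 - x - y), 5 * x + 4 * y - 3 + 4 * (1 - x - y) - 1)"
      by (rule twist_regions(4)) (use xy slant_turn in argo)+
    then show ?thesis using slant_turn by (simp add: z)
  next
    case left
    have "twist (y - x, x) = (y - x + x, x)"
      by (rule twist_regions(3)) (use xy left in argo)+
    then show ?thesis using left by (simp add: z)
  next
    case left_turn
    have "twist (x, 3 * x - y) = (3 * (x) - (3 * x - y), x)"
      by (rule twist_regions(8)) (use xy left_turn in argo)+
    then show ?thesis using left_turn by (simp add: z)
  qed
qed

lemma twist_square: "z \<in> square \<Longrightarrow> twist z \<in> square"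
proof -
  assume z: "z \<in> square"
  obtain x y where xy: "z = (x, y)" by (cases z)
  have b: "0 \<le> x" "0 \<le> y" "x \<le> 1" "y \<le> 1" using z xy by auto
  have in_square: "w \<in> square" if "w = (u, v)" "0 \<le> u \<and> u \<le> 1 \<and> 0 \<le> v \<and> v \<le> 1" for w :: "real \<times> real" and u v
    using that by simp
  show "twist z \<in> square"
    unfolding xy by (cases rule: twist_cases[of x y]; erule in_square; insert b; argo)
qed

lemma untwist_square: "z \<in> square \<Longrightarrow> untwist z \<in> square"
  using twist_square[of "prod.swap z"] by (auto simp: untwist_def mem_Times_iff)

lemma untwist_twist: "z \<in> square \<Longrightarrow> untwist (twist z) = z"
  by (simp add: untwist_def twist_swap_twist)

lemma twist_untwist:
  assumes z: "z \<in> square"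
  shows "twist (untwist z) = z"
proof -
  have "prod.swap z \<in> square" using z by (auto simp: mem_Times_iff)
  from twist_swap_twist[OF this] show ?thesis by (simp add: untwist_def)
qed

lemma continuous_on_untwist: "continuous_on square untwist"
proof -
  have "continuous_on square (prod.swap :: real \<times> real \<Rightarrow> _)"
    by (simp add: continuous_on_swap)
  moreover have "continuous_on square (\<lambda>z. twist (prod.swap z))"
    by (rule continuous_on_compose2[OF piecewise_continuous_on[OF piecewise_twist]])
       (auto simp: continuous_on_swap)
  ultimately show ?thesis
    unfolding untwist_def by (intro continuous_on_swap_args continuous_on_compose2[OF continuous_on_swap[of UNIV]]) auto
qed

lemma piecewise_affine_map: "p * s - q * r = d \<Longrightarrow> piecewise d (affine_map p q r s c e) {}"
  unfolding piecewise_def by blast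

lemma flip_eq_affine_map:
  "flip1 = affine_map (-1) 0 0 1 1 0" "flip2 = affine_map 1 0 0 (-1) 0 1"
  by (auto simp: flip1_def flip2_def affine_map_def fun_eq_iff)

lemma flip_square: "flip1 ` square \<subseteq> square" "flip2 ` square \<subseteq> square"
  by (auto simp: flip1_def flip2_def)

theorem mcnaughton_homeomorphisms:
  assumes "i < n" "j < n" "i \<noteq> j"
  shows "mcnaughton_homeomorphism n (lift2 i j twist)"
    and "mcnaughton_homeomorphism n (lift2 i j flip1)"
    and "mcnaughton_homeomorphism n (lift2 i j flip2)"
proof -
  show "mcnaughton_homeomorphism n (lift2 i j twist)"
    by (rule mcnaughton_homeomorphism_lift2[OF assms piecewise_twist _ _ _ continuous_on_untwist])
       (auto simp: twist_square untwist_square untwist_twist twist_untwist image_subset_iff simp del: mem_Sigma_iff)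
  have "piecewise (-1) flip1 {}" "piecewise (-1) flip2 {}"
    unfolding flip_eq_affine_map by (rule piecewise_affine_map; simp)+
  then show "mcnaughton_homeomorphism n (lift2 i j flip1)" "mcnaughton_homeomorphism n (lift2 i j flip2)"
    using mcnaughton_homeomorphism_lift2[OF assms _ _ _ _ piecewise_continuous_on] flip_square by (metis flip_flip)+
qed

section \<open>Measures on the cube\<close>

lemma aff_continuous_on: "continuous_on S (aff n a)"
  unfolding aff_def
  by (intro continuous_intros continuous_on_subset[OF continuous_on_product_coordinates]) simp

lemma aff_measurable [measurable]: "aff n a \<in> borel_measurable borel"
  by (rule borel_measurable_continuous_onI) (rule aff_continuous_on)

lemma coordinate_measurable [measurable]: "(\<lambda>x :: nat \<Rightarrow> real. x k) \<in> borel_measurable borel"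
  by (rule borel_measurable_continuous_onI) (rule continuous_on_product_coordinates)

lemma aff_shift: "aff n (a(n := a n + k)) x = aff n a x + of_int k"
  by (simp add: aff_def)

definition truncated :: "nat \<Rightarrow> (nat \<Rightarrow> int) \<Rightarrow> (nat \<Rightarrow> real) \<Rightarrow> real" where
  "truncated n a x = min 1 \<bar>aff n a x\<bar>"

text \<open>Shifting the constant term by 1 either way adds the hyperplanes where the form is 1 or
  -1; on every cell the function is then the form, its negative or the constant 1.\<close>

lemma mcnaughton_truncated: "mcnaughton_function n (truncated n a)"
  unfolding mcnaughton_function_def
proof (intro conjI)
  show "continuous_on (cube n) (truncated n a)"
    unfolding truncated_def by (intro continuous_intros aff_continuous_on)
  show "truncated n a ` cube n \<subseteq> {0..1}" by (auto simp: truncated_def)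
  let ?A = "{a, a(n := a n + (-1)), a(n := a n + 1)}"
  obtain W where W: "rational_polyhedral_complex n W" "\<Union>W = cube n"
    and sgn: "\<And>C b. C \<in> W \<Longrightarrow> b \<in> ?A \<Longrightarrow> (\<forall>x\<in>C. 0 \<le> aff n b x) \<or> (\<forall>x\<in>C. aff n b x \<le> 0)"
    using arrangement_complex[of ?A n] by blast
  have "\<exists>b. \<forall>x\<in>C. truncated n a x = (\<Sum>i<n. of_int (b i) * x i) + of_int (b n)" if C: "C \<in> W" for C
  proof -
    have low: "(\<forall>x\<in>C. 1 \<le> aff n a x) \<or> (\<forall>x\<in>C. aff n a x \<le> 1)"
      using sgn[OF C, of "a(n := a n + (-1))"] unfolding aff_shift by simp
    have high: "(\<forall>x\<in>C. -1 \<le> aff n a x) \<or> (\<forall>x\<in>C. aff n a x \<le> -1)"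
      using sgn[OF C, of "a(n := a n + 1)"] unfolding aff_shift by force
    have zero: "(\<forall>x\<in>C. 0 \<le> aff n a x) \<or> (\<forall>x\<in>C. aff n a x \<le> 0)"
      using sgn[OF C, of a] by simp
    have one: "aff n (\<lambda>k. if k = n then 1 else 0) x = 1" for x by (simp add: aff_def)
    consider (a) "\<forall>x\<in>C. 0 \<le> aff n a x \<and> aff n a x \<le> 1" | (b) "\<forall>x\<in>C. -1 \<le> aff n a x \<and> aff n a x \<le> 0"
      | (c) "\<forall>x\<in>C. 1 \<le> \<bar>aff n a x\<bar>"
    proof -
      from zero show thesis
      proof
        assume z: "\<forall>x\<in>C. 0 \<le> aff n a x"
        from low show thesis
        proof
          assume "\<forall>x\<in>C. 1 \<le> aff n a x"
          then show thesis by (intro that(3)) force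
        qed (use z that(1) in blast)
      next
        assume z: "\<forall>x\<in>C. aff n a x \<le> 0"
        from high show thesis
        proof
          assume "\<forall>x\<in>C. aff n a x \<le> -1"
          then show thesis by (intro that(3)) force
        qed (use z that(2) in blast)
      qed
    qed
    then have "\<exists>b. \<forall>x\<in>C. truncated n a x = aff n b x"
    proof cases
      case a then show ?thesis by (intro exI[of _ a]) (simp add: truncated_def)
    next
      case b then show ?thesis by (intro exI[of _ "\<lambda>i. - a i"]) (force simp: truncated_def aff_uminus)
    next
      case c then show ?thesis
        by (intro exI[of _ "\<lambda>k. if k = n then 1 else 0"]) (simp add: truncated_def one)
    qed
    then show ?thesis by (simp add: aff_def)
  qed
  then show "\<exists>W. rational_polyhedral_complex n W \<and> \<Union>W = cube n \<and>
        (\<forall>C\<in>W. has_aff_dim C n \<longrightarrow>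
           (\<exists>b :: nat \<Rightarrow> int. \<forall>x\<in>C. truncated n a x = (\<Sum>i<n. of_int (b i) * x i) + of_int (b n)))"
    using W by blast
qed

text \<open>A function disjoint from this one vanishes off the hyperplane. Each point of the cube on
  the hyperplane is a limit, along the segment towards y, of points off it, so continuity
  finishes.\<close>

lemma pseudotrue_truncated:
  assumes y: "y \<in> cube n" "aff n a y \<noteq> 0"
  shows "pseudotrue n (truncated n a)"
  unfolding pseudotrue_def
proof (intro conjI allI impI ballI mcnaughton_truncated)
  fix g x
  assume g: "mcnaughton_function n g \<and> (\<forall>x\<in>cube n. mv_wedge (truncated n a) g x = 0)" and x: "x \<in> cube n"
  have cont: "continuous_on (cube n) g" and nonneg: "\<And>x. x \<in> cube n \<Longrightarrow> 0 \<le> g x"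
    using g by (auto simp: mcnaughton_function_def image_subset_iff)
  have off: "g z = 0" if "z \<in> cube n" "aff n a z \<noteq> 0" for z
  proof -
    have "min (min 1 \<bar>aff n a z\<bar>) (g z) = 0"
      using g that(1) by (auto simp: mv_wedge_def truncated_def)
    then show ?thesis using that(2) by (auto simp: min_def split: if_splits)
  qed
  show "g x = 0"
  proof (cases "aff n a x = 0")
    case False
    then show ?thesis using off x by blast
  next
    case True
    define \<gamma> where "\<gamma> t = (1 - t) *\<^sub>R x + t *\<^sub>R y" for t :: real
    have \<gamma>: "\<gamma> t \<in> cube n" if "0 \<le> t" "t \<le> 1" for t
      unfolding \<gamma>_def by (rule cube_combination) (use x y that in auto)
    have "continuous_on {0..1} \<gamma>"
      unfolding \<gamma>_def
      by (rule continuous_on_coordinatewise_then_product) (auto intro!: continuous_intros)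
    then have c: "continuous_on {0..1} (\<lambda>t. g (\<gamma> t))"
      by (rule continuous_on_compose2[OF cont]) (use \<gamma> in auto)
    have "(\<lambda>k. g (\<gamma> (inverse (real (Suc k))))) \<longlonglongrightarrow> g (\<gamma> 0)"
      by (rule continuous_on_tendsto_compose[OF c LIMSEQ_inverse_real_of_nat])
         (auto simp: field_simps)
    moreover have "g (\<gamma> (inverse (real (Suc k)))) = 0" for k
    proof (rule off)
      let ?t = "inverse (real (Suc k))"
      have t: "0 < ?t" "?t \<le> 1" by (auto simp: field_simps)
      then show "\<gamma> ?t \<in> cube n" by (intro \<gamma>) auto
      have "aff n a (\<gamma> ?t) = (1 - ?t) * aff n a x + ?t * aff n a y"
        unfolding \<gamma>_def by (rule aff_combination) simp
      then show "aff n a (\<gamma> ?t) \<noteq> 0" using True y(2) t by simp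
    qed
    ultimately have "(\<lambda>k. 0 :: real) \<longlonglongrightarrow> g (\<gamma> 0)" by simp
    then have "g (\<gamma> 0) = 0" using LIMSEQ_unique[OF _ tendsto_const] by blast
    then show ?thesis by (simp add: \<gamma>_def)
  qed
qed

section \<open>Total mass and null hyperplanes\<close>

locale cube_measure =
  fixes n :: nat and M :: "(nat \<Rightarrow> real) measure"
  assumes borel: "borel_measure_on_cube n M"
    and invariant: "automorphism_invariant n M"
    and detects: "detects_pseudotruths n M"
begin

lemma sets_M: "sets M = sets (restrict_space borel (cube n))"
  using borel by (simp add: borel_measure_on_cube_def)

lemma space_M: "space M = cube n"
  using sets_eq_imp_space_eq[OF sets_M] by (simp add: space_restrict_space)

lemma Int_cube_sets: "X \<in> sets borel \<Longrightarrow> X \<inter> cube n \<in> sets M"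
  unfolding sets_M sets_restrict_space by (auto simp: Int_commute)

lemma measurable_M: "f \<in> borel \<rightarrow>\<^sub>M N \<Longrightarrow> f \<in> M \<rightarrow>\<^sub>M N"
  using measurable_restrict_space1 measurable_cong_sets[OF sets_M refl] by blast

lemma sup_integral_truncated:
  assumes "y \<in> cube n" "aff n a y \<noteq> 0"
  shows "(SUP k\<in>{1..}. \<integral>\<^sup>+x. ennreal (min 1 (real k * truncated n a x)) \<partial>M) = 1"
proof -
  have mv: "mv_multiple k (truncated n a) = (\<lambda>x. min 1 (real k * truncated n a x))" for k
    by (rule ext, rule mv_multiple_eq) (simp add: truncated_def)
  have "(SUP k\<in>{1..}. \<integral>\<^sup>+x. ennreal (mv_multiple k (truncated n a) x) \<partial>M) = 1"
    using detects pseudotrue_truncated[OF assms] unfolding detects_pseudotruths_def by blast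
  then show ?thesis unfolding mv .
qed

lemma cube_nonempty: "(\<lambda>i. if i < n then 0 else undefined) \<in> cube n"
  by (simp add: cube_iff)

text \<open>The constant 1 is pseudotrue and equals all its multiples, so detection returns the
  total mass.\<close>

lemma emeasure_cube: "emeasure M (cube n) = 1"
proof -
  let ?a = "\<lambda>k. if k = n then 1 else 0 :: int"
  have one: "aff n ?a x = 1" for x by (simp add: aff_def)
  have "(SUP k\<in>{1..}. \<integral>\<^sup>+x. ennreal (min 1 (real k * truncated n ?a x)) \<partial>M) = 1"
    by (rule sup_integral_truncated[OF cube_nonempty]) (simp only: one)
  also have "(SUP k\<in>{1..}. \<integral>\<^sup>+x. ennreal (min 1 (real k * truncated n ?a x)) \<partial>M) =
      (SUP k\<in>{1 :: nat..}. emeasure M (space M))"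
    by (rule SUP_cong) (auto simp: truncated_def one min_def)
  finally show ?thesis by (simp add: space_M)
qed

sublocale finite_measure M
  by (rule finite_measureI) (simp add: space_M emeasure_cube)

text \<open>Every multiple of the truncated form is bounded by the indicator of the complement of
  the hyperplane. Detection forces this complement to have mass at least one, which is all the mass
  there is.\<close>

lemma hyperplane_null:
  assumes "k < n" "a k \<noteq> 0"
  shows "AE x in M. aff n a x \<noteq> 0"
proof -
  let ?o = "\<lambda>i. if i < n then 0 else undefined :: real"
  let ?e = "?o(k := 1)"
  \<comment> \<open>The origin serves if the constant term is nonzero, and the k-th unit vector
    otherwise.\<close>
  have "\<exists>y\<in>cube n. aff n a y \<noteq> 0"
  proof (cases "a n = 0")
    case True
    have "(\<Sum>i<n. of_int (a i) * ?e i) = (\<Sum>i\<in>{k}. of_int (a i) * ?e i)"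
      by (rule sum.mono_neutral_right) (use assms in auto)
    then have "aff n a ?e \<noteq> 0" using True assms by (simp add: aff_def)
    moreover have "?e \<in> cube n" using assms by (auto simp: cube_iff)
    ultimately show ?thesis by blast
  next
    case False
    then have "aff n a ?o \<noteq> 0" by (simp add: aff_def)
    then show ?thesis using cube_nonempty by blast
  qed
  then obtain y where y: "y \<in> cube n" "aff n a y \<noteq> 0" by blast
  let ?N = "{x. aff n a x = 0} \<inter> cube n" and ?P = "{x. aff n a x \<noteq> 0} \<inter> cube n"
  have sets: "?N \<in> sets M" "?P \<in> sets M"
    by (intro Int_cube_sets; measurable)+
  have "(\<integral>\<^sup>+x. ennreal (min 1 (real k * truncated n a x)) \<partial>M) \<le> emeasure M ?P" for k
  proof -
    have "(\<integral>\<^sup>+x. ennreal (min 1 (real k * truncated n a x)) \<partial>M) \<le> (\<integral>\<^sup>+x. indicator ?P x \<partial>M)"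
      by (rule nn_integral_mono) (auto simp: space_M truncated_def indicator_def)
    then show ?thesis using sets by simp
  qed
  then have "1 \<le> emeasure M ?P"
    unfolding sup_integral_truncated[OF y, symmetric] by (intro SUP_least) auto
  moreover have "emeasure M ?N + emeasure M ?P = 1"
  proof -
    have "emeasure M ?N + emeasure M ?P = emeasure M (?N \<union> ?P)"
      by (rule plus_emeasure) (use sets in auto)
    also have "?N \<union> ?P = cube n" by auto
    finally show ?thesis by (simp add: emeasure_cube)
  qed
  ultimately have "1 \<le> measure M ?P" "measure M ?N + measure M ?P = 1"
    by (simp_all add: emeasure_eq_measure flip: ennreal_plus ennreal_1)
  then have "measure M ?N = 0" using measure_nonneg[of M ?N] by linarith
  then have "emeasure M ?N = 0" by (simp add: emeasure_eq_measure)
  then show ?thesis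
    using sets by (intro AE_I'[of ?N]) (auto simp: space_M null_sets_def)
qed

text \<open>Clearing the denominator s turns each rational value r / s into an integral hyperplane,
  and there are countably many of these.\<close>

lemma AE_irrational_combination:
  fixes p q :: int
  assumes ij: "i < n" "j < n" "i \<noteq> j" and pq: "p \<noteq> 0 \<or> q \<noteq> 0"
  shows "AE x in M. of_int p * x i + of_int q * x j \<notin> \<rat>"
proof -
  define a where "a = (\<lambda>(r, s) k. if k = i then s * p else if k = j then s * q else if k = n then - r else 0 :: int)"
  have a: "aff n (a (r, s)) x = of_int s * (of_int p * x i + of_int q * x j) - of_int r" for r s x
  proof -
    have "(\<Sum>k<n. of_int (a (r, s) k) * x k) = (\<Sum>k\<in>{i, j}. of_int (a (r, s) k) * x k)"
      by (rule sum.mono_neutral_right) (use ij in \<open>auto simp: a_def\<close>)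
    then show ?thesis using ij by (simp add: aff_def a_def algebra_simps)
  qed
  have "AE x in M. \<forall>t. snd t \<noteq> 0 \<longrightarrow> aff n (a t) x \<noteq> 0"
    unfolding AE_all_countable
  proof
    fix t :: "int \<times> int"
    obtain r s where t: "t = (r, s)" by (cases t)
    show "AE x in M. snd t \<noteq> 0 \<longrightarrow> aff n (a t) x \<noteq> 0"
    proof (cases "s = 0")
      case True then show ?thesis by (simp add: t)
    next
      case False
      have "\<exists>k<n. a t k \<noteq> 0"
      proof (cases "p = 0")
        case True
        then have "a t j \<noteq> 0" using False pq ij by (simp add: a_def t)
        then show ?thesis using ij by blast
      next
        case pn: False
        then have "a t i \<noteq> 0" using False by (simp add: a_def t)
        then show ?thesis using ij by blast
      qed
      then obtain k where "k < n" "a t k \<noteq> 0" by blast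
      from hyperplane_null[of k "a t", OF this] show ?thesis by eventually_elim simp
    qed
  qed
  then show ?thesis
  proof eventually_elim
    case (elim x)
    show ?case
    proof
      assume "of_int p * x i + of_int q * x j \<in> \<rat>"
      then obtain r s where rs: "s > 0" "of_int p * x i + of_int q * x j = of_int r / of_int s"
        by (rule Rats_cases') blast
      then have "aff n (a (r, s)) x = 0" unfolding a by simp
      then show False using elim rs(1) by (metis less_irrefl snd_conv)
    qed
  qed
qed

section \<open>Two coordinates conditioned on the others\<close>

definition cylinder :: "nat \<Rightarrow> nat \<Rightarrow> (nat \<Rightarrow> real) set \<Rightarrow> bool" where
  "cylinder i j E \<longleftrightarrow> E \<in> sets borel \<and> (\<forall>x u v. x(i := u, j := v) \<in> E \<longleftrightarrow> x \<in> E)"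

text \<open>The joint distribution of two coordinates on the event E, not normalised: its total mass
  is that of E, from which independence will be read off.\<close>

definition shadow :: "nat \<Rightarrow> nat \<Rightarrow> (nat \<Rightarrow> real) set \<Rightarrow> (real \<times> real) measure" where
  "shadow i j E = distr (density M (indicator (E \<inter> cube n))) borel (\<lambda>x. (x i, x j))"

lemma pair_measurable [measurable]: "(\<lambda>x :: nat \<Rightarrow> real. (x i, x j)) \<in> borel \<rightarrow>\<^sub>M borel"
  unfolding borel_prod[symmetric] by measurable

lemma emeasure_shadow:
  assumes E: "E \<in> sets borel" and B: "B \<in> sets borel"
  shows "emeasure (shadow i j E) B = emeasure M {x \<in> cube n. x \<in> E \<and> (x i, x j) \<in> B}"
proof -
  have m: "(\<lambda>x. (x i, x j)) \<in> M \<rightarrow>\<^sub>M borel" by (rule measurable_M) measurable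
  have B': "(\<lambda>x. (x i, x j)) -` B \<inter> space M \<in> sets M" by (rule measurable_sets[OF m B])
  have "emeasure (shadow i j E) B =
      emeasure (density M (indicator (E \<inter> cube n))) ((\<lambda>x. (x i, x j)) -` B \<inter> space M)"
    unfolding shadow_def using m B by (subst emeasure_distr) simp_all
  also have "\<dots> = emeasure M ((E \<inter> cube n) \<inter> ((\<lambda>x. (x i, x j)) -` B \<inter> space M))"
    by (rule emeasure_restricted[OF Int_cube_sets[OF E] B'])
  also have "(E \<inter> cube n) \<inter> ((\<lambda>x. (x i, x j)) -` B \<inter> space M) = {x \<in> cube n. x \<in> E \<and> (x i, x j) \<in> B}"
    by (auto simp: space_M)
  finally show ?thesis .
qed

lemma AE_shadow:
  assumes E: "E \<in> sets borel" and P: "{z. P z} \<in> sets borel" and ae: "AE x in M. P (x i, x j)"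
  shows "AE z in shadow i j E. P z"
proof -
  have m: "(\<lambda>x. (x i, x j)) \<in> density M (indicator (E \<inter> cube n)) \<rightarrow>\<^sub>M borel"
    using measurable_M[OF pair_measurable] by simp
  have "AE x in density M (indicator (E \<inter> cube n)). P (x i, x j)"
    using Int_cube_sets[OF E] ae by (subst AE_density) (auto intro: borel_measurable_indicator)
  then show ?thesis
    unfolding shadow_def using P by (subst AE_distr_iff[OF m]) auto
qed

lemma generic_measurable: "{z. generic z} \<in> sets borel"
proof -
  have Q: "(\<rat> :: real set) \<in> sets borel" by (rule sets.countable[OF _ countable_rat]) simp
  have *: "{z. f z \<notin> \<rat>} \<in> sets borel" if "f \<in> borel_measurable borel" for f :: "real \<times> real \<Rightarrow> real"
  proof -
    have "f -` (- \<rat>) \<inter> space borel \<in> sets borel"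
      by (rule measurable_sets[OF that]) (rule borel_comp[OF Q])
    then show ?thesis by (simp add: vimage_def)
  qed
  have "{z. generic z} = {z. fst z \<notin> \<rat>} \<inter> {z. snd z \<notin> \<rat>} \<inter> {z. fst z + snd z \<notin> \<rat>} \<inter> {z. fst z - snd z \<notin> \<rat>}"
    by (auto simp: generic_def)
  also have "\<dots> \<in> sets borel"
    by (intro sets.Int * borel_measurable_continuous_onI continuous_intros)
  finally show ?thesis .
qed

text \<open>A lifted map changes only the coordinates i and j, hence preserves the cylinder E, and
  invariance of M passes to the restricted marginal.\<close>

lemma planar_invariant_shadow:
  assumes ij: "i < n" "j < n" "i \<noteq> j" and cyl: "cylinder i j E"
  shows "planar_invariant (shadow i j E)"
proof (intro planar_invariant.intro planar_invariant_axioms.intro)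
  have E: "E \<in> sets borel" and upd: "\<And>x u v. x(i := u, j := v) \<in> E \<longleftrightarrow> x \<in> E"
    using cyl by (auto simp: cylinder_def)
  show sets: "sets (shadow i j E) = sets borel" by (simp add: shadow_def)
  show "finite_measure (shadow i j E)"
    by (rule finite_measureI) (simp add: emeasure_shadow[OF E] sets_eq_imp_space_eq[OF sets])
  show "AE z in shadow i j E. z \<in> square"
  proof (rule AE_shadow[OF E])
    have "square \<in> sets borel" by (intro borel_closed closed_Times closed_atLeastAtMost)
    then show "{z. z \<in> square} \<in> sets borel" by simp
    show "AE x in M. (x i, x j) \<in> square"
      by (rule AE_I2) (use ij in \<open>simp add: space_M cube_iff\<close>)
  qed
  show "AE z in shadow i j E. generic z"
  proof (rule AE_shadow[OF E generic_measurable])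
    show "AE x in M. generic (x i, x j)"
      using AE_irrational_combination[OF ij, of 1 0] AE_irrational_combination[OF ij, of 0 1]
        AE_irrational_combination[OF ij, of 1 1] AE_irrational_combination[OF ij, of 1 "-1"]
      by (simp, elim AE_mp) (auto simp: generic_def)
  qed
  have inv: "emeasure (shadow i j E) (f -` B) = emeasure (shadow i j E) B"
    if f: "mcnaughton_homeomorphism n (lift2 i j f)" "f \<in> borel \<rightarrow>\<^sub>M borel" "f ` square \<subseteq> square"
      and B: "B \<in> sets borel" for f B
  proof -
    let ?X = "{x \<in> cube n. x \<in> E \<and> (x i, x j) \<in> B}"
    have "(\<lambda>x. (x i, x j)) -` B \<in> sets (borel :: (nat \<Rightarrow> real) measure)"
      using measurable_sets[OF pair_measurable B] by simp
    then have "(E \<inter> (\<lambda>x. (x i, x j)) -` B) \<inter> cube n \<in> sets M"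
      by (intro Int_cube_sets sets.Int E)
    moreover have "?X = (E \<inter> (\<lambda>x. (x i, x j)) -` B) \<inter> cube n" by auto
    ultimately have X: "?X \<in> sets (restrict_space borel (cube n))" by (simp only: sets_M)
    have "lift2 i j f -` ?X \<inter> cube n = {x \<in> cube n. x \<in> E \<and> (x i, x j) \<in> f -` B}"
    proof (rule Set.set_eqI)
      fix x
      have "lift2 i j f x \<in> cube n" if "x \<in> cube n" using lift2_cube[OF ij(1,2) f(3) that] .
      moreover have "lift2 i j f x \<in> E \<longleftrightarrow> x \<in> E" unfolding lift2_def by (rule upd)
      moreover have "(lift2 i j f x i, lift2 i j f x j) = f (x i, x j)"
        using ij(3) by (simp add: lift2_def)
      ultimately show "x \<in> lift2 i j f -` ?X \<inter> cube n \<longleftrightarrow> x \<in> {x \<in> cube n. x \<in> E \<and> (x i, x j) \<in> f -` B}"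
        by (simp only: vimage_eq Int_iff mem_Collect_eq) blast
    qed
    moreover have "emeasure M (lift2 i j f -` ?X \<inter> cube n) = emeasure M ?X"
      using invariant f(1) X unfolding automorphism_invariant_def by blast
    moreover have "f -` B \<in> sets borel" using measurable_sets[OF f(2) B] by simp
    ultimately show ?thesis by (simp add: emeasure_shadow[OF E] B)
  qed
  fix B :: "(real \<times> real) set" assume B: "B \<in> sets borel"
  show "emeasure (shadow i j E) (twist -` B) = emeasure (shadow i j E) B"
    by (rule inv[OF mcnaughton_homeomorphisms(1)[OF ij] twist_measurable _ B])
       (use twist_square in blast)
  show "emeasure (shadow i j E) (flip1 -` B) = emeasure (shadow i j E) B"
    by (rule inv[OF mcnaughton_homeomorphisms(2)[OF ij] flip_measurable(1) flip_square(1) B])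
  show "emeasure (shadow i j E) (flip2 -` B) = emeasure (shadow i j E) B"
    by (rule inv[OF mcnaughton_homeomorphisms(3)[OF ij] flip_measurable(2) flip_square(2) B])
qed

lemma emeasure_cylinder:
  assumes ij: "i < n" "j < n" "i \<noteq> j" and cyl: "cylinder i j E"
    and A: "A \<in> sets borel" and B: "B \<in> sets borel"
  shows "emeasure M {x \<in> cube n. x \<in> E \<and> x i \<in> A \<and> x j \<in> B} =
    emeasure M {x \<in> cube n. x \<in> E} * (emeasure lborel (A \<inter> {0..1}) * emeasure lborel (B \<inter> {0..1}))"
proof -
  interpret planar_invariant "shadow i j E" by (rule planar_invariant_shadow[OF ij cyl])
  have E: "E \<in> sets borel" using cyl by (simp add: cylinder_def)
  have AB: "A \<times> B \<in> sets borel" by (rule borel_Times[OF A B])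
  have "emeasure lborel ((A \<times> B) \<inter> square) = emeasure (lborel \<Otimes>\<^sub>M lborel) ((A \<inter> {0..1}) \<times> (B \<inter> {0..1}))"
    unfolding lborel_prod by (rule arg_cong[where f = "emeasure lborel"]) auto
  also have "\<dots> = emeasure lborel (A \<inter> {0..1}) * emeasure lborel (B \<inter> {0..1})"
    by (rule lborel.emeasure_pair_measure_Times) (use A B in auto)
  finally show ?thesis
    using eq_lborel[OF AB] by (simp add: emeasure_shadow[OF E] AB)
qed

text \<open>Two coordinates are split off at a time, the preceding ones forming the cylinder. An odd
  m ends at a single coordinate, which is paired with an unconstrained second one; this is possible
  since n \<ge> 2.\<close>

lemma emeasure_box:
  assumes n: "2 \<le> n" and B: "\<And>k. B k \<in> sets borel"
  shows "m \<le> n \<Longrightarrow> emeasure M {x \<in> cube n. \<forall>k<m. x k \<in> B k} = (\<Prod>k<m. emeasure lborel (B k \<inter> {0..1}))"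
proof (induction m rule: less_induct)
  case (less m)
  have box: "{x. \<forall>k<l. x k \<in> B k} \<in> sets (borel :: (nat \<Rightarrow> real) measure)" for l
  proof -
    have "(\<lambda>x :: nat \<Rightarrow> real. x k) -` B k \<inter> space borel \<in> sets borel" for k
      by (rule measurable_sets[OF coordinate_measurable B])
    then have "{x :: nat \<Rightarrow> real. x k \<in> B k} \<in> sets borel" for k by (simp add: vimage_def)
    then have "{x \<in> space borel. \<forall>k\<in>{..<l}. x k \<in> B k} \<in> sets (borel :: (nat \<Rightarrow> real) measure)"
      by (intro sets.sets_Collect_finite_All) auto
    moreover have "{x \<in> space borel. \<forall>k\<in>{..<l}. x k \<in> B k} = {x. \<forall>k<l. x k \<in> B k}"
      by (auto simp: lessThan_iff)
    ultimately show ?thesis by (simp only:)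
  qed
  have "m = 0 \<or> m = 1 \<or> m = Suc (Suc (m - 2))" by arith
  then consider "m = 0" | "m = 1" | l where "m = Suc (Suc l)" by blast
  then show ?case
  proof cases
    case 1
    then show ?thesis using emeasure_cube by simp
  next
    case 2
    have cyl: "cylinder 0 1 UNIV" by (simp add: cylinder_def)
    have "emeasure M {x \<in> cube n. x \<in> UNIV \<and> x 0 \<in> B 0 \<and> x 1 \<in> UNIV} =
        emeasure M {x \<in> cube n. x \<in> UNIV} * (emeasure lborel (B 0 \<inter> {0..1}) * emeasure lborel (UNIV \<inter> {0..1 :: real}))"
      by (rule emeasure_cylinder[OF _ _ _ cyl B]) (use n in simp_all)
    moreover have "{x \<in> cube n. \<forall>k<m. x k \<in> B k} = {x \<in> cube n. x \<in> UNIV \<and> x 0 \<in> B 0 \<and> x 1 \<in> UNIV}"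
      using 2 by auto
    moreover have "{x \<in> cube n. x \<in> UNIV} = cube n" by auto
    moreover have "emeasure lborel (UNIV \<inter> {0..1 :: real}) = 1" by simp
    moreover have "(\<Prod>k<m. emeasure lborel (B k \<inter> {0..1})) = emeasure lborel (B 0 \<inter> {0..1})"
      using 2 by simp
    ultimately show ?thesis by (simp only: emeasure_cube mult_1_left mult_1_right)
  next
    case 3
    let ?E = "{x. \<forall>k<l. x k \<in> B k}"
    have "cylinder l (Suc l) ?E"
      unfolding cylinder_def mem_Collect_eq
    proof (intro conjI allI box)
      fix x :: "nat \<Rightarrow> real" and u v :: real
      have "(x(l := u, Suc l := v)) k = x k" if "k < l" for k using that by simp
      then show "(\<forall>k<l. (x(l := u, Suc l := v)) k \<in> B k) \<longleftrightarrow> (\<forall>k<l. x k \<in> B k)" by metis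
    qed
    then have "emeasure M {x \<in> cube n. x \<in> ?E \<and> x l \<in> B l \<and> x (Suc l) \<in> B (Suc l)} =
        emeasure M {x \<in> cube n. x \<in> ?E} * (emeasure lborel (B l \<inter> {0..1}) * emeasure lborel (B (Suc l) \<inter> {0..1}))"
      by (rule emeasure_cylinder[OF _ _ _ _ B B, rotated 3]) (use less.prems 3 in simp_all)
    moreover have "{x \<in> cube n. \<forall>k<m. x k \<in> B k} = {x \<in> cube n. x \<in> ?E \<and> x l \<in> B l \<and> x (Suc l) \<in> B (Suc l)}"
      unfolding 3 by (auto simp: less_Suc_eq)
    moreover have "emeasure M {x \<in> cube n. x \<in> ?E} = (\<Prod>k<l. emeasure lborel (B k \<inter> {0..1}))"
      unfolding mem_Collect_eq by (rule less.IH) (use less.prems 3 in simp_all)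
    moreover have "(\<Prod>k<m. emeasure lborel (B k \<inter> {0..1})) = (\<Prod>k<l. emeasure lborel (B k \<inter> {0..1})) *
        (emeasure lborel (B l \<inter> {0..1}) * emeasure lborel (B (Suc l) \<inter> {0..1}))"
      unfolding 3 by (simp add: mult.assoc)
    ultimately show ?thesis by (simp only:)
  qed
qed

end

text \<open>Transported by the identity to the product space, M becomes a finite measure that agrees
  with restricted Lebesgue measure on product boxes, and boxes determine it.\<close>

lemma eq_lebesgue_cubeI:
  assumes M: "borel_measure_on_cube n M"
    and box: "\<And>B. (\<And>k. B k \<in> sets borel) \<Longrightarrow>
      emeasure M {x \<in> cube n. \<forall>k<n. x k \<in> B k} = (\<Prod>k<n. emeasure lborel (B k \<inter> {0..1}))"
  shows "M = lebesgue_cube n"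
proof (rule measure_eqI)
  let ?P = "(\<Pi>\<^sub>M i\<in>{..<n}. lborel) :: (nat \<Rightarrow> real) measure"
  have sub: "cube n \<subseteq> space ?P" by (auto simp: cube_def space_PiM PiE_def Pi_def)
  have cubeP: "cube n \<in> sets ?P" unfolding cube_def by (rule sets_PiM_I_finite) auto
  have setsM: "sets M = sets (lebesgue_cube n)"
    using M borel_measure_on_cube_lebesgue_cube[of n] by (simp add: borel_measure_on_cube_def)
  then show "sets M = sets (lebesgue_cube n)" .
  have spaceM: "space M = cube n"
    using sets_eq_imp_space_eq[OF setsM] sub by (simp add: lebesgue_cube_def space_restrict_space Int_absorb2)
  have "(\<lambda>x. x) \<in> lebesgue_cube n \<rightarrow>\<^sub>M ?P"
    unfolding lebesgue_cube_def by (rule measurable_restrict_space1) simp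
  then have idM: "(\<lambda>x. x) \<in> M \<rightarrow>\<^sub>M ?P" using measurable_cong_sets[OF setsM refl] by blast
  interpret product_sigma_finite "\<lambda>_ :: nat. lborel :: real measure" ..
  have "distr M ?P (\<lambda>x. x) = density ?P (indicator (cube n))"
  proof (rule measure_eqI_PiM_finite[where I = "{..<n}" and A = "\<lambda>_. space ?P" and M = "\<lambda>_. lborel"])
    show "finite {..<n}" by simp
    show "sets (distr M ?P (\<lambda>x. x)) = sets ?P" by simp
    show "sets (density ?P (indicator (cube n))) = sets ?P" by simp
    fix A :: "nat \<Rightarrow> real set" assume A: "\<And>i. i \<in> {..<n} \<Longrightarrow> A i \<in> sets lborel"
    \<comment> \<open>The family A is controlled only below n; it is filled up with
      \<open>UNIV\<close> because \<open>box\<close> asks for Borel sets at every index.\<close>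
    define B where "B k = (if k < n then A k else UNIV)" for k
    have B: "B k \<in> sets borel" for k using A by (simp add: B_def)
    have PA: "Pi\<^sub>E {..<n} A \<in> sets ?P" by (rule sets_PiM_I_finite) (use A in auto)
    have "emeasure (distr M ?P (\<lambda>x. x)) (Pi\<^sub>E {..<n} A) = emeasure M (Pi\<^sub>E {..<n} A \<inter> cube n)"
      using idM PA by (subst emeasure_distr) (simp_all add: spaceM vimage_def)
    also have "Pi\<^sub>E {..<n} A \<inter> cube n = {x \<in> cube n. \<forall>k<n. x k \<in> B k}"
      by (auto simp: cube_def B_def PiE_def Pi_def)
    also have "emeasure M \<dots> = (\<Prod>k<n. emeasure lborel (A k \<inter> {0..1}))"
      unfolding box[OF B] by (rule prod.cong) (auto simp: B_def)
    also have "\<dots> = emeasure ?P (Pi\<^sub>E {..<n} (\<lambda>k. A k \<inter> {0..1}))"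
      by (rule emeasure_PiM[symmetric]) (use A in auto)
    also have "Pi\<^sub>E {..<n} (\<lambda>k. A k \<inter> {0..1}) = cube n \<inter> Pi\<^sub>E {..<n} A"
      by (auto simp: cube_def PiE_def Pi_def)
    also have "emeasure ?P \<dots> = emeasure (density ?P (indicator (cube n))) (Pi\<^sub>E {..<n} A)"
      by (rule emeasure_restricted[symmetric, OF cubeP PA])
    finally show "emeasure (distr M ?P (\<lambda>x. x)) (Pi\<^sub>E {..<n} A) = emeasure (density ?P (indicator (cube n))) (Pi\<^sub>E {..<n} A)" .
  next
    show "range (\<lambda>_ :: nat. space ?P) \<subseteq> prod_algebra {..<n} (\<lambda>_. lborel)"
      using prod_algebraI_finite[of "{..<n}" "\<lambda>_. UNIV" "\<lambda>_. lborel"] by (auto simp: space_PiM)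
    show "(\<Union>i :: nat. space ?P) = space (Pi\<^sub>M {..<n} (\<lambda>_. lborel))" by simp
    show "emeasure (distr M ?P (\<lambda>x. x)) (space ?P) \<noteq> \<infinity>"
    proof -
      have "emeasure (distr M ?P (\<lambda>x. x)) (space ?P) = emeasure M (cube n)"
        using idM sub by (subst emeasure_distr) (simp_all add: spaceM vimage_def Int_absorb1)
      also have "\<dots> = 1" using box[of "\<lambda>_. UNIV"] by simp
      finally show ?thesis by simp
    qed
  qed
  moreover fix X assume X: "X \<in> sets M"
  then obtain Y where Y: "Y \<in> sets ?P" "X = cube n \<inter> Y"
    unfolding setsM lebesgue_cube_def sets_restrict_space by auto
  have XP: "X \<in> sets ?P" using Y cubeP by auto
  have Xc: "X \<subseteq> cube n" using Y by auto
  have "emeasure M X = emeasure (distr M ?P (\<lambda>x. x)) X"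
    using idM XP Xc by (subst emeasure_distr) (simp_all add: spaceM vimage_def Int_absorb2)
  moreover have "emeasure (density ?P (indicator (cube n))) X = emeasure (lebesgue_cube n) X"
    using emeasure_restricted[OF cubeP XP] Xc cubeP sub
    by (simp add: lebesgue_cube_def emeasure_restrict_space Int_absorb1 Int_absorb2)
  ultimately show "emeasure M X = emeasure (lebesgue_cube n) X" by simp
qed

theorem theorem4:
  fixes \<mu> :: "nat \<Rightarrow> (nat \<Rightarrow> real) measure"
  assumes "\<And>n. n \<ge> 1 \<Longrightarrow> borel_measure_on_cube n (\<mu> n)"
    and "\<And>n. n \<ge> 1 \<Longrightarrow> automorphism_invariant n (\<mu> n)"
    and "\<And>n. n \<ge> 1 \<Longrightarrow> detects_pseudotruths n (\<mu> n)"
  shows "(\<forall>n\<ge>2. \<mu> n = lebesgue_cube n) \<and> (coherent \<mu> \<longrightarrow> \<mu> 1 = lebesgue_cube 1)"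
proof (intro conjI allI impI)
  have loc: "cube_measure n (\<mu> n)" if "n \<ge> 1" for n
    using assms that by (simp add: cube_measure_def)
  show "\<mu> n = lebesgue_cube n" if n: "n \<ge> 2" for n
  proof (rule eq_lebesgue_cubeI)
    show "borel_measure_on_cube n (\<mu> n)" using assms(1) n by simp
    show "emeasure (\<mu> n) {x \<in> cube n. \<forall>k<n. x k \<in> B k} = (\<Prod>k<n. emeasure lborel (B k \<inter> {0..1}))"
      if "\<And>k. B k \<in> sets borel" for B
      by (rule cube_measure.emeasure_box[OF loc]) (use n that in auto)
  qed
  \<comment> \<open>A one-dimensional box pulls back to a planar box with free second coordinate,
    whose mass in dimension two is already known.\<close>
  assume "coherent \<mu>"
  then have "\<mu> 1 = distr (\<mu> (Suc 1)) (restrict_space borel (cube 1)) (\<lambda>x. restrict x {..<1})"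
    unfolding coherent_def by blast
  then have coh: "\<mu> 1 = distr (\<mu> 2) (restrict_space borel (cube 1)) (\<lambda>x. restrict x {..<1})"
    by (simp only: Suc_1)
  interpret cube_measure 2 "\<mu> 2" by (rule loc) simp
  show "\<mu> 1 = lebesgue_cube 1"
  proof (rule eq_lebesgue_cubeI)
    show "borel_measure_on_cube 1 (\<mu> 1)" using assms(1) by simp
    fix B :: "nat \<Rightarrow> real set" assume B: "\<And>k. B k \<in> sets borel"
    let ?r = "\<lambda>x :: nat \<Rightarrow> real. restrict x {..<1}"
    have "?r \<in> borel \<rightarrow>\<^sub>M borel"
    proof (rule measurable_coordinatewise_then_product)
      fix k
      show "(\<lambda>x. ?r x k) \<in> borel_measurable borel" by (cases "k < 1") simp_all
    qed
    then have r: "?r \<in> \<mu> 2 \<rightarrow>\<^sub>M restrict_space borel (cube 1)"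
      by (intro measurable_restrict_space2 measurable_M) (auto simp: space_M cube_iff)
    have "{x. x 0 \<in> B 0} = (\<lambda>x :: nat \<Rightarrow> real. x 0) -` B 0 \<inter> space borel" by auto
    also have "\<dots> \<in> sets borel" by (rule measurable_sets[OF coordinate_measurable B])
    finally have "{x. x 0 \<in> B 0} \<in> sets (borel :: (nat \<Rightarrow> real) measure)" .
    then have X: "{x \<in> cube 1. \<forall>k<1. x k \<in> B k} \<in> sets (restrict_space borel (cube 1))"
      unfolding sets_restrict_space by (intro image_eqI[of _ _ "{x. x 0 \<in> B 0}"]) auto
    have "emeasure (\<mu> 1) {x \<in> cube 1. \<forall>k<1. x k \<in> B k} =
        emeasure (\<mu> 2) (?r -` {x \<in> cube 1. \<forall>k<1. x k \<in> B k} \<inter> space (\<mu> 2))"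
      unfolding coh by (rule emeasure_distr[OF r X])
    also have "?r -` {x \<in> cube 1. \<forall>k<1. x k \<in> B k} \<inter> space (\<mu> 2) = {x \<in> cube 2. \<forall>k<1. x k \<in> B k}"
      by (auto simp: space_M cube_iff)
    also have "emeasure (\<mu> 2) \<dots> = (\<Prod>k<1. emeasure lborel (B k \<inter> {0..1}))"
      by (rule emeasure_box) (use B in auto)
    finally show "emeasure (\<mu> 1) {x \<in> cube 1. \<forall>k<1. x k \<in> B k} = (\<Prod>k<1. emeasure lborel (B k \<inter> {0..1}))" .
  qed
qed

end
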